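(* For every finitely generated, right-angled and hyperbolic Coxeter group $\Gamma$ the Davis complex $X$ of $\Gamma$ admits a strongly aperiodic tiling $\Phi$ with finitely many tiles. In addition, every limit tiling of $\Phi$ is also strongly aperiodic.
   Context: Right-angled Coxeter group: a group $\Gamma$ with finite generating set $S$ whose elements have order two, all other relations being consequences of relations $st=ts$ for certain pairs $s,t\in S$. Hyperbolic means Gromov hyperbolic. Davis complex. The nerve $N=N(\Gamma,S)$ is the simplicial complex with vertex set $S$ in which distinct vertices span a simplex iff they commute pairwise. Let $N'$ be its barycentric subdivision and $C=\operatorname{Cone} N'$ (the chamber). The Davis complex $X$ is the image of a simplicial map $q:\Gamma\times C\to X$ defined by the equivalence relation on vertices $a\times v_\sigma\sim b\times v_\sigma$ iff $a^{-1}b\in\Gamma_\sigma$, where $\sigma$ is a simplex of $N$, $v_\sigma$ its barycenter and $\Gamma_\sigma$ the subgroup generated by the vertices of $\sigma$ (cone points are not identified). $\Gamma$ acts on $X$ by $\gamma q(\alpha\times x)=q(\gamma\alpha\times x)$; $X$ is the union of the chambers $\gamma C$, and it carries its standard CAT(0) metric, for which $\Gamma$ acts by isometries. Tilings. A set of tiles $(\mathcal T,\mathcal F)$ is a finite collection $\mathcal T$ of compact $n$-dimensional complexes $t$ and a collection $\mathcal F$ of subcomplexes $f$ (faces) of dimension $<n$, together with an opposition function $o:\mathcal F\to\mathcal F$, $o^2=\mathrm{id}$. A metric space $X$ is tiled by $(\mathcal T,\mathcal F)$ if: (1) $X=\bigcup_\lambda t_\lambda$ with each $t_\lambda$ isometric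 to a tile in $\mathcal T$; (2) $t_\lambda\setminus\bigcup_{f\in t_\lambda}f=\mathrm{Int}(t_\lambda)$ in $X$ for every $\lambda$; (3) if $\mathrm{Int}(t_\lambda\cup t_{\lambda'})\ne\mathrm{Int}(t_\lambda)\cup\mathrm{Int}(t_{\lambda'})$ then $t_\lambda$ and $t_{\lambda'}$ intersect along $f\in t_\lambda$ and $o(f)\in t_{\lambda'}$; (4) there are no free faces of $t_\lambda$. Strictly speaking the tiling is the collection $\{\phi_\lambda\}$ of specified isometries $\phi_\lambda:t_\lambda\to t$, $t\in\mathcal T$, sending $(n-1)$-dimensional faces of $t_\lambda$ to elements of $\mathcal F$; (3) then says that $o(\phi_\lambda(\sigma))=\phi_{\lambda'}(\sigma)$ for a common face $\sigma=t_\lambda\cap t_{\lambda'}$. An isometry $g$ of $X$ mapping every $t_\lambda$ to some $t_{\lambda'}$ (decomposition preserving) induces the tiling $g^*\phi_\lambda=\phi_{\lambda'}\circ g$; $g$ is an isometry of the tiling if $\{g^*\phi_\lambda\}=\{\phi_\lambda\}$. A tiling $\{\psi_\lambda\}$ is a limit tiling of $\{\phi_\lambda\}$ if there is a sequence $g_i$ of decomposition preserving isometries of $X$ such that for every $\lambda$ there is $i_0(\lambda)$ with $\psi_\lambda=g_i^*\phi_\lambda$ for all $i\ge i_0(\lambda)$. A tiling is strongly aperiodic if its group of isometries is trivial. *)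

theory Defs
  imports "HOL-Analysis.Analysis" "HOL-Algebra.Generated_Groups" "HOL-Algebra.Multiplicative_Group"
begin

section \<open>Right-angled Coxeter groups and hyperbolicity\<close>

text \<open>Since the generators are involutions, words in the generators need no inverse letters.\<close>

definition word_value :: "('g, 'm) monoid_scheme \<Rightarrow> 'g list \<Rightarrow> 'g" where
  "word_value G w = foldr (\<lambda>s g. s \<otimes>\<^bsub>G\<^esub> g) w \<one>\<^bsub>G\<^esub>"

inductive racg_move :: "'g set \<Rightarrow> ('g \<times> 'g) set \<Rightarrow> 'g list \<Rightarrow> 'g list \<Rightarrow> bool"
  for S R where
  cancel: "s \<in> S \<Longrightarrow> racg_move S R (u @ [s, s] @ v) (u @ v)"
| commute: "(s, t) \<in> R \<Longrightarrow> racg_move S R (u @ [s, t] @ v) (u @ [t, s] @ v)"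

text \<open>The last conjunct says that every relation \<open>w = 1\<close> between the generators is a consequence
  of \<open>s\<^sup>2 = 1\<close> and of the relations \<open>st = ts\<close> with \<open>(s, t) \<in> R\<close>.\<close>

definition right_angled_coxeter_group :: "('g, 'm) monoid_scheme \<Rightarrow> 'g set \<Rightarrow> bool" where
  "right_angled_coxeter_group G S \<longleftrightarrow>
     group G \<and> finite S \<and> S \<subseteq> carrier G \<and> generate G S = carrier G \<and>
     (\<forall>s\<in>S. group.ord G s = 2) \<and>
     (\<exists>R \<subseteq> S \<times> S.
        (\<forall>(s, t)\<in>R. s \<otimes>\<^bsub>G\<^esub> t = t \<otimes>\<^bsub>G\<^esub> s) \<and>
        (\<forall>w\<in>lists S. word_value G w = \<one>\<^bsub>G\<^esub> \<longrightarrow> equivclp (racg_move S R) w []))"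

definition word_length :: "('g, 'm) monoid_scheme \<Rightarrow> 'g set \<Rightarrow> 'g \<Rightarrow> nat" where
  "word_length G S g = (LEAST n. \<exists>w\<in>lists S. length w = n \<and> word_value G w = g)"

definition word_dist :: "('g, 'm) monoid_scheme \<Rightarrow> 'g set \<Rightarrow> 'g \<Rightarrow> 'g \<Rightarrow> real" where
  "word_dist G S g h = real (word_length G S (inv\<^bsub>G\<^esub> g \<otimes>\<^bsub>G\<^esub> h))"

definition gromov_product :: "('a \<Rightarrow> 'a \<Rightarrow> real) \<Rightarrow> 'a \<Rightarrow> 'a \<Rightarrow> 'a \<Rightarrow> real" where
  "gromov_product d w x y = (d x w + d y w - d x y) / 2"

definition gromov_hyperbolic :: "'a set \<Rightarrow> ('a \<Rightarrow> 'a \<Rightarrow> real) \<Rightarrow> bool" where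
  "gromov_hyperbolic X d \<longleftrightarrow>
     (\<exists>\<delta>\<ge>0. \<forall>x\<in>X. \<forall>y\<in>X. \<forall>z\<in>X. \<forall>w\<in>X.
        gromov_product d w x z \<ge> min (gromov_product d w x y) (gromov_product d w y z) - \<delta>)"

definition hyperbolic_group :: "('g, 'm) monoid_scheme \<Rightarrow> 'g set \<Rightarrow> bool" where
  "hyperbolic_group G S \<longleftrightarrow> gromov_hyperbolic (carrier G) (word_dist G S)"


section \<open>Simplicial complexes\<close>

text \<open>A complex is given by its set of nonempty simplices, a simplex by its set of vertices.\<close>

definition simplicial_complex :: "'v set set \<Rightarrow> bool" where
  "simplicial_complex K \<longleftrightarrow>
     (\<forall>\<sigma>\<in>K. finite \<sigma> \<and> \<sigma> \<noteq> {}) \<and> (\<forall>\<sigma>\<in>K. \<forall>\<tau>. \<tau> \<noteq> {} \<and> \<tau> \<subseteq> \<sigma> \<longrightarrow> \<tau> \<in> K)"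

definition support :: "('v \<Rightarrow> real) \<Rightarrow> 'v set" where
  "support x = {v. x v \<noteq> 0}"

text \<open>Points of the geometric realization are given by their barycentric coordinates.\<close>

definition realization :: "'v set set \<Rightarrow> ('v \<Rightarrow> real) set" where
  "realization K = {x. (\<forall>v. x v \<ge> 0) \<and> support x \<in> K \<and> sum x (support x) = 1}"

definition barycentric_subdivision :: "'v set set \<Rightarrow> 'v set set set" where
  "barycentric_subdivision K = {c. c \<noteq> {} \<and> finite c \<and> c \<subseteq> K \<and> chain_subset c}"

text \<open>The cone point is \<open>None\<close>.\<close>

definition cone :: "'v set set \<Rightarrow> 'v option set set" where
  "cone K = {{None}} \<union> {Some ` \<tau> | \<tau>. \<tau> \<in> K} \<union> {insert None (Some ` \<tau>) | \<tau>. \<tau> \<in> K}"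

text \<open>The intrinsic metric of a connected complex whose simplices carry metrics, all given by \<open>e\<close>:
  the infimum of the lengths of strings \<open>x = p 0, \<dots>, p m = y\<close> with consecutive points in a
  common simplex. It is set to 0 off the realization because the locale \<open>Metric_space\<close>
  requires nonnegativity and symmetry for all arguments.\<close>

definition strings :: "'v set set \<Rightarrow> ('v \<Rightarrow> real) \<Rightarrow> ('v \<Rightarrow> real) \<Rightarrow> (nat \<times> (nat \<Rightarrow> 'v \<Rightarrow> real)) set" where
  "strings K x y =
     {(m, p). p 0 = x \<and> p m = y \<and> (\<forall>i\<le>m. p i \<in> realization K) \<and>
        (\<forall>i<m. \<exists>\<sigma>\<in>K. support (p i) \<subseteq> \<sigma> \<and> support (p (Suc i)) \<subseteq> \<sigma>)}"

definition intrinsic_dist ::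
  "'v set set \<Rightarrow> (('v \<Rightarrow> real) \<Rightarrow> ('v \<Rightarrow> real) \<Rightarrow> real) \<Rightarrow> ('v \<Rightarrow> real) \<Rightarrow> ('v \<Rightarrow> real) \<Rightarrow> real" where
  "intrinsic_dist K e x y =
     (if x \<in> realization K \<and> y \<in> realization K
      then INF (m, p) \<in> strings K x y. \<Sum>i<m. e (p i) (p (Suc i)) else 0)"


section \<open>The Davis complex\<close>

definition nerve :: "('g, 'm) monoid_scheme \<Rightarrow> 'g set \<Rightarrow> 'g set set" where
  "nerve G S = {\<sigma>. \<sigma> \<noteq> {} \<and> finite \<sigma> \<and> \<sigma> \<subseteq> S \<and> (\<forall>s\<in>\<sigma>. \<forall>t\<in>\<sigma>. s \<otimes>\<^bsub>G\<^esub> t = t \<otimes>\<^bsub>G\<^esub> s)}"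

text \<open>The vertices of the chamber are the barycenters \<open>Some \<sigma>\<close> of the simplices \<open>\<sigma>\<close> of the nerve
  and the cone point \<open>None\<close>.\<close>

definition chamber :: "('g, 'm) monoid_scheme \<Rightarrow> 'g set \<Rightarrow> 'g set option set set" where
  "chamber G S = cone (barycentric_subdivision (nerve G S))"

fun vertex_group :: "('g, 'm) monoid_scheme \<Rightarrow> 'g set option \<Rightarrow> 'g set" where
  "vertex_group G None = {\<one>\<^bsub>G\<^esub>}"
| "vertex_group G (Some \<sigma>) = generate G \<sigma>"

definition davis_rel ::
  "('g, 'm) monoid_scheme \<Rightarrow> (('g \<times> 'g set option) \<times> ('g \<times> 'g set option)) set" where
  "davis_rel G = {((a, v), (b, w)). a \<in> carrier G \<and> b \<in> carrier G \<and> v = w \<and>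
      inv\<^bsub>G\<^esub> a \<otimes>\<^bsub>G\<^esub> b \<in> vertex_group G v}"

definition davis_vertex ::
  "('g, 'm) monoid_scheme \<Rightarrow> 'g \<Rightarrow> 'g set option \<Rightarrow> ('g \<times> 'g set option) set" where
  "davis_vertex G a v = davis_rel G `` {(a, v)}"

definition davis_complex ::
  "('g, 'm) monoid_scheme \<Rightarrow> 'g set \<Rightarrow> ('g \<times> 'g set option) set set set" where
  "davis_complex G S = {davis_vertex G a ` \<tau> | a \<tau>. a \<in> carrier G \<and> \<tau> \<in> chamber G S}"

definition davis_space ::
  "('g, 'm) monoid_scheme \<Rightarrow> 'g set \<Rightarrow> (('g \<times> 'g set option) set \<Rightarrow> real) set" where
  "davis_space G S = realization (davis_complex G S)"

text \<open>The standard metric is the cubical one. In each chamber \<open>aC\<close> the simplices on the vertex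
  \<open>None\<close> and the vertices \<open>Some \<tau>\<close>, \<open>\<tau> \<subseteq> \<sigma>\<close>, triangulate the unit cube \<open>[0,1]\<^sup>\<sigma>\<close>, with \<open>Some \<tau>\<close> at the
  indicator vector of \<open>\<tau>\<close> and \<open>None\<close> at the origin. The \<open>s\<close>-coordinate of a vertex depends
  only on its class, hence the following is the affine extension to the simplices of the quotient.\<close>

definition cube_coord :: "(('g \<times> 'g set option) set \<Rightarrow> real) \<Rightarrow> 'g \<Rightarrow> real" where
  "cube_coord x s = (\<Sum>v\<in>{v \<in> support x. \<exists>a \<sigma>. (a, Some \<sigma>) \<in> v \<and> s \<in> \<sigma>}. x v)"

definition davis_dist ::
  "('g, 'm) monoid_scheme \<Rightarrow> 'g set \<Rightarrow> (('g \<times> 'g set option) set \<Rightarrow> real) \<Rightarrow>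
     (('g \<times> 'g set option) set \<Rightarrow> real) \<Rightarrow> real" where
  "davis_dist G S =
     intrinsic_dist (davis_complex G S) (\<lambda>x y. L2_set (\<lambda>s. cube_coord x s - cube_coord y s) S)"


section \<open>Tilings\<close>

text \<open>Tiles are finite simplicial complexes with vertices in \<open>nat\<close>; distinct tiles may share
  subcomplexes, in particular faces. Each tile carries a metric of its own.\<close>

record tile_set =
  tiles :: "nat set set set"
  tile_dist :: "nat set set \<Rightarrow> (nat \<Rightarrow> real) \<Rightarrow> (nat \<Rightarrow> real) \<Rightarrow> real"
  faces :: "nat set set set"
  opposite :: "nat set set \<Rightarrow> nat set set"

definition is_tile_set :: "nat \<Rightarrow> tile_set \<Rightarrow> bool" where
  "is_tile_set n T \<longleftrightarrow>
     finite (tiles T) \<and>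
     (\<forall>K\<in>tiles T. finite K \<and> simplicial_complex K \<and>
        (\<forall>\<sigma>\<in>K. card \<sigma> \<le> n + 1) \<and> (\<exists>\<sigma>\<in>K. card \<sigma> = n + 1) \<and>
        Metric_space (realization K) (tile_dist T K) \<and>
        Metric_space.mtopology (realization K) (tile_dist T K) = top_of_set (realization K)) \<and>
     (\<forall>f\<in>faces T. simplicial_complex f \<and> f \<noteq> {} \<and> (\<forall>\<sigma>\<in>f. card \<sigma> \<le> n) \<and>
        (\<exists>K\<in>tiles T. f \<subseteq> K)) \<and>
     (\<forall>f\<in>faces T. opposite T f \<in> faces T \<and> opposite T (opposite T f) = f)"

text \<open>The pieces are the sets \<open>t\<^sub>\<lambda>\<close>; the map \<open>\<phi>\<^sub>\<lambda>\<close> of the piece \<open>t = t\<^sub>\<lambda>\<close> is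
  \<open>chart \<Phi> t\<close>, restricted to \<open>t\<close>, and its codomain is the tile \<open>target \<Phi> t\<close>.\<close>

record 'x tiling =
  pieces :: "'x set set"
  target :: "'x set \<Rightarrow> nat set set"
  chart :: "'x set \<Rightarrow> 'x \<Rightarrow> nat \<Rightarrow> real"

text \<open>The face of the piece \<open>t\<close> that the chart sends to \<open>f\<close>.\<close>

definition piece_face :: "'x tiling \<Rightarrow> 'x set \<Rightarrow> nat set set \<Rightarrow> 'x set" where
  "piece_face \<Phi> t f = {x \<in> t. chart \<Phi> t x \<in> realization f}"

definition tile_faces :: "tile_set \<Rightarrow> 'x tiling \<Rightarrow> 'x set \<Rightarrow> nat set set set" where
  "tile_faces T \<Phi> t = {f \<in> faces T. f \<subseteq> target \<Phi> t}"

definition is_tiling ::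
  "'x set \<Rightarrow> ('x \<Rightarrow> 'x \<Rightarrow> real) \<Rightarrow> tile_set \<Rightarrow> 'x tiling \<Rightarrow> bool" where
  "is_tiling X d T \<Phi> \<longleftrightarrow>
     (let intr = (\<lambda>A. Metric_space.mtopology X d interior_of A) in
     \<Union>(pieces \<Phi>) = X \<and>
     (\<forall>t\<in>pieces \<Phi>. target \<Phi> t \<in> tiles T \<and>
        bij_betw (chart \<Phi> t) t (realization (target \<Phi> t)) \<and>
        (\<forall>x\<in>t. \<forall>y\<in>t. tile_dist T (target \<Phi> t) (chart \<Phi> t x) (chart \<Phi> t y) = d x y)) \<and>
     (\<forall>t\<in>pieces \<Phi>. t - (\<Union>f\<in>tile_faces T \<Phi> t. piece_face \<Phi> t f) = intr t) \<and>
     (\<forall>t\<in>pieces \<Phi>. \<forall>t'\<in>pieces \<Phi>. intr (t \<union> t') \<noteq> intr t \<union> intr t' \<longrightarrow>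
        (\<exists>f\<in>tile_faces T \<Phi> t. opposite T f \<in> tile_faces T \<Phi> t' \<and>
           t \<inter> t' = piece_face \<Phi> t f \<and> t \<inter> t' = piece_face \<Phi> t' (opposite T f))) \<and>
     (\<forall>t\<in>pieces \<Phi>. \<forall>f\<in>tile_faces T \<Phi> t.
        \<exists>t'\<in>pieces \<Phi> - {t}. \<exists>f'\<in>tile_faces T \<Phi> t'. piece_face \<Phi> t f = piece_face \<Phi> t' f'))"

definition isometry_of :: "'x set \<Rightarrow> ('x \<Rightarrow> 'x \<Rightarrow> real) \<Rightarrow> ('x \<Rightarrow> 'x) \<Rightarrow> bool" where
  "isometry_of X d g \<longleftrightarrow> bij_betw g X X \<and> (\<forall>x\<in>X. \<forall>y\<in>X. d (g x) (g y) = d x y)"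

definition decomposition_preserving ::
  "'x set \<Rightarrow> ('x \<Rightarrow> 'x \<Rightarrow> real) \<Rightarrow> 'x tiling \<Rightarrow> ('x \<Rightarrow> 'x) \<Rightarrow> bool" where
  "decomposition_preserving X d \<Phi> g \<longleftrightarrow> isometry_of X d g \<and> (\<forall>t\<in>pieces \<Phi>. g ` t \<in> pieces \<Phi>)"

definition pullback :: "('x \<Rightarrow> 'x) \<Rightarrow> 'x tiling \<Rightarrow> 'x tiling" where
  "pullback g \<Phi> = \<Phi>\<lparr>target := \<lambda>t. target \<Phi> (g ` t), chart := \<lambda>t. chart \<Phi> (g ` t) \<circ> g\<rparr>"

text \<open>Equality of the maps with domain \<open>t\<close>; they must have the same tile as codomain.\<close>

definition agree_on :: "'x set \<Rightarrow> 'x tiling \<Rightarrow> 'x tiling \<Rightarrow> bool" where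
  "agree_on t \<Phi> \<Psi> \<longleftrightarrow> target \<Phi> t = target \<Psi> t \<and> (\<forall>x\<in>t. chart \<Phi> t x = chart \<Psi> t x)"

text \<open>A tiling has exactly one map with domain \<open>t\<close> for each piece \<open>t\<close>, so two tilings with the
  same pieces are equal as collections of maps iff they agree on every piece.\<close>

definition tiling_isometry ::
  "'x set \<Rightarrow> ('x \<Rightarrow> 'x \<Rightarrow> real) \<Rightarrow> 'x tiling \<Rightarrow> ('x \<Rightarrow> 'x) \<Rightarrow> bool" where
  "tiling_isometry X d \<Phi> g \<longleftrightarrow>
     decomposition_preserving X d \<Phi> g \<and> (\<forall>t\<in>pieces \<Phi>. agree_on t (pullback g \<Phi>) \<Phi>)"

definition strongly_aperiodic ::
  "'x set \<Rightarrow> ('x \<Rightarrow> 'x \<Rightarrow> real) \<Rightarrow> 'x tiling \<Rightarrow> bool" where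
  "strongly_aperiodic X d \<Phi> \<longleftrightarrow> (\<forall>g. tiling_isometry X d \<Phi> g \<longrightarrow> (\<forall>x\<in>X. g x = x))"

definition limit_tiling ::
  "'x set \<Rightarrow> ('x \<Rightarrow> 'x \<Rightarrow> real) \<Rightarrow> tile_set \<Rightarrow> 'x tiling \<Rightarrow> 'x tiling \<Rightarrow> bool" where
  "limit_tiling X d T \<Phi> \<Psi> \<longleftrightarrow>
     is_tiling X d T \<Psi> \<and> pieces \<Psi> = pieces \<Phi> \<and>
     (\<exists>g :: nat \<Rightarrow> 'x \<Rightarrow> 'x. (\<forall>i. decomposition_preserving X d \<Phi> (g i)) \<and>
        (\<forall>t\<in>pieces \<Phi>. \<exists>i0. \<forall>i\<ge>i0. agree_on t \<Psi> (pullback (g i) \<Phi>)))"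

end

theory Submission
  imports Defs
begin

text \<open>The tiles are copies of the chamber, one for each of finitely many colours, and the pieces
are the chambers \<open>a C\<close>; the tile of the piece \<open>a C\<close> is determined by the colour \<open>f a\<close> of \<open>a\<close>. The
tiles share their mirrors and differ only in the name of the cone point, so every mirror may be
opposite to itself, whatever colours it separates. A chart records the type of each vertex. Hence
an isometry that respects the charts maps each chamber as a left translation does, and the
translations on two adjacent chambers agree because the barycentre of the common mirror lies in
exactly two chambers. An isometry of the tiling is thus a left translation that preserves the
colouring \<open>f\<close>.

The question is reduced to a colouring \<open>f\<close> of the group with finitely many colours such that, for
every \<open>d \<noteq> 1\<close>, there is a finite window \<open>W\<close> with the property that each translate \<open>g W\<close> contains a
point \<open>g t\<close> at which \<open>f (g t) \<noteq> f (g d t)\<close>. This uniform form of asymmetry survives in limits.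
Such an \<open>f\<close> exists on every countable group (\<open>exists_limit_aperiodic_colouring\<close>). On an infinite
group one fixes disjoint windows \<open>T n\<close> and \<open>s n T n\<close> with \<open>n + 2\<close> elements for the \<open>n\<close>-th
nontrivial element \<open>s n\<close> and counts colourings of finite sets for which no window repeats: with
eight colours, each new point at least doubles their number (\<open>card_admissible_insert\<close>), because a
repetition on a window that contains the new point determines the colours of \<open>n + 2\<close> points, and
the \<open>n + 1\<close> older ones among them account for a factor \<open>2 ^ (n + 1)\<close> by induction. Compactness
passes to the whole group.

The topology of the Davis complex enters through a single estimate (\<open>weight_Lipschitz\<close>): each
barycentric coordinate is 2-Lipschitz for the intrinsic metric, since on a simplex it is, up to a
constant and a sign, a cube coordinate or a difference of two. It shows that the intrinsic metric
separates points, that it induces the usual topology on a chamber, and that the points of \<open>a C\<close>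
with a positive weight at the cone point of \<open>a C\<close> are interior. Conversely a point of the chamber
\<open>c C\<close> can be pushed slightly towards the cone point of \<open>c C\<close>, so an interior point of a union of
chambers lies in no further chamber. These two facts give the axioms of a tiling
(\<open>is_tiling_chamber_tiling\<close>).

For limits (\<open>limit_tiling_strongly_aperiodic\<close>), let \<open>\<Psi>\<close> be the limit of the pullbacks under \<open>g i\<close>,
and let \<open>h\<close> be an isometry of \<open>\<Psi>\<close> that maps the chamber \<open>a C\<close> to \<open>b C\<close>. On any finite set of
chambers and for large \<open>i\<close>, the conjugate of \<open>h\<close> by \<open>g i\<close> respects the original charts, so it acts
there as a left translation. Since \<open>g i\<close> preserves the relation of touching, the displacement \<open>d\<close>
between the images of \<open>a C\<close> and \<open>b C\<close> stays in a finite set that does not depend on \<open>i\<close>. If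
\<open>d \<noteq> 1\<close>, the window for \<open>d\<close> yields a chamber close to the image of \<open>a C\<close> whose colour differs from
that of its image under the conjugate, a contradiction. So \<open>h\<close> fixes each chamber, and since it
respects an injective chart, each point.\<close>


section \<open>Colourings all of whose limits are aperiodic\<close>

text \<open>The partial sums are \<open>6 - (2 m + 6) / 2 ^ m\<close>. The bound 6 is what makes eight colours
suffice: two are left to double the count.\<close>

lemma sum_weighted_geometric_le: "(\<Sum>n<m. real (n + 2) / 2 ^ n) \<le> 6"
proof -
  have "2 ^ m * (\<Sum>n<m. real (n + 2) / 2 ^ n) = 6 * 2 ^ m - (2 * real m + 6)"
  proof (induction m)
    case (Suc m)
    have "2 ^ Suc m * (\<Sum>n<Suc m. real (n + 2) / 2 ^ n)
        = 2 * (2 ^ m * (\<Sum>n<m. real (n + 2) / 2 ^ n)) + 2 * (real m + 2)"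
      by (simp add: field_simps)
    then show ?case using Suc.IH by simp
  qed simp
  also have "\<dots> \<le> 2 ^ m * 6" by simp
  finally show ?thesis by (simp only: mult_le_cancel_left_pos zero_less_power zero_less_numeral)
qed

text \<open>The window \<open>T n\<close> is where the \<open>n\<close>-th group element \<open>s n\<close> is to be detected. Disjointness
from its translate makes the repetition \<open>f (g t) = f (g (s n t))\<close>, for all \<open>t\<close> in \<open>T n\<close>, a set of
\<open>n + 2\<close> independent equations.\<close>

locale separating_windows = group G for G (structure) +
  fixes T :: "nat \<Rightarrow> 'a set" and s :: "nat \<Rightarrow> 'a"
  assumes T_carrier: "T n \<subseteq> carrier G"
    and s_carrier: "s n \<in> carrier G"
    and card_T: "card (T n) = n + 2"
    and disjoint: "t \<in> T n \<Longrightarrow> t' \<in> T n \<Longrightarrow> t \<noteq> s n \<otimes> t'"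
begin

definition left_window :: "nat \<Rightarrow> 'a \<Rightarrow> 'a set" where
  "left_window n g = (\<lambda>t. g \<otimes> t) ` T n"

definition right_window :: "nat \<Rightarrow> 'a \<Rightarrow> 'a set" where
  "right_window n g = (\<lambda>t. g \<otimes> (s n \<otimes> t)) ` T n"

definition repetitive :: "('a \<Rightarrow> nat) \<Rightarrow> nat \<Rightarrow> 'a \<Rightarrow> bool" where
  "repetitive f n g \<longleftrightarrow> (\<forall>t\<in>T n. f (g \<otimes> t) = f (g \<otimes> (s n \<otimes> t)))"

definition admissible :: "'a set \<Rightarrow> ('a \<Rightarrow> nat) set" where
  "admissible X = {f \<in> X \<rightarrow>\<^sub>E {..<8}.
     \<forall>n. \<forall>g\<in>carrier G. left_window n g \<union> right_window n g \<subseteq> X \<longrightarrow> \<not> repetitive f n g}"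

lemma finite_T: "finite (T n)"
  using card_T[of n] by (metis card.infinite add_2_eq_Suc' nat.distinct(1))

lemma T_in: "t \<in> T n \<Longrightarrow> t \<in> carrier G"
  using T_carrier by blast

lemma finite_windows [simp]: "finite (left_window n g)" "finite (right_window n g)"
  by (simp_all add: left_window_def right_window_def finite_T)

lemma card_windows:
  assumes "g \<in> carrier G"
  shows "card (left_window n g) = n + 2" "card (right_window n g) = n + 2"
proof -
  have "inj_on (\<lambda>t. g \<otimes> t) (T n)"
    using assms by (auto intro!: inj_onI simp: T_in)
  then show "card (left_window n g) = n + 2"
    by (simp add: left_window_def card_image card_T)
  have "inj_on (\<lambda>t. g \<otimes> (s n \<otimes> t)) (T n)"
    using assms by (auto intro!: inj_onI simp: T_in s_carrier)
  then show "card (right_window n g) = n + 2"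
    by (simp add: right_window_def card_image card_T)
qed

lemma windows_disjoint:
  assumes "g \<in> carrier G" shows "left_window n g \<inter> right_window n g = {}"
  using assms disjoint by (auto simp: left_window_def right_window_def T_in s_carrier)

lemma finite_admissible: "finite X \<Longrightarrow> finite (admissible X)"
  unfolding admissible_def by (auto intro!: finite_subset[OF _ finite_PiE[of X "\<lambda>_. {..<8}"]])

text \<open>Whether a window inside \<open>X\<close> is repeated depends on the colours in \<open>X\<close> only.\<close>

lemma admissible_restrict:
  assumes "f \<in> Y \<rightarrow>\<^sub>E {..<8}" "X \<subseteq> Y" "restrict f X' \<in> admissible X'" "X \<subseteq> X'"
  shows "restrict f X \<in> admissible X"
proof -
  have "\<not> repetitive (restrict f X) n g"
    if "g \<in> carrier G" "left_window n g \<union> right_window n g \<subseteq> X" for n g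
  proof -
    have "\<not> repetitive (restrict f X') n g"
      using assms(3,4) that unfolding admissible_def by blast
    moreover have "restrict f X' (g \<otimes> t) = restrict f X (g \<otimes> t)"
      "restrict f X' (g \<otimes> (s n \<otimes> t)) = restrict f X (g \<otimes> (s n \<otimes> t))" if "t \<in> T n" for t
    proof -
      have "g \<otimes> t \<in> X" "g \<otimes> (s n \<otimes> t) \<in> X"
        using that \<open>left_window n g \<union> right_window n g \<subseteq> X\<close>
        by (auto simp: left_window_def right_window_def)
      then show "restrict f X' (g \<otimes> t) = restrict f X (g \<otimes> t)"
        "restrict f X' (g \<otimes> (s n \<otimes> t)) = restrict f X (g \<otimes> (s n \<otimes> t))"
        using assms(4) by auto
    qed
    ultimately show ?thesis by (simp add: repetitive_def)
  qed
  moreover have "restrict f X \<in> X \<rightarrow>\<^sub>E {..<8}"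
    using assms(1,2) by (auto simp: PiE_def Pi_def)
  ultimately show ?thesis by (auto simp: admissible_def)
qed

text \<open>A repetition copies either window to the other one, so the colours on one of them may be
forgotten.\<close>

lemma repetitive_determined:
  assumes g: "g \<in> carrier G" and W: "left_window n g \<union> right_window n g \<subseteq> X"
    and f: "f \<in> X \<rightarrow>\<^sub>E C" "repetitive f n g" and f': "f' \<in> X \<rightarrow>\<^sub>E C" "repetitive f' n g"
    and H: "H = left_window n g \<or> H = right_window n g"
    and eq: "restrict f (X - H) = restrict f' (X - H)"
  shows "f = f'"
proof -
  have off: "f x = f' x" if "x \<in> X - H" for x
    using eq that by (metis restrict_apply)
  have disj: "left_window n g \<inter> right_window n g = {}"
    using windows_disjoint[OF g] .
  have pair: "f (g \<otimes> t) = f' (g \<otimes> t) \<and> f (g \<otimes> (s n \<otimes> t)) = f' (g \<otimes> (s n \<otimes> t))"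
    if "t \<in> T n" for t
  proof -
    have l: "g \<otimes> t \<in> left_window n g" and r: "g \<otimes> (s n \<otimes> t) \<in> right_window n g"
      using that by (auto simp: left_window_def right_window_def)
    have "f (g \<otimes> t) = f (g \<otimes> (s n \<otimes> t))" "f' (g \<otimes> t) = f' (g \<otimes> (s n \<otimes> t))"
      using f f' that by (auto simp: repetitive_def)
    moreover have "g \<otimes> t \<in> X - H \<or> g \<otimes> (s n \<otimes> t) \<in> X - H"
      using H l r W disj by blast
    ultimately show ?thesis using off by metis
  qed
  have "f x = f' x" if "x \<in> X" for x
  proof (cases "x \<in> H")
    case True
    then show ?thesis using H pair by (auto simp: left_window_def right_window_def)
  next
    case False
    then show ?thesis using off that by blast
  qed
  then show ?thesis using f(1) f'(1) by (metis PiE_ext)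
qed

text \<open>Rosenfeld's counting argument. Of the \<open>8\<close> times as many extensions to \<open>v\<close>, the bad ones
repeat a window of some index \<open>n\<close> that contains \<open>v\<close>. There are at most \<open>2 (n + 2)\<close> such windows
for each \<open>n\<close>, and each is responsible for at most a fraction \<open>1 / 2 ^ (n + 1)\<close> of the colourings
of \<open>X\<close>, because forgetting the half that contains \<open>v\<close> is injective and removes \<open>n + 1\<close> points of
\<open>X\<close>, each of which had at least doubled the number of colourings. The fractions add up to at most
6.\<close>

lemma card_admissible_insert:
  assumes X: "finite X" "X \<subseteq> carrier G" and v: "v \<in> carrier G" "v \<notin> X"
    and growth: "\<And>Y. Y \<subseteq> X \<Longrightarrow> 2 ^ card (X - Y) * card (admissible Y) \<le> card (admissible X)"
  shows "2 * card (admissible X) \<le> card (admissible (insert v X))"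
proof -
  define X' where "X' = insert v X"
  define Ext where "Ext = {f \<in> X' \<rightarrow>\<^sub>E {..<8}. restrict f X \<in> admissible X}"
  define B where "B n = {g \<in> carrier G. v \<in> left_window n g \<union> right_window n g \<and>
                            left_window n g \<union> right_window n g \<subseteq> X'}" for n
  define Bad where "Bad n g = {f \<in> Ext. repetitive f n g}" for n g
  have finX': "finite X'" using X by (simp add: X'_def)
  have finExt: "finite Ext"
    unfolding Ext_def using finX' by (auto intro!: finite_subset[OF _ finite_PiE[of X' "\<lambda>_. {..<8}"]])
  have cardExt: "card Ext = 8 * card (admissible X)"
  proof -
    have "bij_betw (\<lambda>(f, c). f(v := c)) (admissible X \<times> {..<8}) Ext"
    proof (rule bij_betw_byWitness[where f' = "\<lambda>f. (restrict f X, f v)"])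
      have "restrict (f(v := c)) X = f" if "f \<in> admissible X" for f c
        using that v by (auto simp: admissible_def PiE_def extensional_def)
      then show "\<forall>p\<in>admissible X \<times> {..<8}.
          (restrict (case p of (f, c) \<Rightarrow> f(v := c)) X, (case p of (f, c) \<Rightarrow> f(v := c)) v) = p"
        and "(\<lambda>(f, c). f(v := c)) ` (admissible X \<times> {..<8}) \<subseteq> Ext"
        by (auto simp: Ext_def X'_def admissible_def PiE_def Pi_def extensional_def)
      show "\<forall>f\<in>Ext. (case (restrict f X, f v) of (f, c) \<Rightarrow> f(v := c)) = f"
        by (auto simp: Ext_def X'_def PiE_def extensional_def fun_eq_iff)
      show "(\<lambda>f. (restrict f X, f v)) ` Ext \<subseteq> admissible X \<times> {..<8}"
        by (auto simp: Ext_def X'_def PiE_def Pi_def)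
    qed
    then have "card Ext = card (admissible X \<times> {..<8::nat})"
      using bij_betw_same_card by fastforce
    then show ?thesis by (simp add: card_cartesian_product)
  qed
  have small: "n < card X" if "g \<in> B n" for n g
  proof -
    have "left_window n g \<subseteq> X'" "g \<in> carrier G" using that by (auto simp: B_def)
    then have "n + 2 \<le> card X'"
      using card_mono[OF finX'] card_windows by metis
    then show ?thesis using X v by (simp add: X'_def)
  qed
  \<comment> \<open>a repetition away from \<open>v\<close> would already occur in \<open>X\<close>\<close>
  have cover: "Ext \<subseteq> admissible X' \<union> (\<Union>n<card X. \<Union>g\<in>B n. Bad n g)"
  proof
    fix f assume f: "f \<in> Ext"
    show "f \<in> admissible X' \<union> (\<Union>n<card X. \<Union>g\<in>B n. Bad n g)"
    proof (cases "f \<in> admissible X'")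
      case False
      then obtain n g where g: "g \<in> carrier G" "left_window n g \<union> right_window n g \<subseteq> X'"
        "repetitive f n g"
        using f by (auto simp: admissible_def Ext_def)
      have "v \<in> left_window n g \<union> right_window n g"
      proof (rule ccontr)
        assume "v \<notin> left_window n g \<union> right_window n g"
        then have W: "left_window n g \<union> right_window n g \<subseteq> X" using g by (auto simp: X'_def)
        then have "repetitive (restrict f X) n g"
          using g(3) by (auto simp: repetitive_def left_window_def right_window_def)
        then show False using f W g by (auto simp: Ext_def admissible_def)
      qed
      then have "g \<in> B n" using g by (auto simp: B_def)
      moreover have "f \<in> Bad n g" using f g by (auto simp: Bad_def)
      ultimately show ?thesis using small by blast
    qed auto
  qed
  have cardB: "card (B n) \<le> 2 * (n + 2) \<and> finite (B n)" for n
  proof -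
    have "B n \<subseteq> (\<lambda>t. v \<otimes> inv t) ` T n \<union> (\<lambda>t. v \<otimes> inv (s n \<otimes> t)) ` T n"
    proof
      fix g assume "g \<in> B n"
      then consider t where "t \<in> T n" "v = g \<otimes> t" "g \<in> carrier G"
        | t where "t \<in> T n" "v = g \<otimes> (s n \<otimes> t)" "g \<in> carrier G"
        by (auto simp: B_def left_window_def right_window_def)
      then show "g \<in> (\<lambda>t. v \<otimes> inv t) ` T n \<union> (\<lambda>t. v \<otimes> inv (s n \<otimes> t)) ` T n"
      proof cases
        case 1
        then have "g = v \<otimes> inv t" by (simp add: T_in m_assoc)
        then show ?thesis using 1 by blast
      next
        case 2
        then have "g = v \<otimes> inv (s n \<otimes> t)" by (metis T_in inv_solve_right m_closed s_carrier)
        then show ?thesis using 2 by blast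
      qed
    qed
    moreover have "card ((\<lambda>t. v \<otimes> inv t) ` T n \<union> (\<lambda>t. v \<otimes> inv (s n \<otimes> t)) ` T n) \<le> (n + 2) + (n + 2)"
      by (rule order_trans[OF card_Un_le])
        (metis add_mono card_image_le[OF finite_T] card_T)
    ultimately show ?thesis
      by (smt (verit, best) card_mono finite_T finite_Un finite_imageI mult_2 order_trans finite_subset)
  qed
  have cardBad: "card (Bad n g) * 2 ^ (n + 1) \<le> card (admissible X)" if g: "g \<in> B n" for n g
  proof -
    define H where "H = (if v \<in> left_window n g then left_window n g else right_window n g)"
    have gc: "g \<in> carrier G" using g by (simp add: B_def)
    have H: "H = left_window n g \<or> H = right_window n g" "v \<in> H" "H \<subseteq> X'" "card H = n + 2" "finite H"
      using g by (auto simp: H_def B_def card_windows)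
    define Y where "Y = X' - H"
    have Y: "Y \<subseteq> X" using H by (auto simp: Y_def X'_def)
    have "inj_on (\<lambda>f. restrict f Y) (Bad n g)"
    proof (rule inj_onI)
      fix f f' assume "f \<in> Bad n g" "f' \<in> Bad n g" and eq: "restrict f Y = restrict f' Y"
      then have f: "f \<in> X' \<rightarrow>\<^sub>E {..<8}" "repetitive f n g" "f' \<in> X' \<rightarrow>\<^sub>E {..<8}" "repetitive f' n g"
        by (simp_all add: Bad_def Ext_def)
      have W: "left_window n g \<union> right_window n g \<subseteq> X'" using g by (simp add: B_def)
      show "f = f'"
        using repetitive_determined[OF gc W f H(1)] eq by (simp add: Y_def)
    qed
    moreover have "(\<lambda>f. restrict f Y) ` Bad n g \<subseteq> admissible Y"
      using admissible_restrict[of _ X' Y X] Y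
      by (auto simp: Bad_def Ext_def X'_def)
    ultimately have "card (Bad n g) \<le> card (admissible Y)"
      using finite_admissible[of Y] X Y by (metis card_inj_on_le finite_subset)
    moreover have "card (X - Y) = n + 1"
    proof -
      have "X - Y = H - {v}" using H v by (auto simp: Y_def X'_def)
      then show ?thesis using H by simp
    qed
    ultimately have "card (Bad n g) * 2 ^ (n + 1) \<le> card (admissible Y) * 2 ^ (n + 1)"
      "card (admissible Y) * 2 ^ (n + 1) \<le> card (admissible X)"
      using growth[OF Y] by (auto simp only: mult_le_mono1 mult.commute)
    then show ?thesis by (rule order_trans)
  qed
  have "real (card Ext) \<le> card (admissible X') + (\<Sum>n<card X. \<Sum>g\<in>B n. real (card (Bad n g)))"
  proof -
    have fin: "finite (\<Union>g\<in>B n. Bad n g)" for n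
      using finExt by (rule finite_subset[rotated]) (auto simp: Bad_def)
    have "card Ext \<le> card (admissible X' \<union> (\<Union>n<card X. \<Union>g\<in>B n. Bad n g))"
      using cover by (rule card_mono[rotated]) (use fin finite_admissible[OF finX'] in auto)
    also have "\<dots> \<le> card (admissible X') + card (\<Union>n<card X. \<Union>g\<in>B n. Bad n g)"
      by (rule card_Un_le)
    also have "card (\<Union>n<card X. \<Union>g\<in>B n. Bad n g) \<le> (\<Sum>n<card X. card (\<Union>g\<in>B n. Bad n g))"
      by (rule card_UN_le) simp
    also have "\<dots> \<le> (\<Sum>n<card X. \<Sum>g\<in>B n. card (Bad n g))"
      by (intro sum_mono card_UN_le) (use cardB in blast)
    finally show ?thesis
      by (simp flip: of_nat_sum of_nat_add)
  qed
  also have "(\<Sum>n<card X. \<Sum>g\<in>B n. real (card (Bad n g)))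
      \<le> (\<Sum>n<card X. real (n + 2) / 2 ^ n * card (admissible X))"
  proof (rule sum_mono)
    fix n
    have "(\<Sum>g\<in>B n. real (card (Bad n g))) \<le> (\<Sum>g\<in>B n. card (admissible X) / 2 ^ (n + 1))"
    proof (rule sum_mono)
      fix g assume "g \<in> B n"
      from cardBad[OF this] have "real (card (Bad n g) * 2 ^ (n + 1)) \<le> card (admissible X)"
        using of_nat_mono by blast
      then show "real (card (Bad n g)) \<le> card (admissible X) / 2 ^ (n + 1)"
        by (simp add: field_simps)
    qed
    also have "\<dots> = card (B n) * (card (admissible X) / 2 ^ (n + 1))" by simp
    also have "\<dots> \<le> (2 * (n + 2)) * (card (admissible X) / 2 ^ (n + 1))"
      using cardB[of n] by (intro mult_right_mono) (auto simp flip: of_nat_mult of_nat_add)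
    also have "\<dots> = real (n + 2) / 2 ^ n * card (admissible X)" by (simp add: field_simps)
    finally show "(\<Sum>g\<in>B n. real (card (Bad n g))) \<le> real (n + 2) / 2 ^ n * card (admissible X)" .
  qed
  also have "\<dots> = (\<Sum>n<card X. real (n + 2) / 2 ^ n) * card (admissible X)"
    by (simp add: sum_distrib_right)
  also have "\<dots> \<le> 6 * real (card (admissible X))"
    using sum_weighted_geometric_le[of "card X"] by (intro mult_right_mono) auto
  finally show ?thesis using cardExt by (simp add: X'_def)
qed

lemma card_admissible_growth:
  assumes "finite X" "X \<subseteq> carrier G" "Y \<subseteq> X"
  shows "2 ^ card (X - Y) * card (admissible Y) \<le> card (admissible X)"
  using assms
proof (induction "card X" arbitrary: X Y rule: less_induct)
  case less
  show ?case
  proof (cases "Y = X")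
    case False
    then obtain v where v: "v \<in> X" "v \<notin> Y" using less.prems by blast
    define X1 where "X1 = X - {v}"
    have X1: "card X1 < card X" "finite X1" "X1 \<subseteq> carrier G" "Y \<subseteq> X1" "v \<in> carrier G" "v \<notin> X1"
      "insert v X1 = X"
      using v less.prems card_Diff1_less[of X v] by (auto simp: X1_def)
    have "2 * card (admissible X1) \<le> card (admissible X)"
      using card_admissible_insert[of X1 v] less.hyps[OF X1(1-3)] X1 by auto
    moreover have "2 ^ card (X1 - Y) * card (admissible Y) \<le> card (admissible X1)"
      using less.hyps[OF X1(1-3)] X1 by blast
    moreover have "card (X - Y) = Suc (card (X1 - Y))"
    proof -
      have "X - Y = insert v (X1 - Y)" using v X1 by auto
      then show ?thesis using X1 by simp
    qed
    ultimately show ?thesis by simp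
  qed simp
qed

lemma admissible_nonempty:
  assumes "finite X" "X \<subseteq> carrier G" shows "admissible X \<noteq> {}"
proof -
  have "left_window n g \<noteq> {}" for n g
    using card_T[of n] by (force simp: left_window_def)
  then have "admissible {} = {\<lambda>_. undefined}"
    by (auto simp: admissible_def)
  then show ?thesis
    using card_admissible_growth[OF assms, of "{}"] by force
qed

text \<open>By Tychonoff's theorem the colourings form a compact space, in which avoiding one repetition
is a closed condition; finitely many of these conditions concern a finite set of points.\<close>

lemma exists_nonrepetitive_colouring:
  "\<exists>f :: 'a \<Rightarrow> nat. (\<forall>x. f x < 8) \<and> (\<forall>n. \<forall>g\<in>carrier G. \<not> repetitive f n g)"
proof -
  define K :: "('a \<Rightarrow> nat) set" where "K = UNIV \<rightarrow>\<^sub>E {..<8}"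
  define N where "N = (\<lambda>(n, g). {f. \<not> repetitive f n g})"
  have compact_K: "compact K"
  proof -
    have "compactin (product_topology (\<lambda>_. euclidean) UNIV) K"
      unfolding K_def compactin_PiE by (auto intro: finite_imp_compact)
    then show ?thesis by (simp add: euclidean_product_topology)
  qed
  have closed_N: "closed (N p)" for p
  proof -
    obtain n g where p: "p = (n, g)" by force
    have "closed {f :: 'a \<Rightarrow> nat. f x \<noteq> f y}" for x y
    proof -
      have "open {f :: 'a \<Rightarrow> nat. f x = f y}"
      proof -
        have "{f :: 'a \<Rightarrow> nat. f x = f y} = (\<Union>c. (\<lambda>f. f x) -` {c} \<inter> (\<lambda>f. f y) -` {c})" by auto
        moreover have op: "open ((\<lambda>f :: 'a \<Rightarrow> nat. f z) -` {c})" for z c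
          by (intro open_vimage continuous_on_product_coordinates) (simp add: open_discrete)
        ultimately show ?thesis by (simp only:) (intro open_UN open_Int ballI op)
      qed
      then show ?thesis by (simp add: closed_def Collect_neg_eq[symmetric])
    qed
    moreover have "N p = (\<Union>t\<in>T n. {f. f (g \<otimes> t) \<noteq> f (g \<otimes> (s n \<otimes> t))})"
      by (auto simp: N_def p repetitive_def)
    ultimately show ?thesis using finite_T by auto
  qed
  have fip: "K \<inter> \<Inter>F \<noteq> {}" if F: "finite F" "F \<subseteq> N ` (UNIV \<times> carrier G)" for F
  proof -
    obtain P where P: "finite P" "P \<subseteq> UNIV \<times> carrier G" "F = N ` P"
      using F finite_subset_image by metis
    define X where "X = (\<Union>(n, g)\<in>P. left_window n g \<union> right_window n g)"
    have "finite X" using P by (auto simp: X_def)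
    moreover have "X \<subseteq> carrier G"
      using P by (auto simp: X_def left_window_def right_window_def T_in s_carrier)
    ultimately obtain f where f: "f \<in> admissible X" using admissible_nonempty by blast
    \<comment> \<open>\<open>f\<close> has the value \<open>undefined\<close> off \<open>X\<close>, which need not be one of the eight colours\<close>
    define f' where "f' = (\<lambda>x. if x \<in> X then f x else 0)"
    have "f' \<in> K" using f by (auto simp: K_def f'_def admissible_def)
    moreover have "f' \<in> N p" if "p \<in> P" for p
    proof -
      obtain n g where p: "p = (n, g)" by force
      have sub: "left_window n g \<union> right_window n g \<subseteq> X" "g \<in> carrier G"
        using that p P by (auto simp: X_def)
      then have "repetitive f' n g = repetitive f n g"
        by (auto simp: repetitive_def f'_def left_window_def right_window_def)
      then show ?thesis using f sub by (auto simp: N_def p admissible_def)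
    qed
    ultimately show ?thesis using P by blast
  qed
  have "K \<inter> \<Inter>(N ` (UNIV \<times> carrier G)) \<noteq> {}"
    by (rule compact_imp_fip[OF compact_K _ fip]) (use closed_N in auto)
  then obtain f where f: "f \<in> K" "\<And>n g. g \<in> carrier G \<Longrightarrow> f \<in> N (n, g)"
    by fast
  then show ?thesis by (intro exI[of _ f]) (auto simp: K_def N_def)
qed

end

text \<open>Points are chosen greedily; each one excludes only finitely many later choices.\<close>

lemma (in group) exists_separating_window:
  assumes inf: "infinite (carrier G)" and a: "a \<in> carrier G" "a \<noteq> \<one>"
  shows "\<exists>T \<subseteq> carrier G. card T = n \<and> finite T \<and> (\<forall>t\<in>T. \<forall>t'\<in>T. t \<noteq> a \<otimes> t')"
proof (induction n)
  case 0
  show ?case by (intro exI[of _ "{}"]) auto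
next
  case (Suc n)
  then obtain T where T: "T \<subseteq> carrier G" "card T = n" "finite T"
    "\<And>t t'. t \<in> T \<Longrightarrow> t' \<in> T \<Longrightarrow> t \<noteq> a \<otimes> t'"
    by blast
  have "finite (T \<union> (\<lambda>t. a \<otimes> t) ` T \<union> (\<lambda>t. inv a \<otimes> t) ` T)" using T by simp
  then have "\<not> carrier G \<subseteq> T \<union> (\<lambda>t. a \<otimes> t) ` T \<union> (\<lambda>t. inv a \<otimes> t) ` T"
    using inf finite_subset by blast
  then obtain u where u: "u \<in> carrier G" "u \<notin> T" "u \<notin> (\<lambda>t. a \<otimes> t) ` T" "u \<notin> (\<lambda>t. inv a \<otimes> t) ` T"
    by blast
  have "u \<noteq> a \<otimes> u" using a u by simp
  moreover have "t \<noteq> a \<otimes> u" if "t \<in> T" for t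
  proof
    assume "t = a \<otimes> u"
    then have "u = inv a \<otimes> t" using a u by (simp add: m_assoc[symmetric])
    then show False using u that by blast
  qed
  ultimately show ?case using T u by (intro exI[of _ "insert u T"]) auto
qed

text \<open>On a finite group an injective colouring has the property with the window \<open>{1}\<close>.\<close>

lemma (in group) exists_limit_aperiodic_colouring:
  assumes "countable (carrier G)"
  shows "\<exists>k (f :: 'a \<Rightarrow> nat). (\<forall>x\<in>carrier G. f x < k) \<and>
    (\<forall>a\<in>carrier G - {\<one>}. \<exists>W \<subseteq> carrier G. finite W \<and>
       (\<forall>g\<in>carrier G. \<exists>t\<in>W. f (g \<otimes> t) \<noteq> f (g \<otimes> (a \<otimes> t))))"
proof (cases "finite (carrier G)")
  case True
  then obtain f :: "'a \<Rightarrow> nat" and k where f: "inj_on f (carrier G)" "f ` carrier G = {i. i < k}"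
    using finite_imp_inj_to_nat_seg by blast
  have "\<exists>W \<subseteq> carrier G. finite W \<and> (\<forall>g\<in>carrier G. \<exists>t\<in>W. f (g \<otimes> t) \<noteq> f (g \<otimes> (a \<otimes> t)))"
    if "a \<in> carrier G - {\<one>}" for a
  proof -
    have "f g \<noteq> f (g \<otimes> a)" if "g \<in> carrier G" for g
      using f(1) that \<open>a \<in> carrier G - {\<one>}\<close> by (auto dest!: inj_onD)
    then show ?thesis using that by (intro exI[of _ "{\<one>}"]) auto
  qed
  moreover have "\<forall>x\<in>carrier G. f x < k" using f(2) by auto
  ultimately show ?thesis by blast
next
  case False
  define s where "s = from_nat_into (carrier G - {\<one>})"
  have "infinite (carrier G - {\<one>})" using False by simp
  then have ne: "carrier G - {\<one>} \<noteq> {}" using finite.emptyI by metis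
  have rng: "range s = carrier G - {\<one>}"
    unfolding s_def using assms ne by (intro range_from_nat_into) auto
  have "\<exists>T. \<forall>n. T n \<subseteq> carrier G \<and> card (T n) = n + 2 \<and> (\<forall>t\<in>T n. \<forall>t'\<in>T n. t \<noteq> s n \<otimes> t')"
  proof (intro choice allI)
    fix n
    have "s n \<in> carrier G" "s n \<noteq> \<one>" using rng by auto
    then show "\<exists>T. T \<subseteq> carrier G \<and> card T = n + 2 \<and> (\<forall>t\<in>T. \<forall>t'\<in>T. t \<noteq> s n \<otimes> t')"
      using exists_separating_window[OF False, of "s n" "n + 2"] by blast
  qed
  then obtain T where T: "\<And>n. T n \<subseteq> carrier G" "\<And>n. card (T n) = n + 2"
    "\<And>n t t'. t \<in> T n \<Longrightarrow> t' \<in> T n \<Longrightarrow> t \<noteq> s n \<otimes> t'" by blast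
  interpret separating_windows G T s
    by unfold_locales (use T rng in auto)
  obtain f where f: "\<And>x. f x < 8" "\<And>n g. g \<in> carrier G \<Longrightarrow> \<not> repetitive f n g"
    using exists_nonrepetitive_colouring by blast
  have "\<exists>W \<subseteq> carrier G. finite W \<and> (\<forall>g\<in>carrier G. \<exists>t\<in>W. f (g \<otimes> t) \<noteq> f (g \<otimes> (a \<otimes> t)))"
    if a: "a \<in> carrier G - {\<one>}" for a
  proof -
    obtain n where "a = s n" using a rng by (metis rangeE)
    then show ?thesis using f(2) T(1) finite_T
      by (intro exI[of _ "T n"]) (auto simp: repetitive_def)
  qed
  then show ?thesis using f(1) by blast
qed


section \<open>Linear maps of realizations and intrinsic metrics\<close>

text \<open>The affine extension of a map of vertices to the realization: the weights of vertices with
the same image are added.\<close>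

definition push :: "('v \<Rightarrow> 'w) \<Rightarrow> ('v \<Rightarrow> real) \<Rightarrow> 'w \<Rightarrow> real" where
  "push f x w = (\<Sum>v | v \<in> support x \<and> f v = w. x v)"

lemma realizationD:
  assumes "simplicial_complex K" "x \<in> realization K"
  shows "finite (support x)" "support x \<noteq> {}" "support x \<in> K" "x v \<ge> 0"
  using assms by (auto simp: realization_def simplicial_complex_def)

lemma push_eq_sum:
  assumes "finite A" "support x \<subseteq> A"
  shows "push f x w = (\<Sum>v | v \<in> A \<and> f v = w. x v)"
  unfolding push_def using assms
  by (intro sum.mono_neutral_left) (auto simp: support_def)

lemma support_push_subset: "support (push f x) \<subseteq> f ` support x"
proof
  fix w assume "w \<in> support (push f x)"
  then have "push f x w \<noteq> 0" by (simp add: support_def)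
  then have "{v. v \<in> support x \<and> f v = w} \<noteq> {}"
    unfolding push_def by (metis sum.empty)
  then show "w \<in> f ` support x" by auto
qed

lemma support_push:
  assumes "finite (support x)" "\<And>v. x v \<ge> 0"
  shows "support (push f x) = f ` support x"
proof
  show "f ` support x \<subseteq> support (push f x)"
  proof
    fix w assume "w \<in> f ` support x"
    then obtain v where v: "v \<in> support x" "w = f v" by blast
    have "x v \<le> push f x w"
      unfolding push_def using assms v by (intro member_le_sum) auto
    moreover have "x v > 0" using v assms(2)[of v] by (auto simp: support_def less_le)
    ultimately show "w \<in> support (push f x)" by (auto simp: support_def)
  qed
qed (rule support_push_subset)

lemma sum_push:
  assumes "finite (support x)" "finite W"
  shows "(\<Sum>w\<in>W. push f x w) = (\<Sum>v | v \<in> support x \<and> f v \<in> W. x v)"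
proof (cases "finite W")
  case True
  have "(\<Sum>v | v \<in> support x \<and> f v \<in> W. x v)
      = (\<Sum>w\<in>W. \<Sum>v | v \<in> {v \<in> support x. f v \<in> W} \<and> f v = w. x v)"
    using True assms(1) by (intro sum.group[symmetric]) auto
  also have "\<dots> = (\<Sum>w\<in>W. push f x w)"
    unfolding push_def by (intro sum.cong refl) auto
  finally show ?thesis by simp
next
  case False
  then show ?thesis using assms(2) by (metis finite.emptyI equals0I)
qed

lemma push_in_realization:
  assumes K: "simplicial_complex K" and x: "x \<in> realization K" and f: "f ` support x \<in> L"
  shows "push f x \<in> realization L"
proof -
  note x' = realizationD[OF K x]
  have sp: "support (push f x) = f ` support x" by (rule support_push) (use x' in auto)
  have "sum (push f x) (support (push f x)) = (\<Sum>v | v \<in> support x \<and> f v \<in> f ` support x. x v)"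
    unfolding sp using x' by (intro sum_push) auto
  also have "{v. v \<in> support x \<and> f v \<in> f ` support x} = support x" by auto
  also have "sum x (support x) = 1" using x by (simp add: realization_def)
  finally have "sum (push f x) (support (push f x)) = 1" .
  moreover have "push f x w \<ge> 0" for w using x' by (simp add: push_def sum_nonneg)
  ultimately show ?thesis using f sp by (simp add: realization_def)
qed

lemma push_push:
  assumes "finite (support x)"
  shows "push g (push f x) = push (g \<circ> f) x"
proof
  fix u
  have "push g (push f x) u = (\<Sum>w | w \<in> f ` support x \<and> g w = u. push f x w)"
    using assms by (intro push_eq_sum support_push_subset) auto
  also have "\<dots> = (\<Sum>v | v \<in> support x \<and> f v \<in> {w. w \<in> f ` support x \<and> g w = u}. x v)"
    using assms by (intro sum_push) auto
  also have "\<dots> = push (g \<circ> f) x u"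
    unfolding push_def by (intro sum.cong) auto
  finally show "push g (push f x) u = push (g \<circ> f) x u" .
qed

lemma push_cong: "(\<And>v. v \<in> support x \<Longrightarrow> f v = g v) \<Longrightarrow> push f x = push g x"
  unfolding push_def by (intro ext sum.cong) auto

text \<open>An injective vertex map transports the weights unchanged, also the zero weights of vertices
outside the support.\<close>

lemma push_inj_apply:
  assumes "inj_on f A" "support x \<subseteq> A" "v \<in> A"
  shows "push f x (f v) = x v"
proof (cases "v \<in> support x")
  case True
  then have "{u. u \<in> support x \<and> f u = f v} = {v}" using assms by (auto dest: inj_onD)
  then show ?thesis by (simp add: push_def)
next
  case False
  then have "{u. u \<in> support x \<and> f u = f v} = {}" using assms by (auto dest: inj_onD)
  then have "push f x (f v) = 0" by (simp only: push_def sum.empty)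
  then show ?thesis using False by (simp add: support_def)
qed

lemma push_id:
  assumes "\<And>v. v \<in> support x \<Longrightarrow> f v = v" shows "push f x = x"
proof
  fix w
  have "{v. v \<in> support x \<and> f v = w} = (if w \<in> support x then {w} else {})"
    using assms by auto
  then show "push f x w = x w" by (auto simp: push_def support_def)
qed

lemma push_inverse:
  assumes "finite (support x)" "\<And>v. v \<in> support x \<Longrightarrow> g (f v) = v"
  shows "push g (push f x) = x"
  using assms by (simp add: push_push push_id)

definition vertex_point :: "'v \<Rightarrow> 'v \<Rightarrow> real" where
  "vertex_point v = (\<lambda>w. if w = v then 1 else 0)"

lemma support_vertex_point [simp]: "support (vertex_point v) = {v}"
  by (auto simp: support_def vertex_point_def)

lemma vertex_point_in_realization: "{v} \<in> K \<Longrightarrow> vertex_point v \<in> realization K"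
  using support_vertex_point[of v] unfolding realization_def by (auto simp: vertex_point_def)

lemma push_vertex_point [simp]: "push f (vertex_point v) = vertex_point (f v)"
proof
  fix w
  have "{u. u \<in> support (vertex_point v) \<and> f u = w} = (if w = f v then {v} else {})" by auto
  then show "push f (vertex_point v) w = vertex_point (f v) w"
    by (simp add: push_def vertex_point_def)
qed

lemma vertex_point_inject [simp]: "vertex_point v = vertex_point w \<longleftrightarrow> v = w"
  by (metis singleton_inject support_vertex_point)

text \<open>The quantity minimized in the definition of the intrinsic distance.\<close>

definition string_length :: "('p \<Rightarrow> 'p \<Rightarrow> real) \<Rightarrow> nat \<times> (nat \<Rightarrow> 'p) \<Rightarrow> real" where
  "string_length e mp = (\<Sum>i<fst mp. e (snd mp i) (snd mp (Suc i)))"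

lemma intrinsic_dist_eq:
  "intrinsic_dist K e x y = (if x \<in> realization K \<and> y \<in> realization K
     then Inf (string_length e ` strings K x y) else 0)"
  by (simp add: intrinsic_dist_def string_length_def case_prod_beta)

lemma string_length_nonneg: "(\<And>x y. e x y \<ge> 0) \<Longrightarrow> string_length e mp \<ge> 0"
  by (simp add: string_length_def sum_nonneg)

lemma bdd_below_string_length:
  "(\<And>x y. e x y \<ge> 0) \<Longrightarrow> bdd_below (string_length e ` A)"
  by (auto intro!: bdd_belowI[of _ 0] string_length_nonneg)

lemma string_consecutive:
  assumes "(m, p) \<in> strings K x y" "i < m"
  obtains \<sigma> where "\<sigma> \<in> K" "support (p i) \<subseteq> \<sigma>" "support (p (Suc i)) \<subseteq> \<sigma>"
  using assms by (auto simp: strings_def)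

lemma string_points:
  assumes "(m, p) \<in> strings K x y"
  shows "p 0 = x" "p m = y" "i \<le> m \<Longrightarrow> p i \<in> realization K"
  using assms by (auto simp: strings_def)

lemma stringI:
  assumes "p 0 = x" "p m = y" "\<And>i. i \<le> m \<Longrightarrow> p i \<in> realization K"
    and "\<And>i. i < m \<Longrightarrow> \<exists>\<sigma>\<in>K. support (p i) \<subseteq> \<sigma> \<and> support (p (Suc i)) \<subseteq> \<sigma>"
  shows "(m, p) \<in> strings K x y"
  using assms by (simp add: strings_def)

lemma string_singleton: "x \<in> realization K \<Longrightarrow> (0, \<lambda>_. x) \<in> strings K x x"
  by (rule stringI) auto

lemma string_step:
  assumes "x \<in> realization K" "y \<in> realization K" "\<sigma> \<in> K" "support x \<subseteq> \<sigma>" "support y \<subseteq> \<sigma>"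
  shows "(1, \<lambda>i. if i = 0 then x else y) \<in> strings K x y"
proof (rule stringI)
  show "\<exists>\<sigma>\<in>K. support (if i = 0 then x else y) \<subseteq> \<sigma> \<and>
      support (if Suc i = 0 then x else y) \<subseteq> \<sigma>" if "i < 1" for i
    using assms that by (intro bexI[of _ \<sigma>]) auto
qed (use assms in auto)

lemma string_rev:
  assumes mp: "(m, p) \<in> strings K x y"
  shows "(m, \<lambda>i. p (m - i)) \<in> strings K y x"
proof (rule stringI)
  fix i assume "i < m"
  then have "m - Suc i < m" "m - i = Suc (m - Suc i)" by auto
  then show "\<exists>\<sigma>\<in>K. support (p (m - i)) \<subseteq> \<sigma> \<and> support (p (m - Suc i)) \<subseteq> \<sigma>"
    using string_consecutive[OF mp] by metis
qed (use string_points[OF mp] in auto)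

lemma string_length_rev:
  assumes "\<And>x y. e x y = e y x"
  shows "string_length e (m, \<lambda>i. p (m - i)) = string_length e (m, p)"
proof -
  have "string_length e (m, \<lambda>i. p (m - i)) = (\<Sum>i<m. e (p (Suc (m - Suc i))) (p (m - Suc i)))"
    unfolding string_length_def by (auto intro!: sum.cong simp: Suc_diff_Suc)
  also have "\<dots> = (\<Sum>i<m. e (p (Suc i)) (p i))"
    by (rule sum.nat_diff_reindex)
  finally show ?thesis using assms by (simp add: string_length_def)
qed

lemma string_append:
  assumes mp: "(m, p) \<in> strings K x y" and kq: "(k, q) \<in> strings K y z"
  shows "(m + k, \<lambda>i. if i \<le> m then p i else q (i - m)) \<in> strings K x z"
proof -
  define r where "r = (\<lambda>i. if i \<le> m then p i else q (i - m))"
  have p: "r i = p i" if "i \<le> m" for i using that by (simp add: r_def)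
  have q: "r i = q (i - m)" if "m \<le> i" for i
    using that string_points(2)[OF mp] string_points(1)[OF kq] by (cases "i = m") (auto simp: r_def)
  have "\<exists>\<sigma>\<in>K. support (r i) \<subseteq> \<sigma> \<and> support (r (Suc i)) \<subseteq> \<sigma>" if i: "i < m + k" for i
  proof (cases "i < m")
    case True
    obtain \<sigma> where "\<sigma> \<in> K" "support (p i) \<subseteq> \<sigma>" "support (p (Suc i)) \<subseteq> \<sigma>"
      using string_consecutive[OF mp True] .
    then show ?thesis using p[of i] p[of "Suc i"] True by auto
  next
    case False
    then have "i - m < k" using i by simp
    then obtain \<sigma> where "\<sigma> \<in> K" "support (q (i - m)) \<subseteq> \<sigma>" "support (q (Suc (i - m))) \<subseteq> \<sigma>"
      using string_consecutive[OF kq] by blast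
    then show ?thesis using q[of i] q[of "Suc i"] False by (auto simp: Suc_diff_le)
  qed
  moreover have "r i \<in> realization K" if "i \<le> m + k" for i
    using p[of i] q[of i] string_points(3)[OF mp, of i] string_points(3)[OF kq, of "i - m"] that
    by (cases "i \<le> m") auto
  moreover have "r 0 = x" "r (m + k) = z"
    using p[of 0] q[of "m + k"] string_points(1)[OF mp] string_points(2)[OF kq] by auto
  ultimately show ?thesis unfolding r_def[symmetric] by (intro stringI)
qed

lemma string_length_append:
  assumes "(m, p) \<in> strings K x y" "(k, q) \<in> strings K y z"
  shows "string_length e (m + k, \<lambda>i. if i \<le> m then p i else q (i - m))
    = string_length e (m, p) + string_length e (k, q)"
proof -
  let ?r = "\<lambda>i. if i \<le> m then p i else q (i - m)"
  have "(\<Sum>i<m + k. e (?r i) (?r (Suc i)))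
      = (\<Sum>i<m. e (?r i) (?r (Suc i))) + (\<Sum>i<k. e (?r (m + i)) (?r (Suc (m + i))))"
    by (induction k) (simp_all add: add.assoc)
  also have "(\<Sum>i<k. e (?r (m + i)) (?r (Suc (m + i)))) = (\<Sum>i<k. e (q i) (q (Suc i)))"
    using string_points[OF assms(1)] string_points[OF assms(2)] by (intro sum.cong) auto
  finally show ?thesis by (simp add: string_length_def)
qed

text \<open>Connectedness of the complex is needed because the infimum over an empty set of strings
would be arbitrary.\<close>

definition joined :: "'v set set \<Rightarrow> ('v \<Rightarrow> real) \<Rightarrow> ('v \<Rightarrow> real) \<Rightarrow> bool" where
  "joined K x y \<longleftrightarrow> strings K x y \<noteq> {}"

lemma joined_sym: "joined K x y \<Longrightarrow> joined K y x"
  unfolding joined_def using string_rev by fastforce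

lemma joined_trans: "joined K x y \<Longrightarrow> joined K y z \<Longrightarrow> joined K x z"
  unfolding joined_def using string_append by fastforce

lemma joined_step:
  assumes "x \<in> realization K" "y \<in> realization K" "\<sigma> \<in> K" "support x \<subseteq> \<sigma>" "support y \<subseteq> \<sigma>"
  shows "joined K x y"
  using string_step[OF assms] by (auto simp: joined_def)

lemma joined_refl: "x \<in> realization K \<Longrightarrow> joined K x x"
  using string_singleton by (force simp: joined_def)

text \<open>Intrinsic distances of connected complexes, with \<open>e\<close> measuring the distance of points of a
common simplex.\<close>

locale intrinsic =
  fixes K :: "'v set set" and e :: "('v \<Rightarrow> real) \<Rightarrow> ('v \<Rightarrow> real) \<Rightarrow> real"
  assumes e_nonneg: "e x y \<ge> 0" and e_sym: "e x y = e y x"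
    and joined: "x \<in> realization K \<Longrightarrow> y \<in> realization K \<Longrightarrow> joined K x y"
begin

lemma nonneg: "intrinsic_dist K e x y \<ge> 0"
  unfolding intrinsic_dist_eq using joined string_length_nonneg[OF e_nonneg]
  by (auto intro!: cInf_greatest simp: joined_def)

lemma le_string_length:
  assumes "(m, p) \<in> strings K x y"
  shows "intrinsic_dist K e x y \<le> string_length e (m, p)"
proof -
  have "x \<in> realization K" "y \<in> realization K" using assms by (auto simp: strings_def)
  then show ?thesis unfolding intrinsic_dist_eq
    using assms by (auto intro!: cInf_lower bdd_below_string_length e_nonneg)
qed

lemma le_e:
  assumes "x \<in> realization K" "y \<in> realization K" "\<sigma> \<in> K" "support x \<subseteq> \<sigma>" "support y \<subseteq> \<sigma>"
  shows "intrinsic_dist K e x y \<le> e x y"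
  using le_string_length[OF string_step[OF assms]] by (simp add: string_length_def)

lemma sym: "intrinsic_dist K e x y = intrinsic_dist K e y x"
proof -
  have "string_length e ` strings K x y \<subseteq> string_length e ` strings K y x" for x y
  proof clarify
    fix m p assume "(m, p) \<in> strings K x y"
    then show "string_length e (m, p) \<in> string_length e ` strings K y x"
      using string_rev string_length_rev[of e m p, OF e_sym] by (metis image_eqI)
  qed
  then have "string_length e ` strings K x y = string_length e ` strings K y x" by blast
  then show ?thesis by (simp add: intrinsic_dist_eq)
qed

lemma greatest:
  assumes "x \<in> realization K" "y \<in> realization K"
    and "\<And>m p. (m, p) \<in> strings K x y \<Longrightarrow> B \<le> string_length e (m, p)"
  shows "B \<le> intrinsic_dist K e x y"
  unfolding intrinsic_dist_eq using assms joined[OF assms(1,2)]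
  by (auto intro!: cInf_greatest simp: joined_def)

lemma triangle:
  assumes "x \<in> realization K" "y \<in> realization K" "z \<in> realization K"
  shows "intrinsic_dist K e x z \<le> intrinsic_dist K e x y + intrinsic_dist K e y z"
proof -
  have "intrinsic_dist K e x z - string_length e (k, q) \<le> intrinsic_dist K e x y"
    if kq: "(k, q) \<in> strings K y z" for k q
  proof (rule greatest[OF assms(1,2)])
    fix m p assume mp: "(m, p) \<in> strings K x y"
    show "intrinsic_dist K e x z - string_length e (k, q) \<le> string_length e (m, p)"
      using le_string_length[OF string_append[OF mp kq]] string_length_append[OF mp kq, of e] by simp
  qed
  then have "intrinsic_dist K e x z - intrinsic_dist K e x y \<le> intrinsic_dist K e y z"
    by (intro greatest[OF assms(2,3)]) (smt (verit))
  then show ?thesis by simp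
qed

text \<open>An intrinsic metric is the largest one below \<open>e\<close> on simplices, so a Lipschitz bound needs to
be checked on single simplices only.\<close>

lemma Lipschitz:
  fixes F :: "('v \<Rightarrow> real) \<Rightarrow> real"
  assumes F: "\<And>x y \<sigma>. x \<in> realization K \<Longrightarrow> y \<in> realization K \<Longrightarrow> \<sigma> \<in> K \<Longrightarrow> support x \<subseteq> \<sigma> \<Longrightarrow>
      support y \<subseteq> \<sigma> \<Longrightarrow> \<bar>F x - F y\<bar> \<le> L * e x y"
    and L: "L > 0" and xy: "x \<in> realization K" "y \<in> realization K"
  shows "\<bar>F x - F y\<bar> \<le> L * intrinsic_dist K e x y"
proof -
  have "\<bar>F x - F y\<bar> / L \<le> intrinsic_dist K e x y"
  proof (rule greatest[OF xy])
    fix m p assume mp: "(m, p) \<in> strings K x y"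
    have "\<bar>F (p 0) - F (p k)\<bar> \<le> (\<Sum>i<k. L * e (p i) (p (Suc i)))" if "k \<le> m" for k
      using that
    proof (induction k)
      case (Suc k)
      then obtain \<sigma> where "\<sigma> \<in> K" "support (p k) \<subseteq> \<sigma>" "support (p (Suc k)) \<subseteq> \<sigma>"
        using string_consecutive[OF mp, of k] by auto
      then have "\<bar>F (p k) - F (p (Suc k))\<bar> \<le> L * e (p k) (p (Suc k))"
        using string_points[OF mp] Suc.prems by (intro F[of _ _ \<sigma>]) auto
      then show ?case using Suc by simp
    qed simp
    from this[of m] have "\<bar>F x - F y\<bar> \<le> (\<Sum>i<m. L * e (p i) (p (Suc i)))"
      using string_points[OF mp] by auto
    also have "\<dots> = L * string_length e (m, p)"
      by (simp add: string_length_def sum_distrib_left)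
    finally show "\<bar>F x - F y\<bar> / L \<le> string_length e (m, p)"
      using L by (simp add: field_simps)
  qed
  then show ?thesis using L by (simp add: field_simps)
qed

text \<open>A simplicial map that is isometric on simplices maps strings to strings of the same length.\<close>

lemma push_le:
  assumes K: "simplicial_complex K"
    and f: "\<And>\<sigma>. \<sigma> \<in> K \<Longrightarrow> f ` \<sigma> \<in> K"
    and e: "\<And>x y. x \<in> realization K \<Longrightarrow> y \<in> realization K \<Longrightarrow> e (push f x) (push f y) = e x y"
    and xy: "x \<in> realization K" "y \<in> realization K"
  shows "intrinsic_dist K e (push f x) (push f y) \<le> intrinsic_dist K e x y"
proof (rule greatest[OF xy])
  fix m p assume mp: "(m, p) \<in> strings K x y"
  have real: "push f (p i) \<in> realization K" if "i \<le> m" for i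
    using string_points(3)[OF mp that] K realizationD(3)[OF K string_points(3)[OF mp that]]
    by (intro push_in_realization[of K] f)
  have "\<exists>\<sigma>\<in>K. support (push f (p i)) \<subseteq> \<sigma> \<and> support (push f (p (Suc i))) \<subseteq> \<sigma>" if i: "i < m" for i
  proof -
    obtain \<sigma> where \<sigma>: "\<sigma> \<in> K" "support (p i) \<subseteq> \<sigma>" "support (p (Suc i)) \<subseteq> \<sigma>"
      using string_consecutive[OF mp i] .
    have "support (push f (p j)) \<subseteq> f ` \<sigma>" if "support (p j) \<subseteq> \<sigma>" for j
      using support_push_subset[of f "p j"] image_mono[OF that, of f] by (rule order_trans)
    then show ?thesis using f[OF \<sigma>(1)] \<sigma>(2,3) by (intro bexI[of _ "f ` \<sigma>"] conjI)
  qed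
  then have "(m, \<lambda>i. push f (p i)) \<in> strings K (push f x) (push f y)"
    using string_points[OF mp] real by (intro stringI) auto
  from le_string_length[OF this]
  have "intrinsic_dist K e (push f x) (push f y) \<le> string_length e (m, \<lambda>i. push f (p i))" .
  also have "\<dots> = string_length e (m, p)"
    unfolding string_length_def using string_points[OF mp] by (auto intro!: sum.cong e)
  finally show "intrinsic_dist K e (push f x) (push f y) \<le> string_length e (m, p)" .
qed

end


section \<open>Words and special subgroups of right-angled Coxeter groups\<close>

locale racg = group G for G (structure) +
  fixes S :: "'a set"
  assumes coxeter: "right_angled_coxeter_group G S"
begin

lemma finite_S: "finite S" and S_carrier: "S \<subseteq> carrier G" and generate_S: "generate G S = carrier G"
  using coxeter by (auto simp: right_angled_coxeter_group_def)

lemma S_in: "s \<in> S \<Longrightarrow> s \<in> carrier G"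
  using S_carrier by blast

lemma S_square: assumes "s \<in> S" shows "s \<otimes> s = \<one>"
proof -
  have "ord s = 2" using coxeter assms by (auto simp: right_angled_coxeter_group_def)
  then have "s [^] (2::nat) = \<one>" using pow_ord_eq_1[OF S_in[OF assms]] by simp
  then show ?thesis using S_in[OF assms] by (simp add: numeral_2_eq_2)
qed

lemma S_inv: "s \<in> S \<Longrightarrow> inv s = s"
  by (simp add: S_in S_square inv_equality)

lemma one_notin_S: "\<one> \<notin> S"
proof
  assume "\<one> \<in> S"
  then have "ord \<one> = 2" using coxeter by (auto simp: right_angled_coxeter_group_def)
  then show False by simp
qed

lemma word_value_Nil [simp]: "word_value G [] = \<one>"
  and word_value_Cons [simp]: "word_value G (s # w) = s \<otimes> word_value G w"
  by (simp_all add: word_value_def)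

lemma word_value_carrier [simp]: "w \<in> lists S \<Longrightarrow> word_value G w \<in> carrier G"
  by (induction w) (auto simp: S_in)

lemma word_value_append:
  "w \<in> lists S \<Longrightarrow> w' \<in> lists S \<Longrightarrow> word_value G (w @ w') = word_value G w \<otimes> word_value G w'"
  by (induction w) (auto simp: S_in m_assoc)

lemma generate_word:
  assumes "g \<in> generate G \<sigma>" "\<sigma> \<subseteq> S"
  shows "\<exists>w\<in>lists \<sigma>. word_value G w = g"
  using assms(1)
proof (induction rule: generate.induct)
  case one
  show ?case by (intro bexI[of _ "[]"]) auto
next
  case (incl h)
  then show ?case using assms(2) by (intro bexI[of _ "[h]"]) (auto simp: S_in)
next
  case (inv h)
  then show ?case using assms(2) by (intro bexI[of _ "[h]"]) (auto simp: S_in S_inv subset_iff)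
next
  case (eng h1 h2)
  then obtain w1 w2 where w: "w1 \<in> lists \<sigma>" "w2 \<in> lists \<sigma>" "word_value G w1 = h1" "word_value G w2 = h2"
    by blast
  moreover have "w1 \<in> lists S" "w2 \<in> lists S" using w assms(2) by auto
  ultimately show ?case by (intro bexI[of _ "w1 @ w2"]) (auto simp: word_value_append)
qed

lemma carrier_word:
  assumes "g \<in> carrier G" obtains w where "w \<in> lists S" "word_value G w = g"
  using generate_word[of g S] assms generate_S by auto

lemma countable_carrier: "countable (carrier G)"
proof -
  have "carrier G \<subseteq> word_value G ` lists S" using carrier_word by blast
  moreover have "countable (lists S)" using finite_S by (simp add: countable_finite)
  ultimately show ?thesis by (meson countable_image countable_subset)
qed

text \<open>The relations preserve the parity of the number of occurrences of each generator, so \<open>\<Gamma>\<close> has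
a homomorphism to \<open>\<int>/2\<close> for each generator.\<close>

lemma parity_invariant:
  assumes "equivclp (racg_move S R) w w'"
  shows "even (count_list w s) \<longleftrightarrow> even (count_list w' s)"
  using assms
proof (induction rule: equivclp_induct)
  case (step y z)
  have move: "even (count_list u s) \<longleftrightarrow> even (count_list v s)" if "racg_move S R u v" for u v
    using that by cases auto
  have "even (count_list y s) \<longleftrightarrow> even (count_list z s)"
    using step(2) move[of y z] move[of z y] by blast
  then show ?case using step by simp
qed simp

text \<open>The parity of \<open>s\<close> distinguishes \<open>s\<close> from all words in the other generators.\<close>

lemma generator_in_generate:
  assumes "s \<in> S" "\<sigma> \<subseteq> S" "s \<in> generate G \<sigma>"
  shows "s \<in> \<sigma>"
proof (rule ccontr)
  assume s: "s \<notin> \<sigma>"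
  obtain R where R: "\<And>w. w \<in> lists S \<Longrightarrow> word_value G w = \<one> \<Longrightarrow> equivclp (racg_move S R) w []"
    using coxeter unfolding right_angled_coxeter_group_def by blast
  obtain w where w: "w \<in> lists \<sigma>" "word_value G w = s"
    using generate_word[OF assms(3,2)] by blast
  have "s # w \<in> lists S" "word_value G (s # w) = \<one>"
    using w assms by (auto simp: S_square)
  then have "even (count_list (s # w) s) \<longleftrightarrow> even (count_list [] s)"
    by (intro parity_invariant[OF R])
  moreover have "count_list w s = 0" using w s by (auto simp: count_list_0_iff)
  ultimately show False by simp
qed

lemma nerveD:
  assumes "\<sigma> \<in> nerve G S"
  shows "\<sigma> \<noteq> {}" "finite \<sigma>" "\<sigma> \<subseteq> S" "\<sigma> \<subseteq> carrier G"
  using assms S_carrier by (auto simp: nerve_def)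

lemma singleton_nerve: "s \<in> S \<Longrightarrow> {s} \<in> nerve G S"
  by (auto simp: nerve_def)

lemma finite_nerve: "finite (nerve G S)"
  by (rule finite_subset[of _ "Pow S"]) (auto simp: nerve_def finite_S)

lemma generate_insert_commuting:
  assumes "s \<in> S" "\<sigma> \<subseteq> S" "\<And>t. t \<in> \<sigma> \<Longrightarrow> s \<otimes> t = t \<otimes> s" "g \<in> generate G (insert s \<sigma>)"
  shows "g \<in> generate G \<sigma> \<union> (\<lambda>h. s \<otimes> h) ` generate G \<sigma>"
proof -
  let ?H = "generate G \<sigma>"
  have \<sigma>: "\<sigma> \<subseteq> carrier G" using assms S_carrier by blast
  have carr: "h \<in> carrier G" if "h \<in> ?H" for h using generate_in_carrier[OF \<sigma> that] .
  have sc: "s \<in> carrier G" using assms S_in by blast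
  have "insert s \<sigma> \<subseteq> S" using assms by blast
  from generate_word[OF assms(4) this] obtain w where w: "w \<in> lists (insert s \<sigma>)" "word_value G w = g"
    by blast
  have "word_value G w \<in> ?H \<union> (\<lambda>h. s \<otimes> h) ` ?H"
    using w(1)
  proof (induction w)
    case Nil
    then show ?case using generate.one by auto
  next
    case (Cons t w)
    let ?v = "word_value G w"
    have "?v \<in> ?H \<union> (\<lambda>h. s \<otimes> h) ` ?H" using Cons by auto
    then consider "?v \<in> ?H" | h where "h \<in> ?H" "?v = s \<otimes> h" by blast
    then show ?case
    proof cases
      case 1
      show ?thesis
      proof (cases "t = s")
        case False
        then have "t \<in> \<sigma>" using Cons by auto
        then have "t \<otimes> ?v \<in> ?H" using generate.eng[OF generate.incl 1] by blast
        then show ?thesis by simp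
      qed (use 1 in auto)
    next
      case 2
      show ?thesis
      proof (cases "t = s")
        case True
        then have "t \<otimes> ?v = h"
          using 2 sc carr assms(1) by (simp add: m_assoc[symmetric] S_square)
        then show ?thesis using 2 by auto
      next
        case False
        then have t: "t \<in> \<sigma>" using Cons by auto
        have tc: "t \<in> carrier G" using t \<sigma> by blast
        have hc: "h \<in> carrier G" using 2 carr by blast
        have "t \<otimes> ?v = (t \<otimes> s) \<otimes> h" using 2 sc tc hc by (simp add: m_assoc)
        also have "\<dots> = s \<otimes> (t \<otimes> h)"
          using sc tc hc by (simp add: assms(3)[OF t, symmetric] m_assoc)
        finally have "t \<otimes> ?v = s \<otimes> (t \<otimes> h)" .
        moreover have "t \<otimes> h \<in> ?H" using generate.eng[OF generate.incl[OF t] 2(1)] .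
        ultimately show ?thesis by auto
      qed
    qed
  qed
  then show ?thesis using w by simp
qed

lemma generate_singleton:
  assumes "s \<in> S" shows "generate G {s} = {\<one>, s}"
proof
  show "generate G {s} \<subseteq> {\<one>, s}"
    using generate_insert_commuting[OF assms, of "{}"] generate_empty S_in[OF assms] by auto
  show "{\<one>, s} \<subseteq> generate G {s}" by (auto intro: generate.intros)
qed

lemma finite_generate_nerve:
  assumes "\<sigma> \<in> nerve G S" shows "finite (generate G \<sigma>)"
proof -
  have "finite \<sigma>" "\<sigma> \<subseteq> S" "\<forall>s\<in>\<sigma>. \<forall>t\<in>\<sigma>. s \<otimes> t = t \<otimes> s" using assms by (auto simp: nerve_def)
  then show ?thesis
  proof (induction \<sigma>)
    case empty
    then show ?case by (simp add: generate_empty)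
  next
    case (insert s \<sigma>)
    have "generate G (insert s \<sigma>) \<subseteq> generate G \<sigma> \<union> (\<lambda>h. s \<otimes> h) ` generate G \<sigma>"
    proof
      fix g assume "g \<in> generate G (insert s \<sigma>)"
      then show "g \<in> generate G \<sigma> \<union> (\<lambda>h. s \<otimes> h) ` generate G \<sigma>"
        using insert.prems by (intro generate_insert_commuting) blast+
    qed
    moreover have "finite (generate G \<sigma> \<union> (\<lambda>h. s \<otimes> h) ` generate G \<sigma>)"
      using insert.IH insert.prems by blast
    ultimately show ?case by (rule finite_subset)
  qed
qed

end


section \<open>The Davis complex and its metric\<close>

text \<open>An upper set \<open>D\<close> of a finite chain is cut out by any element of the least member of \<open>D\<close> that
is missing from the greatest set below \<open>D\<close>. For the simplices of a subdivided cube this says that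
the sum of the weights over an upper set is one of the cube coordinates.\<close>

lemma chain_separation:
  assumes c: "finite c" "chain_subset c" "{} \<notin> c"
    and D: "D \<subseteq> c" "D \<noteq> {}" "\<And>\<sigma> \<rho>. \<sigma> \<in> D \<Longrightarrow> \<rho> \<in> c \<Longrightarrow> \<sigma> \<subseteq> \<rho> \<Longrightarrow> \<rho> \<in> D"
  shows "\<exists>s\<in>\<Union>c. {\<sigma> \<in> c. s \<in> \<sigma>} = D"
proof -
  have chain: "\<sigma> \<subseteq> \<rho> \<or> \<rho> \<subseteq> \<sigma>" if "\<sigma> \<in> c" "\<rho> \<in> c" for \<sigma> \<rho>
    using c(2) that by (auto simp: chain_subset_def)
  have "finite D" using c(1) D(1) by (rule finite_subset[rotated])
  then obtain m where m: "m \<in> D" "\<And>\<sigma>. \<sigma> \<in> D \<Longrightarrow> \<sigma> \<subseteq> m \<Longrightarrow> m = \<sigma>"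
    using finite_has_minimal[OF _ D(2)] by metis
  have m_le: "m \<subseteq> \<sigma>" if "\<sigma> \<in> D" for \<sigma>
    using chain[of m \<sigma>] m(1) m(2)[OF that] that D(1) by auto
  have below: "\<rho> \<subset> m" if "\<rho> \<in> c - D" for \<rho>
  proof -
    have "\<not> m \<subseteq> \<rho>" using D(3)[OF m(1), of \<rho>] that by auto
    moreover have "\<rho> \<subseteq> m \<or> m \<subseteq> \<rho>" using chain[of \<rho> m] D(1) m(1) that by blast
    ultimately show ?thesis by auto
  qed
  \<comment> \<open>the sets outside \<open>D\<close> form a chain of proper subsets of \<open>m\<close>, so their union is not all
    of \<open>m\<close>\<close>
  have "\<exists>s\<in>m. \<forall>\<rho>\<in>c - D. s \<notin> \<rho>"
  proof (cases "c - D = {}")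
    case True
    have "m \<in> c" using D(1) m(1) by blast
    then have "m \<noteq> {}" using c(3) by metis
    then show ?thesis using True by auto
  next
    case False
    obtain M where M: "M \<in> c - D" "\<And>\<sigma>. \<sigma> \<in> c - D \<Longrightarrow> M \<subseteq> \<sigma> \<Longrightarrow> M = \<sigma>"
      using finite_has_maximal[OF _ False] c(1) by (metis finite_Diff)
    have "\<rho> \<subseteq> M" if "\<rho> \<in> c - D" for \<rho>
      using chain[of \<rho> M] M(1) M(2)[OF that] that by auto
    moreover obtain s where "s \<in> m" "s \<notin> M" using below[OF M(1)] by blast
    ultimately show ?thesis by blast
  qed
  then obtain s where s: "s \<in> m" "\<And>\<rho>. \<rho> \<in> c - D \<Longrightarrow> s \<notin> \<rho>" by blast
  have "{\<sigma> \<in> c. s \<in> \<sigma>} = D" using s m_le D(1) by blast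
  moreover have "s \<in> \<Union>c" using s m(1) D(1) by blast
  ultimately show ?thesis by blast
qed

lemma (in group) cancel_inv_left:
  assumes "x \<in> carrier G" "y \<in> carrier G"
  shows "x \<otimes> (inv x \<otimes> y) = y" "inv x \<otimes> (x \<otimes> y) = y"
  using assms by (simp_all add: m_assoc[symmetric])

fun type_set :: "'a set option \<Rightarrow> 'a set" where
  "type_set None = {}"
| "type_set (Some \<sigma>) = \<sigma>"

definition proper_types :: "'a set option set \<Rightarrow> 'a set set" where
  "proper_types \<tau> = {\<sigma>. Some \<sigma> \<in> \<tau>}"

text \<open>All representatives of a vertex of the Davis complex have the same second component, its
type.\<close>

definition vtype :: "('a \<times> 'a set option) set \<Rightarrow> 'a set option" where
  "vtype D = (THE v. v \<in> snd ` D)"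

definition translate :: "('a, 'm) monoid_scheme \<Rightarrow> 'a \<Rightarrow> ('a \<times> 'a set option) set \<Rightarrow> ('a \<times> 'a set option) set" where
  "translate G g D = (\<lambda>(b, v). (g \<otimes>\<^bsub>G\<^esub> b, v)) ` D"

context racg
begin

abbreviation dv :: "'a \<Rightarrow> 'a set option \<Rightarrow> ('a \<times> 'a set option) set" where
  "dv \<equiv> davis_vertex G"

abbreviation X :: "(('a \<times> 'a set option) set \<Rightarrow> real) set" where
  "X \<equiv> davis_space G S"

definition types :: "'a set option set" where
  "types = insert None (Some ` nerve G S)"

lemma None_types [simp]: "None \<in> types" and Some_types [simp]: "Some \<sigma> \<in> types \<longleftrightarrow> \<sigma> \<in> nerve G S"
  by (auto simp: types_def)

lemma finite_types: "finite types"
  by (simp add: types_def finite_nerve)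

lemma subgroup_vertex_group: "v \<in> types \<Longrightarrow> subgroup (vertex_group G v) G"
  by (cases v) (auto dest: nerveD intro!: generate_is_subgroup simp: triv_subgroup)

lemma davis_vertex_eq:
  assumes "a \<in> carrier G"
  shows "dv a v = {(b, v) | b. b \<in> carrier G \<and> inv a \<otimes> b \<in> vertex_group G v}"
  using assms by (auto simp: davis_vertex_def davis_rel_def)

lemma davis_vertex_self:
  assumes "a \<in> carrier G" "v \<in> types" shows "(a, v) \<in> dv a v"
  using assms subgroup.one_closed[OF subgroup_vertex_group] by (simp add: davis_vertex_eq)

text \<open>The vertices of type \<open>v\<close> are the cosets of the vertex group of \<open>v\<close>.\<close>

lemma davis_vertex_eq_iff:
  assumes a: "a \<in> carrier G" and b: "b \<in> carrier G" and v: "v \<in> types" and w: "w \<in> types"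
  shows "dv a v = dv b w \<longleftrightarrow> v = w \<and> inv a \<otimes> b \<in> vertex_group G v"
proof
  assume "dv a v = dv b w"
  then have "(b, w) \<in> dv a v" using davis_vertex_self[OF b w] by simp
  then show "v = w \<and> inv a \<otimes> b \<in> vertex_group G v" using a by (simp add: davis_vertex_eq)
next
  assume vw: "v = w \<and> inv a \<otimes> b \<in> vertex_group G v"
  let ?H = "vertex_group G v"
  have H: "subgroup ?H G" using subgroup_vertex_group[OF v] .
  have ab: "inv a \<otimes> b \<in> ?H" using vw by blast
  have "inv a \<otimes> c \<in> ?H \<longleftrightarrow> inv b \<otimes> c \<in> ?H" if c: "c \<in> carrier G" for c
  proof -
    have eq: "inv a \<otimes> c = (inv a \<otimes> b) \<otimes> (inv b \<otimes> c)"
      using a b c by (simp add: m_assoc cancel_inv_left)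
    have eq': "inv b \<otimes> c = inv (inv a \<otimes> b) \<otimes> (inv a \<otimes> c)"
      using a b c by (simp add: m_assoc inv_mult_group cancel_inv_left)
    show ?thesis
      using subgroup.m_closed[OF H] subgroup.m_inv_closed[OF H] ab eq eq' by metis
  qed
  then show "dv a v = dv b w" using a b vw by (auto simp: davis_vertex_eq)
qed

lemma vtype_davis_vertex [simp]:
  assumes "a \<in> carrier G" "v \<in> types" shows "vtype (dv a v) = v"
proof -
  have "snd ` dv a v = {v}"
    using davis_vertex_self[OF assms] assms(1) by (force simp: davis_vertex_eq)
  then show ?thesis by (simp add: vtype_def)
qed

lemma inj_on_davis_vertex: "a \<in> carrier G \<Longrightarrow> inj_on (dv a) types"
  by (metis inj_onI vtype_davis_vertex)

lemma translate_davis_vertex: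
  assumes "g \<in> carrier G" "a \<in> carrier G" shows "translate G g (dv a v) = dv (g \<otimes> a) v"
proof -
  have mem: "(b, v) \<in> translate G g (dv a v) \<longleftrightarrow> b \<in> carrier G \<and> inv (g \<otimes> a) \<otimes> b \<in> vertex_group G v" for b
  proof
    assume "(b, v) \<in> translate G g (dv a v)"
    then obtain c where c: "c \<in> carrier G" "inv a \<otimes> c \<in> vertex_group G v" "b = g \<otimes> c"
      using assms by (auto simp: translate_def davis_vertex_eq)
    have "inv (g \<otimes> a) \<otimes> b = inv a \<otimes> c"
      using c assms by (simp add: inv_mult_group m_assoc cancel_inv_left)
    then show "b \<in> carrier G \<and> inv (g \<otimes> a) \<otimes> b \<in> vertex_group G v" using c assms by simp
  next
    assume b: "b \<in> carrier G \<and> inv (g \<otimes> a) \<otimes> b \<in> vertex_group G v"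
    moreover have "inv (g \<otimes> a) \<otimes> b = inv a \<otimes> (inv g \<otimes> b)"
      using b assms by (simp add: inv_mult_group m_assoc)
    ultimately have "inv a \<otimes> (inv g \<otimes> b) \<in> vertex_group G v" by simp
    then have "(inv g \<otimes> b, v) \<in> dv a v" using b assms by (simp add: davis_vertex_eq)
    moreover have "b = g \<otimes> (inv g \<otimes> b)" using b assms by (simp add: m_assoc[symmetric])
    ultimately show "(b, v) \<in> translate G g (dv a v)" unfolding translate_def by force
  qed
  have snd: "w = v" if "(b, w) \<in> translate G g (dv a v)" for b w
    using that assms by (auto simp: translate_def davis_vertex_eq)
  show ?thesis
  proof (intro equalityI subsetI)
    fix p assume p: "p \<in> translate G g (dv a v)"
    obtain b w where "p = (b, w)" by force
    then have "p = (b, v)" "(b, v) \<in> translate G g (dv a v)" using p snd by auto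
    then show "p \<in> dv (g \<otimes> a) v" using mem assms by (simp add: davis_vertex_eq)
  next
    fix p assume "p \<in> dv (g \<otimes> a) v"
    then obtain b where "p = (b, v)" "b \<in> carrier G" "inv (g \<otimes> a) \<otimes> b \<in> vertex_group G v"
      using assms by (auto simp: davis_vertex_eq)
    then show "p \<in> translate G g (dv a v)" using mem by simp
  qed
qed

text \<open>A description of the cone over the barycentric subdivision that treats the cone point like
the other types.\<close>

lemma chamber_iff:
  "\<tau> \<in> chamber G S \<longleftrightarrow> \<tau> \<noteq> {} \<and> \<tau> \<subseteq> types \<and> chain_subset (proper_types \<tau>)"
proof
  assume "\<tau> \<in> chamber G S"
  then consider "\<tau> = {None}"
    | c where "c \<in> barycentric_subdivision (nerve G S)" "\<tau> = Some ` c \<or> \<tau> = insert None (Some ` c)"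
    by (auto simp: chamber_def cone_def)
  then show "\<tau> \<noteq> {} \<and> \<tau> \<subseteq> types \<and> chain_subset (proper_types \<tau>)"
  proof cases
    case 1
    then show ?thesis by (simp add: proper_types_def chain_subset_def)
  next
    case 2
    then have "proper_types \<tau> = c" by (auto simp: proper_types_def)
    moreover have "\<tau> \<noteq> {}" "\<tau> \<subseteq> types"
      using 2 unfolding barycentric_subdivision_def types_def by blast+
    ultimately show ?thesis using 2(1) by (simp add: barycentric_subdivision_def)
  qed
next
  assume \<tau>: "\<tau> \<noteq> {} \<and> \<tau> \<subseteq> types \<and> chain_subset (proper_types \<tau>)"
  have eq: "\<tau> = Some ` proper_types \<tau> \<or> \<tau> = insert None (Some ` proper_types \<tau>)"
  proof (cases "None \<in> \<tau>")
    case True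
    have "x \<in> \<tau> \<longleftrightarrow> x \<in> insert None (Some ` proper_types \<tau>)" for x
      using True by (cases x) (auto simp: proper_types_def)
    then show ?thesis by blast
  next
    case False
    have "x \<in> \<tau> \<longleftrightarrow> x \<in> Some ` proper_types \<tau>" for x
      using False by (cases x) (auto simp: proper_types_def)
    then show ?thesis by blast
  qed
  show "\<tau> \<in> chamber G S"
  proof (cases "proper_types \<tau> = {}")
    case True
    then have "\<tau> = {None}" using eq \<tau> by auto
    then show ?thesis by (simp add: chamber_def cone_def)
  next
    case False
    have "proper_types \<tau> \<subseteq> nerve G S" using \<tau> by (auto simp: proper_types_def)
    then have mem: "proper_types \<tau> \<in> barycentric_subdivision (nerve G S)"
      using \<tau> False finite_subset[OF _ finite_nerve] by (simp add: barycentric_subdivision_def)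
    from eq show ?thesis
    proof
      assume "\<tau> = Some ` proper_types \<tau>"
      then show ?thesis using mem unfolding chamber_def cone_def by auto
    next
      assume "\<tau> = insert None (Some ` proper_types \<tau>)"
      then show ?thesis using mem unfolding chamber_def cone_def by auto
    qed
  qed
qed

lemma chamberD:
  assumes "\<tau> \<in> chamber G S"
  shows "\<tau> \<noteq> {}" "\<tau> \<subseteq> types" "finite \<tau>" "chain_subset (proper_types \<tau>)"
    "finite (proper_types \<tau>)" "proper_types \<tau> \<subseteq> nerve G S"
proof -
  show \<tau>: "\<tau> \<noteq> {}" "\<tau> \<subseteq> types" "chain_subset (proper_types \<tau>)" using assms by (auto simp: chamber_iff)
  show "finite \<tau>" using \<tau>(2) finite_types by (rule finite_subset)
  show "proper_types \<tau> \<subseteq> nerve G S" using \<tau> by (auto simp: proper_types_def)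
  then show "finite (proper_types \<tau>)" using finite_nerve by (rule finite_subset)
qed

lemma chamber_face:
  assumes \<tau>: "\<tau> \<in> chamber G S" and \<rho>: "\<rho> \<subseteq> \<tau>" "\<rho> \<noteq> {}"
  shows "\<rho> \<in> chamber G S"
proof -
  have "proper_types \<rho> \<subseteq> proper_types \<tau>" using \<rho> by (auto simp: proper_types_def)
  then have "chain_subset (proper_types \<rho>)"
    using chamberD(4)[OF \<tau>] unfolding chain_subset_def by (meson subsetD)
  then show ?thesis using \<rho> chamberD(2)[OF \<tau>] by (simp add: chamber_iff)
qed

lemma chamber_insert_None: "\<tau> \<in> chamber G S \<Longrightarrow> insert None \<tau> \<in> chamber G S"
  by (auto simp: chamber_iff proper_types_def)

lemma singleton_chamber: "v \<in> types \<Longrightarrow> {v} \<in> chamber G S"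
  by (auto simp: chamber_iff proper_types_def chain_subset_def)

lemma finite_chamber: "finite (chamber G S)"
  by (rule finite_subset[of _ "Pow types"]) (use chamberD finite_types in auto)

lemma simplicial_complex_chamber: "simplicial_complex (chamber G S)"
  using chamberD chamber_face by (auto simp: simplicial_complex_def)

lemma davis_simplex: "a \<in> carrier G \<Longrightarrow> \<tau> \<in> chamber G S \<Longrightarrow> dv a ` \<tau> \<in> davis_complex G S"
  by (auto simp: davis_complex_def)

lemma simplicial_complex_davis: "simplicial_complex (davis_complex G S)"
  unfolding simplicial_complex_def
proof (intro conjI ballI allI impI)
  fix \<sigma> assume "\<sigma> \<in> davis_complex G S"
  then obtain a \<tau> where \<sigma>: "a \<in> carrier G" "\<tau> \<in> chamber G S" "\<sigma> = dv a ` \<tau>"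
    by (auto simp: davis_complex_def)
  then show "finite \<sigma>" "\<sigma> \<noteq> {}" using chamberD by auto
  fix \<rho> assume "\<rho> \<noteq> {} \<and> \<rho> \<subseteq> \<sigma>"
  then obtain \<tau>' where "\<tau>' \<subseteq> \<tau>" "\<rho> = dv a ` \<tau>'" "\<tau>' \<noteq> {}"
    using \<sigma>(3) by (metis subset_image_iff image_is_empty)
  then show "\<rho> \<in> davis_complex G S" using \<sigma> chamber_face davis_simplex by blast
qed

lemmas davis_pointD = realizationD[OF simplicial_complex_davis, folded davis_space_def]

lemma davis_point_support:
  assumes "x \<in> X"
  obtains a \<tau> where "a \<in> carrier G" "\<tau> \<in> chamber G S" "support x = dv a ` \<tau>"
  using davis_pointD(3)[OF assms] by (auto simp: davis_complex_def)

lemma vertex_point_davis: "a \<in> carrier G \<Longrightarrow> v \<in> types \<Longrightarrow> vertex_point (dv a v) \<in> X"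
  unfolding davis_space_def
  using davis_simplex[of a "{v}"] singleton_chamber by (intro vertex_point_in_realization) auto

lemma cube_coord_eq:
  assumes a: "a \<in> carrier G" and \<tau>: "\<tau> \<in> chamber G S" and x: "support x \<subseteq> dv a ` \<tau>"
  shows "cube_coord x s = (\<Sum>\<sigma> | \<sigma> \<in> proper_types \<tau> \<and> s \<in> \<sigma>. x (dv a (Some \<sigma>)))"
proof -
  have fin: "finite (dv a ` \<tau>)" using chamberD[OF \<tau>] by simp
  have inj: "inj_on (dv a) \<tau>" using inj_on_davis_vertex[OF a] chamberD[OF \<tau>] inj_on_subset by blast
  have P: "(\<exists>b \<sigma>. (b, Some \<sigma>) \<in> dv a v \<and> s \<in> \<sigma>) \<longleftrightarrow> (\<exists>\<sigma>. v = Some \<sigma> \<and> s \<in> \<sigma>)" if "v \<in> \<tau>" for v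
  proof -
    have "v \<in> types" using that chamberD[OF \<tau>] by blast
    then have "(a, v) \<in> dv a v" by (rule davis_vertex_self[OF a])
    then show ?thesis using a by (cases v) (auto simp: davis_vertex_eq)
  qed
  have "cube_coord x s = (\<Sum>D \<in> {D \<in> dv a ` \<tau>. \<exists>b \<sigma>. (b, Some \<sigma>) \<in> D \<and> s \<in> \<sigma>}. x D)"
    unfolding cube_coord_def using fin x by (intro sum.mono_neutral_left) (auto simp: support_def)
  also have "{D \<in> dv a ` \<tau>. \<exists>b \<sigma>. (b, Some \<sigma>) \<in> D \<and> s \<in> \<sigma>}
      = (\<lambda>\<sigma>. dv a (Some \<sigma>)) ` {\<sigma> \<in> proper_types \<tau>. s \<in> \<sigma>}"
    using P by (force simp: proper_types_def)
  also have "sum x \<dots> = (\<Sum>\<sigma> | \<sigma> \<in> proper_types \<tau> \<and> s \<in> \<sigma>. x (dv a (Some \<sigma>)))"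
  proof (subst sum.reindex)
    show "inj_on (\<lambda>\<sigma>. dv a (Some \<sigma>)) {\<sigma> \<in> proper_types \<tau>. s \<in> \<sigma>}"
      using inj by (auto simp: inj_on_def proper_types_def)
  qed simp
  finally show ?thesis .
qed

definition cube_dist :: "(('a \<times> 'a set option) set \<Rightarrow> real) \<Rightarrow> (('a \<times> 'a set option) set \<Rightarrow> real) \<Rightarrow> real" where
  "cube_dist x y = L2_set (\<lambda>s. cube_coord x s - cube_coord y s) S"

lemma davis_dist_eq: "davis_dist G S = intrinsic_dist (davis_complex G S) cube_dist"
  by (simp add: davis_dist_def cube_dist_def[abs_def])

lemma cube_dist_nonneg: "cube_dist x y \<ge> 0"
  by (simp add: cube_dist_def)

lemma cube_coord_le_cube_dist:
  assumes "s \<in> S" shows "\<bar>cube_coord x s - cube_coord y s\<bar> \<le> cube_dist x y"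
proof -
  have "\<bar>cube_coord x s - cube_coord y s\<bar> \<le> L2_set (\<lambda>s. \<bar>cube_coord x s - cube_coord y s\<bar>) S"
    by (rule member_le_L2_set[OF finite_S assms])
  then show ?thesis by (simp add: cube_dist_def L2_set_def)
qed

text \<open>The weight of a vertex of type \<open>\<sigma>\<close> is the difference of the sums of the weights over \<open>\<rho> \<supseteq> \<sigma>\<close>
and over \<open>\<rho> \<supset> \<sigma>\<close>, and that of the cone point is 1 minus the sum of all others. Each of these sums
is zero or a cube coordinate by \<open>chain_separation\<close>.\<close>

lemma weight_le_cube_dist:
  assumes xy: "x \<in> X" "y \<in> X" and \<Sigma>: "\<Sigma> \<in> davis_complex G S" "support x \<subseteq> \<Sigma>" "support y \<subseteq> \<Sigma>"
  shows "\<bar>x D - y D\<bar> \<le> 2 * cube_dist x y"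
proof (cases "D \<in> \<Sigma>")
  case False
  then have "x D = 0" "y D = 0" using \<Sigma> by (auto simp: support_def)
  then show ?thesis using cube_dist_nonneg by simp
next
  case True
  obtain a \<tau> where a: "a \<in> carrier G" and \<tau>: "\<tau> \<in> chamber G S" and \<Sigma>_eq: "\<Sigma> = dv a ` \<tau>"
    using \<Sigma>(1) by (auto simp: davis_complex_def)
  let ?c = "proper_types \<tau>"
  define wt where "wt z E = (\<Sum>\<sigma>\<in>E. z (dv a (Some \<sigma>)))" for z :: "('a \<times> 'a set option) set \<Rightarrow> real" and E
  note \<tau>' = chamberD[OF \<tau>]
  \<comment> \<open>an upper set is separated by a generator, and its weight is a cube coordinate\<close>
  have upper: "\<bar>wt x E - wt y E\<bar> \<le> cube_dist x y"
    if E: "E \<subseteq> ?c" "\<And>\<sigma> \<rho>. \<sigma> \<in> E \<Longrightarrow> \<rho> \<in> ?c \<Longrightarrow> \<sigma> \<subseteq> \<rho> \<Longrightarrow> \<rho> \<in> E" for E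
  proof (cases "E = {}")
    case True
    then show ?thesis using cube_dist_nonneg by (simp add: wt_def)
  next
    case False
    have "{} \<notin> ?c" using \<tau>'(6) nerveD by blast
    then obtain s where s: "s \<in> \<Union>?c" "{\<sigma> \<in> ?c. s \<in> \<sigma>} = E"
      using chain_separation[OF \<tau>'(5,4) _ E(1) False] E(2) by metis
    have "s \<in> S" using s(1) \<tau>'(6) nerveD by blast
    moreover have "cube_coord x s = wt x E" "cube_coord y s = wt y E"
      using cube_coord_eq[OF a \<tau>] \<Sigma> \<Sigma>_eq s(2) by (simp_all add: wt_def)
    ultimately show ?thesis using cube_coord_le_cube_dist by metis
  qed
  obtain v where v: "v \<in> \<tau>" "D = dv a v" using True \<Sigma>_eq by blast
  show ?thesis
  proof (cases v)
    case (Some \<sigma>)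
    have \<sigma>: "\<sigma> \<in> ?c" using v Some by (simp add: proper_types_def)
    have eq: "z D = wt z {\<rho> \<in> ?c. \<sigma> \<subseteq> \<rho>} - wt z {\<rho> \<in> ?c. \<sigma> \<subset> \<rho>}" for z
    proof -
      have "{\<rho> \<in> ?c. \<sigma> \<subseteq> \<rho>} = insert \<sigma> {\<rho> \<in> ?c. \<sigma> \<subset> \<rho>}" using \<sigma> by blast
      then show ?thesis using \<tau>'(5) v Some by (simp add: wt_def)
    qed
    have "\<bar>wt x {\<rho> \<in> ?c. \<sigma> \<subseteq> \<rho>} - wt y {\<rho> \<in> ?c. \<sigma> \<subseteq> \<rho>}\<bar> \<le> cube_dist x y"
      "\<bar>wt x {\<rho> \<in> ?c. \<sigma> \<subset> \<rho>} - wt y {\<rho> \<in> ?c. \<sigma> \<subset> \<rho>}\<bar> \<le> cube_dist x y"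
      by (rule upper; blast)+
    then show ?thesis unfolding eq by linarith
  next
    case None
    have eq: "z D = 1 - wt z ?c" if z: "z \<in> X" "support z \<subseteq> \<Sigma>" for z
    proof -
      have \<tau>_eq: "\<tau> = insert None (Some ` ?c)"
      proof -
        have "u \<in> \<tau> \<longleftrightarrow> u \<in> insert None (Some ` ?c)" for u
          using v None by (cases u) (auto simp: proper_types_def)
        then show ?thesis by blast
      qed
      have "1 = sum z (support z)" using z by (simp add: davis_space_def realization_def)
      also have "\<dots> = sum z \<Sigma>"
        using z \<tau>'(3) \<Sigma>_eq by (intro sum.mono_neutral_left) (auto simp: support_def)
      also have "\<dots> = (\<Sum>u\<in>\<tau>. z (dv a u))"
        unfolding \<Sigma>_eq using inj_on_subset[OF inj_on_davis_vertex[OF a] \<tau>'(2)]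
        by (subst sum.reindex) auto
      also have "\<dots> = z (dv a None) + (\<Sum>u\<in>Some ` ?c. z (dv a u))"
        by (subst \<tau>_eq, subst sum.insert) (use \<tau>'(5) in auto)
      also have "(\<Sum>u\<in>Some ` ?c. z (dv a u)) = wt z ?c"
        unfolding wt_def by (subst sum.reindex) auto
      finally show ?thesis using v None by simp
    qed
    have "\<bar>wt x ?c - wt y ?c\<bar> \<le> cube_dist x y" by (rule upper) auto
    then show ?thesis
      using eq[OF xy(1) \<Sigma>(2)] eq[OF xy(2) \<Sigma>(3)] cube_dist_nonneg[of x y] by linarith
  qed
qed

lemma cube_dist_le_weights:
  assumes \<Sigma>: "\<Sigma> \<in> davis_complex G S" "support x \<subseteq> \<Sigma>" "support y \<subseteq> \<Sigma>"
  shows "cube_dist x y \<le> real (card S) * (\<Sum>D\<in>\<Sigma>. \<bar>x D - y D\<bar>)"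
proof -
  have fin: "finite \<Sigma>" using simplicial_complex_davis \<Sigma>(1) by (simp add: simplicial_complex_def)
  define P where "P s D \<longleftrightarrow> (\<exists>a \<sigma>. (a, Some \<sigma>) \<in> D \<and> s \<in> \<sigma>)" for s :: 'a and D :: "('a \<times> 'a set option) set"
  have eq: "cube_coord z s = (\<Sum>D\<in>{D \<in> \<Sigma>. P s D}. z D)" if "support z \<subseteq> \<Sigma>" for z s
    unfolding cube_coord_def P_def using fin that
    by (intro sum.mono_neutral_left) (auto simp: support_def)
  have "cube_dist x y \<le> (\<Sum>s\<in>S. \<bar>cube_coord x s - cube_coord y s\<bar>)"
    unfolding cube_dist_def by (rule L2_set_le_sum_abs)
  also have "\<dots> \<le> (\<Sum>s\<in>S. \<Sum>D\<in>\<Sigma>. \<bar>x D - y D\<bar>)"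
  proof (rule sum_mono)
    fix s
    have "\<bar>cube_coord x s - cube_coord y s\<bar> = \<bar>\<Sum>D\<in>{D \<in> \<Sigma>. P s D}. x D - y D\<bar>"
      using \<Sigma> by (simp add: eq sum_subtractf)
    also have "\<dots> \<le> (\<Sum>D\<in>{D \<in> \<Sigma>. P s D}. \<bar>x D - y D\<bar>)" by (rule sum_abs)
    also have "\<dots> \<le> (\<Sum>D\<in>\<Sigma>. \<bar>x D - y D\<bar>)" using fin by (intro sum_mono2) auto
    finally show "\<bar>cube_coord x s - cube_coord y s\<bar> \<le> (\<Sum>D\<in>\<Sigma>. \<bar>x D - y D\<bar>)" .
  qed
  finally show ?thesis by simp
qed

lemma joined_cone_point:
  assumes "x \<in> X" "a \<in> carrier G" "\<tau> \<in> chamber G S" "support x = dv a ` \<tau>"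
  shows "joined (davis_complex G S) x (vertex_point (dv a None))"
  using assms davis_simplex[OF assms(2) chamber_insert_None[OF assms(3)]]
    vertex_point_davis[OF assms(2), of None]
  by (intro joined_step[of _ _ _ "dv a ` insert None \<tau>"]) (auto simp: davis_space_def)

lemma joined_vertex_points:
  assumes "a \<in> carrier G" "v \<in> types"
  shows "joined (davis_complex G S) (vertex_point (dv a v)) (vertex_point (dv a None))"
  by (rule joined_cone_point[of _ a "{v}"])
    (use assms vertex_point_davis singleton_chamber in auto)

text \<open>Adjacent chambers share the barycentre of their common mirror; a word leads from chamber to
chamber.\<close>

lemma joined_cone_points:
  assumes "w \<in> lists S" "a \<in> carrier G"
  shows "joined (davis_complex G S) (vertex_point (dv a None)) (vertex_point (dv (a \<otimes> word_value G w) None))"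
  using assms
proof (induction w arbitrary: a)
  case Nil
  then show ?case using joined_refl vertex_point_davis[of a None] by (simp add: davis_space_def)
next
  case (Cons s w)
  then have s: "s \<in> S" "s \<in> carrier G" "Some {s} \<in> types" by (auto simp: S_in singleton_nerve)
  have eq: "dv a (Some {s}) = dv (a \<otimes> s) (Some {s})"
    using s Cons.prems by (subst davis_vertex_eq_iff) (auto simp: cancel_inv_left generate.incl)
  have "joined (davis_complex G S) (vertex_point (dv a (Some {s}))) (vertex_point (dv a None))"
    "joined (davis_complex G S) (vertex_point (dv a (Some {s}))) (vertex_point (dv (a \<otimes> s) None))"
    using joined_vertex_points[of a "Some {s}"] joined_vertex_points[of "a \<otimes> s" "Some {s}"] eq s Cons.prems
    by simp_all
  then have step: "joined (davis_complex G S) (vertex_point (dv a None)) (vertex_point (dv (a \<otimes> s) None))"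
    using joined_trans[OF joined_sym] by blast
  have "joined (davis_complex G S) (vertex_point (dv (a \<otimes> s) None))
      (vertex_point (dv (a \<otimes> s \<otimes> word_value G w) None))"
    using Cons.IH[of "a \<otimes> s"] Cons.prems s by simp
  from joined_trans[OF step this] show ?case using s Cons.prems Cons.hyps by (simp add: m_assoc)
qed

lemma davis_connected:
  assumes "x \<in> X" "y \<in> X" shows "joined (davis_complex G S) x y"
proof -
  obtain a \<tau> where a: "a \<in> carrier G" "\<tau> \<in> chamber G S" "support x = dv a ` \<tau>"
    using davis_point_support[OF assms(1)] .
  obtain b \<tau>' where b: "b \<in> carrier G" "\<tau>' \<in> chamber G S" "support y = dv b ` \<tau>'"
    using davis_point_support[OF assms(2)] .
  have "inv a \<otimes> b \<in> carrier G" using a b by simp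
  then obtain w where w: "w \<in> lists S" "word_value G w = inv a \<otimes> b" by (rule carrier_word)
  have "a \<otimes> word_value G w = b" using a b w by (simp add: m_assoc[symmetric])
  then have "joined (davis_complex G S) (vertex_point (dv a None)) (vertex_point (dv b None))"
    using joined_cone_points[OF w(1) a(1)] by simp
  then show ?thesis
    using joined_cone_point[OF assms(1) a] joined_cone_point[OF assms(2) b]
    by (blast intro: joined_sym joined_trans)
qed

end

sublocale racg \<subseteq> davis: intrinsic "davis_complex G S" cube_dist
proof
  show "cube_dist x y = cube_dist y x" for x y
    by (simp add: cube_dist_def L2_set_def power2_commute)
qed (use cube_dist_nonneg davis_connected in \<open>auto simp: davis_space_def\<close>)

context racg
begin

text \<open>The local bound on simplices is global, since a coordinate is a function on the whole
complex.\<close>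

lemma weight_Lipschitz:
  assumes "x \<in> X" "y \<in> X" shows "\<bar>x D - y D\<bar> \<le> 2 * davis_dist G S x y"
  unfolding davis_dist_eq using assms weight_le_cube_dist
  by (intro davis.Lipschitz) (auto simp: davis_space_def)

lemma davis_dist_le_weights:
  assumes "x \<in> X" "y \<in> X" "\<Sigma> \<in> davis_complex G S" "support x \<subseteq> \<Sigma>" "support y \<subseteq> \<Sigma>"
  shows "davis_dist G S x y \<le> real (card S) * (\<Sum>D\<in>\<Sigma>. \<bar>x D - y D\<bar>)"
  unfolding davis_dist_eq
  using davis.le_e[of x y \<Sigma>] cube_dist_le_weights[of \<Sigma> x y] assms by (auto simp: davis_space_def)

text \<open>Only the separation of points is specific to the Davis complex: all coordinates agree at
distance zero.\<close>

lemma Metric_space_davis: "Metric_space X (davis_dist G S)"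
proof
  fix x y z
  show "0 \<le> davis_dist G S x y" unfolding davis_dist_eq by (rule davis.nonneg)
  show "davis_dist G S x y = davis_dist G S y x" unfolding davis_dist_eq by (rule davis.sym)
  show "davis_dist G S x y = 0 \<longleftrightarrow> x = y" if "x \<in> X" "y \<in> X"
  proof
    assume "davis_dist G S x y = 0"
    then have "x D = y D" for D using weight_Lipschitz[OF that, of D] by simp
    then show "x = y" by blast
  next
    assume "x = y"
    moreover have "davis_dist G S x x \<le> 0"
      using davis_dist_le_weights[OF that(1,1) davis_pointD(3)[OF that(1)]] by simp
    ultimately show "davis_dist G S x y = 0"
      using davis.nonneg[of x x] by (simp add: davis_dist_eq)
  qed
  show "davis_dist G S x z \<le> davis_dist G S x y + davis_dist G S y z"
    if "x \<in> X" "y \<in> X" "z \<in> X"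
    unfolding davis_dist_eq using that by (intro davis.triangle) (auto simp: davis_space_def)
qed

lemma cube_coord_translate:
  assumes g: "g \<in> carrier G" and x: "x \<in> X"
  shows "cube_coord (push (translate G g) x) s = cube_coord x s"
proof -
  define P where "P D \<longleftrightarrow> (\<exists>a \<sigma>. (a, Some \<sigma>) \<in> D \<and> s \<in> \<sigma>)" for D :: "('a \<times> 'a set option) set"
  have P: "P (translate G g D) \<longleftrightarrow> P D" for D
    unfolding P_def translate_def by force
  have sup: "support (push (translate G g) x) = translate G g ` support x"
    by (rule support_push) (use davis_pointD[OF x] in auto)
  have "cube_coord (push (translate G g) x) s
      = (\<Sum>v | v \<in> support x \<and> translate G g v \<in> {D \<in> translate G g ` support x. P D}. x v)"
    unfolding cube_coord_def sup P_def[symmetric] using davis_pointD[OF x] by (intro sum_push) auto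
  also have "{v. v \<in> support x \<and> translate G g v \<in> {D \<in> translate G g ` support x. P D}}
      = {D \<in> support x. P D}"
    using P by auto
  finally show ?thesis by (simp add: cube_coord_def P_def)
qed

lemma translate_simplex:
  assumes "g \<in> carrier G" "\<sigma> \<in> davis_complex G S"
  shows "translate G g ` \<sigma> \<in> davis_complex G S"
proof -
  obtain a \<tau> where "a \<in> carrier G" "\<tau> \<in> chamber G S" "\<sigma> = dv a ` \<tau>"
    using assms(2) by (auto simp: davis_complex_def)
  then have "translate G g ` \<sigma> = dv (g \<otimes> a) ` \<tau>"
    using assms(1) by (simp add: image_image translate_davis_vertex)
  then show ?thesis using \<open>a \<in> carrier G\<close> \<open>\<tau> \<in> chamber G S\<close> assms(1) davis_simplex by simp
qed

lemma push_translate: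
  assumes "g \<in> carrier G" "x \<in> X" shows "push (translate G g) x \<in> X"
  unfolding davis_space_def
  by (rule push_in_realization[OF simplicial_complex_davis])
    (use assms translate_simplex davis_pointD(3)[OF assms(2)] in \<open>auto simp: davis_space_def\<close>)

lemma push_translate_inverse:
  assumes g: "g \<in> carrier G" and x: "x \<in> X"
  shows "push (translate G (inv g)) (push (translate G g) x) = x"
proof (rule push_inverse)
  show "finite (support x)" using davis_pointD(1)[OF x] .
  obtain a \<tau> where a: "a \<in> carrier G" "\<tau> \<in> chamber G S" "support x = dv a ` \<tau>"
    using davis_point_support[OF x] .
  fix D assume "D \<in> support x"
  then obtain v where "D = dv a v" using a by blast
  then show "translate G (inv g) (translate G g D) = D"
    using a(1) g by (simp add: translate_davis_vertex m_assoc[symmetric])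
qed

text \<open>Translations are simplicial and preserve types, hence cube coordinates.\<close>

lemma davis_dist_translate:
  assumes g: "g \<in> carrier G" and xy: "x \<in> X" "y \<in> X"
  shows "davis_dist G S (push (translate G g) x) (push (translate G g) y) = davis_dist G S x y"
proof -
  have le: "davis_dist G S (push (translate G h) x) (push (translate G h) y) \<le> davis_dist G S x y"
    if "h \<in> carrier G" "x \<in> X" "y \<in> X" for h x y
    unfolding davis_dist_eq
    by (rule davis.push_le[OF simplicial_complex_davis])
      (use that translate_simplex cube_coord_translate in \<open>auto simp: cube_dist_def davis_space_def\<close>)
  show ?thesis
  proof (rule antisym)
    have "davis_dist G S (push (translate G (inv g)) (push (translate G g) x))
        (push (translate G (inv g)) (push (translate G g) y))
      \<le> davis_dist G S (push (translate G g) x) (push (translate G g) y)"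
      using g xy by (intro le push_translate) auto
    then show "davis_dist G S x y \<le> davis_dist G S (push (translate G g) x) (push (translate G g) y)"
      using g xy by (simp add: push_translate_inverse)
  qed (use le g xy in blast)
qed

end


section \<open>Chambers, their neighbours and their interiors\<close>

context racg
begin

definition piece :: "'a \<Rightarrow> (('a \<times> 'a set option) set \<Rightarrow> real) set" where
  "piece a = {x \<in> X. support x \<subseteq> dv a ` types}"

lemma piece_subset: "piece a \<subseteq> X"
  by (auto simp: piece_def)

text \<open>A simplex with all its vertices in the chamber of \<open>a\<close> is a simplex of that chamber, since
each of its vertices is determined by its type.\<close>

lemma piece_support:
  assumes a: "a \<in> carrier G" and x: "x \<in> piece a"
  obtains \<tau> where "\<tau> \<in> chamber G S" "support x = dv a ` \<tau>"
proof -
  have "x \<in> X" using x by (simp add: piece_def)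
  then obtain b \<tau> where b: "b \<in> carrier G" "\<tau> \<in> chamber G S" "support x = dv b ` \<tau>"
    by (rule davis_point_support)
  have "dv b v = dv a v" if v: "v \<in> \<tau>" for v
  proof -
    have "dv b v \<in> dv a ` types" using v b(3) x by (auto simp: piece_def)
    then obtain w where w: "w \<in> types" "dv b v = dv a w" by blast
    have "v \<in> types" using v chamberD(2)[OF b(2)] by blast
    then have "v = w" using w a b(1) by (metis vtype_davis_vertex)
    then show ?thesis using w by simp
  qed
  then have "support x = dv a ` \<tau>" using b(3) by simp
  then show ?thesis using that b(2) by blast
qed

lemma pieceI:
  assumes "x \<in> X" "\<tau> \<in> chamber G S" "support x = dv a ` \<tau>"
  shows "x \<in> piece a"
  using assms chamberD(2)[OF assms(2)] by (auto simp: piece_def)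

lemma in_piece_iff:
  assumes a: "a \<in> carrier G" and b: "b \<in> carrier G" and x: "x \<in> X"
    and \<tau>: "\<tau> \<in> chamber G S" "support x = dv a ` \<tau>"
  shows "x \<in> piece b \<longleftrightarrow> (\<forall>v\<in>\<tau>. inv a \<otimes> b \<in> vertex_group G v)"
proof
  assume "x \<in> piece b"
  then obtain \<tau>' where \<tau>': "\<tau>' \<in> chamber G S" "support x = dv b ` \<tau>'"
    by (rule piece_support[OF b])
  show "\<forall>v\<in>\<tau>. inv a \<otimes> b \<in> vertex_group G v"
  proof
    fix v assume v: "v \<in> \<tau>"
    then obtain w where w: "w \<in> \<tau>'" "dv a v = dv b w" using \<tau> \<tau>' by (metis imageE imageI)
    have "v \<in> types" "w \<in> types" using v w chamberD(2) \<tau>(1) \<tau>'(1) by auto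
    then show "inv a \<otimes> b \<in> vertex_group G v" using w(2) davis_vertex_eq_iff[OF a b] by blast
  qed
next
  assume *: "\<forall>v\<in>\<tau>. inv a \<otimes> b \<in> vertex_group G v"
  have "dv a v = dv b v" if "v \<in> \<tau>" for v
  proof -
    have "v \<in> types" using that chamberD(2)[OF \<tau>(1)] by blast
    then show ?thesis using that * a b by (simp add: davis_vertex_eq_iff)
  qed
  then have "support x = dv b ` \<tau>" using \<tau>(2) by simp
  then show "x \<in> piece b" by (rule pieceI[OF x \<tau>(1)])
qed

lemma point_in_some_piece:
  assumes "x \<in> X" obtains a where "a \<in> carrier G" "x \<in> piece a"
  using davis_point_support[OF assms] pieceI[OF assms] by metis

lemma vertex_point_in_piece: "a \<in> carrier G \<Longrightarrow> v \<in> types \<Longrightarrow> vertex_point (dv a v) \<in> piece a"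
  using vertex_point_davis by (simp add: piece_def)

text \<open>Cone points are not identified, so each of them lies in one chamber only.\<close>

lemma cone_point_unique:
  assumes a: "a \<in> carrier G" and b: "b \<in> carrier G" and x: "x \<in> piece b" "dv a None \<in> support x"
  shows "a = b"
proof -
  obtain \<tau> where \<tau>: "\<tau> \<in> chamber G S" "support x = dv b ` \<tau>" using piece_support[OF b x(1)] .
  then obtain v where v: "v \<in> \<tau>" "dv a None = dv b v" using x(2) by auto
  have "v \<in> types" using v \<tau> chamberD by blast
  then have "inv a \<otimes> b = \<one>" using v a b by (auto simp: davis_vertex_eq_iff)
  then show ?thesis using a b by (metis inv_equality inv_inv inv_closed)
qed

lemma inj_on_piece: "inj_on piece (carrier G)"
proof (rule inj_onI)
  fix a b assume "a \<in> carrier G" "b \<in> carrier G" "piece a = piece b"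
  then show "a = b"
    using cone_point_unique[of a b "vertex_point (dv a None)"] vertex_point_in_piece[of a None] by auto
qed

lemma cone_point_piece:
  assumes "a \<in> carrier G" "x \<in> X" "dv a None \<in> support x"
  shows "x \<in> piece a"
proof -
  obtain b where b: "b \<in> carrier G" "x \<in> piece b" using point_in_some_piece[OF assms(2)] .
  then have "a = b" using cone_point_unique[OF assms(1) b(1) b(2) assms(3)] by simp
  then show ?thesis using b by simp
qed

text \<open>This is the mirror that separates the chambers of \<open>a\<close> and \<open>a s\<close>. They share a vertex of type
\<open>\<sigma>\<close> if \<open>s\<close> lies in the subgroup generated by \<open>\<sigma>\<close>, which by \<open>generator_in_generate\<close> means that \<open>s\<close>
lies in \<open>\<sigma>\<close>.\<close>

lemma in_neighbour_iff:
  assumes a: "a \<in> carrier G" and s: "s \<in> S" and x: "x \<in> X"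
    and \<tau>: "\<tau> \<in> chamber G S" "support x = dv a ` \<tau>"
  shows "x \<in> piece (a \<otimes> s) \<longleftrightarrow> (\<forall>v\<in>\<tau>. s \<in> type_set v)"
proof -
  have sc: "s \<in> carrier G" using s by (rule S_in)
  have "inv a \<otimes> (a \<otimes> s) = s" using a sc by (simp add: cancel_inv_left)
  moreover have "s \<in> vertex_group G v \<longleftrightarrow> s \<in> type_set v" if "v \<in> \<tau>" for v
  proof (cases v)
    case None
    then show ?thesis using s one_notin_S by auto
  next
    case (Some \<sigma>)
    then have "\<sigma> \<in> nerve G S" using that chamberD(2)[OF \<tau>(1)] by auto
    then show ?thesis using Some s generator_in_generate[OF s, of \<sigma>] nerveD generate.incl by auto
  qed
  ultimately show ?thesis using in_piece_iff[OF a _ x \<tau>, of "a \<otimes> s"] a sc by simp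
qed

text \<open>The members of a chain of nonempty simplices share the elements of the least one; so the
mirrors cover everything away from the star of the cone point.\<close>

lemma common_generator:
  assumes \<tau>: "\<tau> \<in> chamber G S" "None \<notin> \<tau>"
  obtains s where "s \<in> S" "\<forall>v\<in>\<tau>. s \<in> type_set v"
proof -
  note \<tau>' = chamberD[OF \<tau>(1)]
  have "\<exists>\<sigma>. Some \<sigma> \<in> \<tau>" using \<tau>'(1) \<tau>(2) by (metis not_None_eq equals0I)
  then have ne: "proper_types \<tau> \<noteq> {}" by (auto simp: proper_types_def)
  have "{} \<notin> proper_types \<tau>" using \<tau>'(6) nerveD by blast
  then obtain s where s: "s \<in> \<Union>(proper_types \<tau>)" "{\<sigma> \<in> proper_types \<tau>. s \<in> \<sigma>} = proper_types \<tau>"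
    using chain_separation[OF \<tau>'(5,4) _ subset_refl ne] by metis
  have "s \<in> S" using s(1) \<tau>'(6) nerveD by blast
  moreover have "s \<in> type_set v" if "v \<in> \<tau>" for v
  proof (cases v)
    case None
    then show ?thesis using that \<tau>(2) by simp
  next
    case (Some \<sigma>)
    then have "\<sigma> \<in> proper_types \<tau>" using that by (simp add: proper_types_def)
    then show ?thesis using s(2) Some by auto
  qed
  ultimately show ?thesis using that by blast
qed

end

sublocale racg \<subseteq> davis_metric: Metric_space "davis_space G S" "davis_dist G S"
  by (rule Metric_space_davis)

context racg
begin

abbreviation intr where "intr A \<equiv> davis_metric.mtopology interior_of A"

text \<open>The point \<open>y\<close> lies on the segment from \<open>x\<close> to the cone point.\<close>

lemma approach_cone_point:
  assumes c: "c \<in> carrier G" and x: "x \<in> piece c" and r: "r > 0"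
  obtains y where "y \<in> davis_metric.mball x r" "dv c None \<in> support y"
proof -
  have xX: "x \<in> X" using x by (simp add: piece_def)
  obtain \<tau> where \<tau>: "\<tau> \<in> chamber G S" "support x = dv c ` \<tau>" using piece_support[OF c x] .
  let ?p = "vertex_point (dv c None)"
  let ?\<Sigma> = "dv c ` insert None \<tau>"
  have \<Sigma>: "?\<Sigma> \<in> davis_complex G S" using davis_simplex[OF c chamber_insert_None[OF \<tau>(1)]] .
  have fin: "finite ?\<Sigma>" using chamberD(3)[OF \<tau>(1)] by simp
  define N where "N = real (card S * card ?\<Sigma>)"
  define \<epsilon> where "\<epsilon> = min (1/2) (r / (N + 1))"
  have N: "N \<ge> 0" by (simp add: N_def)
  have \<epsilon>: "0 < \<epsilon>" "\<epsilon> < 1" "N * \<epsilon> < r"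
  proof -
    show "0 < \<epsilon>" "\<epsilon> < 1" using r N by (auto simp: \<epsilon>_def)
    have "N * \<epsilon> \<le> N * (r / (N + 1))" using N by (intro mult_left_mono) (auto simp: \<epsilon>_def)
    also have "\<dots> < r" using r N by (simp add: field_simps)
    finally show "N * \<epsilon> < r" .
  qed
  define y where "y D = (1 - \<epsilon>) * x D + \<epsilon> * ?p D" for D
  have pos: "y D \<ge> 0" for D
    using \<epsilon> davis_pointD(4)[OF xX, of D] by (simp add: y_def vertex_point_def)
  have yp: "y (dv c None) > 0"
    using \<epsilon> davis_pointD(4)[OF xX, of "dv c None"] by (simp add: y_def vertex_point_def add_nonneg_pos)
  have sy: "support y \<subseteq> ?\<Sigma>"
  proof
    fix D assume "D \<in> support y"
    then have "x D \<noteq> 0 \<or> ?p D \<noteq> 0" by (auto simp: support_def y_def)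
    then have "D \<in> support x \<or> D \<in> support ?p" by (simp add: support_def)
    then show "D \<in> ?\<Sigma>" using \<tau>(2) by auto
  qed
  have sub: "support z \<subseteq> ?\<Sigma> \<Longrightarrow> sum z ?\<Sigma> = sum z (support z)" for z :: "_ \<Rightarrow> real"
    using fin by (intro sum.mono_neutral_right) (auto simp: support_def)
  have "sum y ?\<Sigma> = (1 - \<epsilon>) * sum x ?\<Sigma> + \<epsilon> * sum ?p ?\<Sigma>"
    by (simp add: y_def sum.distrib sum_distrib_left)
  also have "sum x ?\<Sigma> = 1"
    using xX \<tau>(2) by (subst sub) (auto simp: davis_space_def realization_def)
  also have "sum ?p ?\<Sigma> = sum ?p {dv c None}"
    using sub[of ?p] by simp
  also have "\<dots> = 1" by (simp add: vertex_point_def)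
  finally have sum_y: "sum y (support y) = 1" using sub[OF sy] by simp
  have "dv c None \<in> support y" using yp by (simp add: support_def)
  then have "support y \<noteq> {}" by blast
  then have "support y \<in> davis_complex G S"
    using sy \<Sigma> simplicial_complex_davis unfolding simplicial_complex_def by metis
  then have yX: "y \<in> X" using pos sum_y by (simp add: davis_space_def realization_def)
  have "davis_dist G S x y \<le> real (card S) * (\<Sum>D\<in>?\<Sigma>. \<bar>x D - y D\<bar>)"
    using \<tau>(2) sy by (intro davis_dist_le_weights[OF xX yX \<Sigma>]) auto
  also have "\<dots> \<le> real (card S) * (\<Sum>D\<in>?\<Sigma>. \<epsilon>)"
  proof (intro mult_left_mono sum_mono)
    fix D
    have "x D \<le> 1"
    proof (cases "D \<in> support x")
      case True
      then have "x D \<le> sum x (support x)"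
        using davis_pointD[OF xX] by (intro member_le_sum) auto
      then show ?thesis using xX by (simp add: davis_space_def realization_def)
    qed (auto simp: support_def)
    then have "\<bar>x D - ?p D\<bar> \<le> 1"
      using davis_pointD(4)[OF xX, of D] by (cases "D = dv c None") (auto simp: vertex_point_def)
    then have "\<epsilon> * \<bar>x D - ?p D\<bar> \<le> \<epsilon>" using \<epsilon> by (simp add: mult_left_le)
    moreover have "\<bar>x D - y D\<bar> = \<epsilon> * \<bar>x D - ?p D\<bar>"
    proof -
      have "x D - y D = \<epsilon> * (x D - ?p D)" by (simp add: y_def algebra_simps)
      then show ?thesis using \<epsilon> by (simp add: abs_mult)
    qed
    ultimately show "\<bar>x D - y D\<bar> \<le> \<epsilon>" by simp
  qed simp
  also have "\<dots> = N * \<epsilon>" by (simp add: N_def)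
  finally have "y \<in> davis_metric.mball x r" using \<epsilon>(3) xX yX by simp
  moreover have "dv c None \<in> support y" using yp by (simp add: support_def)
  ultimately show ?thesis using that by blast
qed

lemma interior_meets_cone_point:
  assumes "c \<in> carrier G" "x \<in> piece c" "x \<in> intr A"
  obtains y where "y \<in> A" "dv c None \<in> support y"
  using assms approach_cone_point[of c x] by (metis davis_metric.in_interior_of_mball subsetD)

text \<open>A point at distance \<open>r\<close> differs in each weight by at most \<open>2 r\<close>, so nearby points have a
positive weight at the same cone point.\<close>

lemma cone_point_interior:
  assumes a: "a \<in> carrier G" and x: "x \<in> X" "dv a None \<in> support x"
  shows "x \<in> intr (piece a)"
  unfolding davis_metric.in_interior_of_mball
proof (intro conjI exI[of _ "x (dv a None) / 2"])
  show "x \<in> X" by fact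
  have pos: "x (dv a None) > 0"
    using x(2) davis_pointD(4)[OF x(1), of "dv a None"] by (auto simp: support_def less_le)
  then show "x (dv a None) / 2 > 0" by simp
  show "davis_metric.mball x (x (dv a None) / 2) \<subseteq> piece a"
  proof
    fix y assume "y \<in> davis_metric.mball x (x (dv a None) / 2)"
    then have y: "y \<in> X" "davis_dist G S x y < x (dv a None) / 2" by auto
    have "\<bar>x (dv a None) - y (dv a None)\<bar> < x (dv a None)"
      using weight_Lipschitz[OF x(1) y(1), of "dv a None"] y(2) by simp
    then have "dv a None \<in> support y" by (auto simp: support_def)
    then show "y \<in> piece a" by (rule cone_point_piece[OF a y(1)])
  qed
qed

lemma boundary_has_neighbour:
  assumes a: "a \<in> carrier G" and x: "x \<in> piece a" "dv a None \<notin> support x"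
  obtains s where "s \<in> S" "x \<in> piece (a \<otimes> s)"
proof -
  obtain \<tau> where \<tau>: "\<tau> \<in> chamber G S" "support x = dv a ` \<tau>" using piece_support[OF a x(1)] .
  then have "None \<notin> \<tau>" using x(2) by auto
  then obtain s where "s \<in> S" "\<forall>v\<in>\<tau>. s \<in> type_set v" using common_generator[OF \<tau>(1)] by blast
  then show ?thesis using that in_neighbour_iff[OF a _ _ \<tau>] x piece_subset by blast
qed

lemma mult_generator_neq: "a \<in> carrier G \<Longrightarrow> s \<in> S \<Longrightarrow> a \<otimes> s \<noteq> a"
  using one_notin_S S_in[of s] by auto

lemma interior_piece:
  assumes a: "a \<in> carrier G"
  shows "intr (piece a) = {x \<in> piece a. dv a None \<in> support x}"
proof (intro equalityI subsetI)
  fix x assume "x \<in> {x \<in> piece a. dv a None \<in> support x}"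
  then show "x \<in> intr (piece a)" using cone_point_interior[OF a] piece_subset by blast
next
  fix x assume x: "x \<in> intr (piece a)"
  then have xa: "x \<in> piece a" using interior_of_subset by (metis subsetD)
  have "dv a None \<in> support x"
  proof (rule ccontr)
    assume "dv a None \<notin> support x"
    then obtain s where s: "s \<in> S" "x \<in> piece (a \<otimes> s)" using boundary_has_neighbour[OF a xa] by blast
    have as: "a \<otimes> s \<in> carrier G" using a S_in[OF s(1)] by simp
    obtain y where "y \<in> piece a" "dv (a \<otimes> s) None \<in> support y"
      using interior_meets_cone_point[OF as s(2) x] .
    then have "a \<otimes> s = a" using cone_point_unique[OF as a] by blast
    then show False using mult_generator_neq[OF a s(1)] by simp
  qed
  then show "x \<in> {x \<in> piece a. dv a None \<in> support x}" using xa by blast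
qed

text \<open>A point that is interior to the union but to neither chamber lies on a mirror of one of the
two, and the chamber behind this mirror must be the other one.\<close>

lemma interior_union_adjacent:
  assumes a: "a \<in> carrier G" and b: "b \<in> carrier G"
    and neq: "intr (piece a \<union> piece b) \<noteq> intr (piece a) \<union> intr (piece b)"
  obtains s where "s \<in> S" "b = a \<otimes> s"
proof -
  have ab: "a \<noteq> b" using neq by auto
  have "intr (piece a) \<union> intr (piece b) \<subseteq> intr (piece a \<union> piece b)"
    by (simp add: interior_of_mono)
  then obtain x where x: "x \<in> intr (piece a \<union> piece b)" "x \<notin> intr (piece a)" "x \<notin> intr (piece b)"
    using neq by blast
  \<comment> \<open>a third chamber through \<open>x\<close> would have interior points near \<open>x\<close>\<close>
  have covered: "c = a \<or> c = b" if c: "c \<in> carrier G" "x \<in> piece c" for c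
  proof -
    obtain y where "y \<in> piece a \<union> piece b" "dv c None \<in> support y"
      using interior_meets_cone_point[OF c x(1)] .
    then show ?thesis using cone_point_unique[OF c(1) a] cone_point_unique[OF c(1) b] by blast
  qed
  have "x \<in> piece a \<union> piece b" using x(1) interior_of_subset by (metis subsetD)
  then show ?thesis
  proof
    assume xa: "x \<in> piece a"
    then have "dv a None \<notin> support x" using x(2) interior_piece[OF a] by blast
    then obtain s where s: "s \<in> S" "x \<in> piece (a \<otimes> s)" using boundary_has_neighbour[OF a xa] by blast
    then have "b = a \<otimes> s" using covered[of "a \<otimes> s"] mult_generator_neq[OF a s(1)] a S_in by auto
    then show ?thesis using that s(1) by blast
  next
    assume xb: "x \<in> piece b"
    then have "dv b None \<notin> support x" using x(3) interior_piece[OF b] by blast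
    then obtain s where s: "s \<in> S" "x \<in> piece (b \<otimes> s)" using boundary_has_neighbour[OF b xb] by blast
    then have "a = b \<otimes> s" using covered[of "b \<otimes> s"] mult_generator_neq[OF b s(1)] b S_in by auto
    then have "b = a \<otimes> s" using b s(1) S_in by (simp add: m_assoc S_square)
    then show ?thesis using that s(1) by blast
  qed
qed

end


section \<open>The tiling by coloured chambers\<close>

lemma simplicial_complex_image:
  assumes "simplicial_complex K" shows "simplicial_complex (image f ` K)"
  unfolding simplicial_complex_def
proof (intro conjI ballI allI impI)
  fix \<sigma> assume "\<sigma> \<in> image f ` K"
  then obtain \<tau> where \<tau>: "\<tau> \<in> K" "\<sigma> = f ` \<tau>" by blast
  then show "finite \<sigma>" "\<sigma> \<noteq> {}" using assms by (auto simp: simplicial_complex_def)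
  fix \<rho> assume \<rho>: "\<rho> \<noteq> {} \<and> \<rho> \<subseteq> \<sigma>"
  then obtain \<tau>' where "\<tau>' \<subseteq> \<tau>" "\<rho> = f ` \<tau>'" using \<tau>(2) by (metis subset_imageE)
  moreover from this have "\<tau>' \<in> K" using assms \<tau>(1) \<rho> unfolding simplicial_complex_def by blast
  ultimately show "\<rho> \<in> image f ` K" by blast
qed

context racg
begin

text \<open>Even numbers name cone points, one for each colour; odd numbers name the remaining types and
do not depend on the colour, so tiles of all colours share their boundary.\<close>

definition vertex_code :: "nat \<Rightarrow> 'a set option \<Rightarrow> nat" where
  "vertex_code c v = (case v of None \<Rightarrow> 2 * c | Some \<sigma> \<Rightarrow> 2 * to_nat_on (nerve G S) \<sigma> + 1)"

definition vertex_decode :: "nat \<Rightarrow> 'a set option" where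
  "vertex_decode m = (if even m then None else Some (from_nat_into (nerve G S) (m div 2)))"

lemma vertex_decode_code [simp]: "v \<in> types \<Longrightarrow> vertex_decode (vertex_code c v) = v"
  using finite_nerve
  by (cases v) (auto simp: vertex_code_def vertex_decode_def countable_finite)

lemma inj_on_vertex_code: "inj_on (vertex_code c) types"
  by (metis inj_onI vertex_decode_code)

lemma vertex_code_None [simp]: "vertex_code c None = 2 * c"
  by (simp add: vertex_code_def)

lemma vertex_code_colour: "v \<noteq> None \<Longrightarrow> vertex_code c v = vertex_code c' v"
  by (cases v) (simp_all add: vertex_code_def)

definition tile :: "nat \<Rightarrow> nat set set" where
  "tile c = image (vertex_code c) ` chamber G S"

definition mirror :: "'a \<Rightarrow> 'a set option set set" where
  "mirror s = {\<tau> \<in> chamber G S. \<forall>v\<in>\<tau>. s \<in> type_set v}"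

definition face :: "'a \<Rightarrow> nat set set" where
  "face s = image (vertex_code 0) ` mirror s"

lemma None_notin_mirror: "\<tau> \<in> mirror s \<Longrightarrow> None \<notin> \<tau>"
  by (auto simp: mirror_def)

lemma face_eq: "face s = image (vertex_code c) ` mirror s"
proof -
  have "vertex_code 0 ` \<tau> = vertex_code c ` \<tau>" if "\<tau> \<in> mirror s" for \<tau>
    using None_notin_mirror[OF that] vertex_code_colour[of _ 0 c] by (metis image_cong)
  then show ?thesis by (simp add: face_def)
qed

lemma face_subset_tile: "face s \<subseteq> tile c"
  unfolding face_eq[of s c] tile_def by (auto simp: mirror_def)

lemma simplicial_complex_tile: "simplicial_complex (tile c)"
  unfolding tile_def by (rule simplicial_complex_image[OF simplicial_complex_chamber])

lemma simplicial_complex_face: "simplicial_complex (face s)"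
proof -
  have "simplicial_complex (mirror s)"
    using simplicial_complex_chamber by (auto simp: simplicial_complex_def mirror_def)
  then show ?thesis unfolding face_def by (rule simplicial_complex_image)
qed

lemma decode_image:
  assumes "\<tau> \<in> chamber G S" shows "vertex_decode ` vertex_code c ` \<tau> = \<tau>"
proof -
  have "vertex_decode ` vertex_code c ` \<tau> = (\<lambda>v. v) ` \<tau>"
    unfolding image_image
  proof (rule image_cong)
    fix v assume "v \<in> \<tau>"
    then have "v \<in> types" using chamberD(2)[OF assms] by blast
    then show "vertex_decode (vertex_code c v) = v" by simp
  qed simp
  then show ?thesis by simp
qed

lemma code_vtype_image:
  assumes "a \<in> carrier G" "\<tau> \<in> chamber G S"
  shows "(vertex_code c \<circ> vtype) ` dv a ` \<tau> = vertex_code c ` \<tau>"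
  unfolding image_image
proof (rule image_cong)
  fix v assume "v \<in> \<tau>"
  then have "v \<in> types" using chamberD(2)[OF assms(2)] by blast
  then show "(vertex_code c \<circ> vtype) (dv a v) = vertex_code c v" using assms(1) by simp
qed simp

lemma code_in_face_iff:
  assumes "\<tau> \<in> chamber G S"
  shows "vertex_code c ` \<tau> \<in> face s \<longleftrightarrow> (\<forall>v\<in>\<tau>. s \<in> type_set v)"
proof
  assume "vertex_code c ` \<tau> \<in> face s"
  then obtain \<tau>' where \<tau>': "\<tau>' \<in> mirror s" "vertex_code c ` \<tau> = vertex_code c ` \<tau>'"
    unfolding face_eq[of s c] by blast
  have "\<tau>' \<in> chamber G S" using \<tau>'(1) by (simp add: mirror_def)
  moreover have "vertex_decode ` vertex_code c ` \<tau> = vertex_decode ` vertex_code c ` \<tau>'"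
    using \<tau>'(2) by (rule arg_cong)
  ultimately have "\<tau> = \<tau>'" using decode_image[of _ c] assms by metis
  then show "\<forall>v\<in>\<tau>. s \<in> type_set v" using \<tau>' by (simp add: mirror_def)
next
  assume "\<forall>v\<in>\<tau>. s \<in> type_set v"
  then show "vertex_code c ` \<tau> \<in> face s"
    unfolding face_eq[of s c] using assms by (auto simp: mirror_def)
qed

lemma card_code_image: "\<tau> \<in> chamber G S \<Longrightarrow> card (vertex_code c ` \<tau>) = card \<tau>"
  by (rule card_image[OF inj_on_subset[OF inj_on_vertex_code chamberD(2)]])

definition encode :: "nat \<Rightarrow> (('a \<times> 'a set option) set \<Rightarrow> real) \<Rightarrow> nat \<Rightarrow> real" where
  "encode c = push (vertex_code c \<circ> vtype)"

text \<open>The copy of a point of a tile in the chamber of \<open>a\<close>. The decoding forgets the colour, so it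
serves all tiles.\<close>

definition decode_at :: "'a \<Rightarrow> (nat \<Rightarrow> real) \<Rightarrow> ('a \<times> 'a set option) set \<Rightarrow> real" where
  "decode_at a = push (dv a \<circ> vertex_decode)"

lemma support_encode:
  assumes "a \<in> carrier G" "x \<in> X" "\<tau> \<in> chamber G S" "support x = dv a ` \<tau>"
  shows "support (encode c x) = vertex_code c ` \<tau>"
proof -
  have "support (encode c x) = (vertex_code c \<circ> vtype) ` support x"
    unfolding encode_def by (rule support_push) (use davis_pointD[OF assms(2)] in auto)
  also have "\<dots> = vertex_code c ` \<tau>"
    unfolding assms(4) by (rule code_vtype_image[OF assms(1,3)])
  finally show ?thesis .
qed

lemma encode_in_realization:
  assumes a: "a \<in> carrier G" and x: "x \<in> piece a"
  shows "encode c x \<in> realization (tile c)"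
proof -
  have xX: "x \<in> X" using x piece_subset by blast
  obtain \<tau> where \<tau>: "\<tau> \<in> chamber G S" "support x = dv a ` \<tau>" using piece_support[OF a x] .
  have "(vertex_code c \<circ> vtype) ` support x = vertex_code c ` \<tau>"
    unfolding \<tau>(2) by (rule code_vtype_image[OF a \<tau>(1)])
  then have "(vertex_code c \<circ> vtype) ` support x \<in> tile c" using \<tau>(1) by (simp add: tile_def)
  then show ?thesis
    unfolding encode_def using xX simplicial_complex_davis
    by (intro push_in_realization[of "davis_complex G S"]) (auto simp: davis_space_def)
qed

lemma tile_point_support:
  assumes "u \<in> realization (tile c)"
  obtains \<tau> where "\<tau> \<in> chamber G S" "support u = vertex_code c ` \<tau>"
  using realizationD(3)[OF simplicial_complex_tile assms] by (auto simp: tile_def)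

lemma support_decode_at:
  assumes "u \<in> realization (tile c)" "\<tau> \<in> chamber G S" "support u = vertex_code c ` \<tau>"
  shows "support (decode_at a u) = dv a ` \<tau>"
proof -
  have "support (decode_at a u) = (dv a \<circ> vertex_decode) ` support u"
    unfolding decode_at_def
    by (rule support_push) (use realizationD[OF simplicial_complex_tile assms(1)] in auto)
  also have "\<dots> = dv a ` vertex_decode ` vertex_code c ` \<tau>" using assms(3) by (simp add: image_comp)
  finally show ?thesis using decode_image[OF assms(2)] by simp
qed

lemma decode_at_in_piece:
  assumes a: "a \<in> carrier G" and u: "u \<in> realization (tile c)"
  shows "decode_at a u \<in> piece a"
proof -
  obtain \<tau> where \<tau>: "\<tau> \<in> chamber G S" "support u = vertex_code c ` \<tau>" using tile_point_support[OF u] .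
  have "(dv a \<circ> vertex_decode) ` support u = dv a ` vertex_decode ` vertex_code c ` \<tau>"
    using \<tau>(2) by (simp add: image_comp)
  then have "(dv a \<circ> vertex_decode) ` support u \<in> davis_complex G S"
    using decode_image[OF \<tau>(1)] davis_simplex[OF a \<tau>(1)] by simp
  then have "decode_at a u \<in> X"
    unfolding decode_at_def davis_space_def by (rule push_in_realization[OF simplicial_complex_tile u])
  then show ?thesis using pieceI[OF _ \<tau>(1) support_decode_at[OF u \<tau>]] by blast
qed

text \<open>Encoding the chamber of \<open>a\<close> and decoding it in the chamber of \<open>b\<close> is the left translation by
\<open>b a\<^sup>-\<^sup>1\<close>.\<close>

lemma decode_at_encode:
  assumes a: "a \<in> carrier G" and b: "b \<in> carrier G" and x: "x \<in> piece a"
  shows "decode_at b (encode c x) = push (translate G (b \<otimes> inv a)) x"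
proof -
  obtain \<tau> where \<tau>: "\<tau> \<in> chamber G S" "support x = dv a ` \<tau>" using piece_support[OF a x] .
  have fin: "finite (support x)" using \<tau> chamberD(3) by simp
  have "decode_at b (encode c x) = push ((dv b \<circ> vertex_decode) \<circ> (vertex_code c \<circ> vtype)) x"
    unfolding decode_at_def encode_def by (rule push_push[OF fin])
  also have "\<dots> = push (translate G (b \<otimes> inv a)) x"
  proof (rule push_cong)
    fix D assume "D \<in> support x"
    then obtain v where v: "D = dv a v" "v \<in> \<tau>" using \<tau>(2) by blast
    then have "v \<in> types" using chamberD(2)[OF \<tau>(1)] by blast
    then show "((dv b \<circ> vertex_decode) \<circ> (vertex_code c \<circ> vtype)) D = translate G (b \<otimes> inv a) D"
      using v a b by (simp add: translate_davis_vertex m_assoc)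
  qed
  finally show ?thesis .
qed

lemma decode_at_encode_same:
  assumes a: "a \<in> carrier G" and x: "x \<in> piece a"
  shows "decode_at a (encode c x) = x"
proof -
  obtain \<tau> where \<tau>: "\<tau> \<in> chamber G S" "support x = dv a ` \<tau>" using piece_support[OF a x] .
  have "translate G \<one> D = D" if "D \<in> support x" for D
    using that \<tau>(2) a by (auto simp: translate_davis_vertex)
  then show ?thesis using decode_at_encode[OF a a x] a by (simp add: push_id)
qed

lemma encode_decode_at:
  assumes a: "a \<in> carrier G" and u: "u \<in> realization (tile c)"
  shows "encode c (decode_at a u) = u"
  unfolding encode_def decode_at_def
proof (rule push_inverse)
  show "finite (support u)" using realizationD[OF simplicial_complex_tile u] by blast
  obtain \<tau> where \<tau>: "\<tau> \<in> chamber G S" "support u = vertex_code c ` \<tau>" using tile_point_support[OF u] .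
  fix m assume "m \<in> support u"
  then obtain v where v: "v \<in> \<tau>" "m = vertex_code c v" using \<tau>(2) by blast
  then have "v \<in> types" using chamberD(2)[OF \<tau>(1)] by blast
  then show "(vertex_code c \<circ> vtype) ((dv a \<circ> vertex_decode) m) = m" using v a by simp
qed

lemma bij_betw_encode:
  assumes a: "a \<in> carrier G"
  shows "bij_betw (encode c) (piece a) (realization (tile c))"
  by (rule bij_betw_byWitness[where f' = "decode_at a"])
    (use a decode_at_encode_same encode_decode_at encode_in_realization decode_at_in_piece in auto)

lemma decode_at_apply:
  assumes a: "a \<in> carrier G" and u: "u \<in> realization (tile c)" and v: "v \<in> types"
  shows "decode_at a u (dv a v) = u (vertex_code c v)"
proof -
  obtain \<tau> where \<tau>: "\<tau> \<in> chamber G S" "support u = vertex_code c ` \<tau>" using tile_point_support[OF u] .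
  have "inj_on (dv a \<circ> vertex_decode) (vertex_code c ` types)"
    by (rule comp_inj_on) (auto intro: inj_onI inj_on_subset[OF inj_on_davis_vertex[OF a]])
  then have "decode_at a u ((dv a \<circ> vertex_decode) (vertex_code c v)) = u (vertex_code c v)"
    unfolding decode_at_def
    by (rule push_inj_apply) (use \<tau> chamberD(2)[OF \<tau>(1)] v in auto)
  then show ?thesis using v by simp
qed

text \<open>The metric of the tiles is that of the chamber of \<open>1\<close> as a subspace of \<open>X\<close>; by homogeneity
every other chamber has the same one.\<close>

definition decoded_dist :: "(nat \<Rightarrow> real) \<Rightarrow> (nat \<Rightarrow> real) \<Rightarrow> real" where
  "decoded_dist u w = davis_dist G S (decode_at \<one> u) (decode_at \<one> w)"

lemma decode_at_in_X: "u \<in> realization (tile c) \<Longrightarrow> decode_at \<one> u \<in> X"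
  using decode_at_in_piece[of \<one>] piece_subset by blast

lemma Metric_space_tile: "Metric_space (realization (tile c)) decoded_dist"
proof
  fix u v w
  show "0 \<le> decoded_dist u v" by (simp add: decoded_dist_def)
  show "decoded_dist u v = decoded_dist v u" by (simp add: decoded_dist_def davis_metric.commute)
  assume u: "u \<in> realization (tile c)" and v: "v \<in> realization (tile c)"
  show "decoded_dist u v = 0 \<longleftrightarrow> u = v"
    unfolding decoded_dist_def using u v decode_at_in_X encode_decode_at[OF one_closed] by (metis davis_metric.zero)
  assume w: "w \<in> realization (tile c)"
  show "decoded_dist u w \<le> decoded_dist u v + decoded_dist v w"
    unfolding decoded_dist_def using u v w by (intro davis_metric.triangle decode_at_in_X)
qed

lemma coordinate_Lipschitz:
  assumes u: "u \<in> realization (tile c)" and w: "w \<in> realization (tile c)"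
  shows "\<bar>u m - w m\<bar> \<le> 2 * decoded_dist u w"
proof (cases "m \<in> vertex_code c ` types")
  case True
  then obtain v where v: "v \<in> types" "m = vertex_code c v" by blast
  then show ?thesis
    using weight_Lipschitz[OF decode_at_in_X[OF u] decode_at_in_X[OF w], of "dv \<one> v"]
      decode_at_apply[OF one_closed u v(1)] decode_at_apply[OF one_closed w v(1)]
    by (simp add: decoded_dist_def)
next
  case False
  have "z m = 0" if z: "z \<in> realization (tile c)" for z
  proof -
    obtain \<tau> where \<tau>: "\<tau> \<in> chamber G S" "support z = vertex_code c ` \<tau>" using tile_point_support[OF z] .
    then have "m \<notin> support z" using False chamberD(2)[OF \<tau>(1)] by blast
    then show ?thesis by (simp add: support_def)
  qed
  then have "u m = 0" "w m = 0" using u w by blast+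
  then show ?thesis by (simp add: decoded_dist_def)
qed

text \<open>If \<open>w\<close> differs from \<open>u\<close> by less than the weights of \<open>u\<close>, then the support of \<open>w\<close> contains
that of \<open>u\<close>, and both points lie in a common simplex.\<close>

lemma decoded_dist_small:
  assumes u: "u \<in> realization (tile c)" and w: "w \<in> realization (tile c)"
    and \<delta>: "\<And>m. m \<in> vertex_code c ` types \<Longrightarrow> \<bar>w m - u m\<bar> < \<delta>"
    and sup: "\<And>m. m \<in> support u \<Longrightarrow> \<delta> \<le> u m"
  shows "decoded_dist u w \<le> real (card S * card types) * \<delta>"
proof -
  obtain \<tau> where \<tau>: "\<tau> \<in> chamber G S" "support u = vertex_code c ` \<tau>" using tile_point_support[OF u] .
  obtain \<rho> where \<rho>: "\<rho> \<in> chamber G S" "support w = vertex_code c ` \<rho>" using tile_point_support[OF w] .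
  have "vertex_code c None \<in> vertex_code c ` types" by (rule imageI) simp
  then have "\<delta> > 0" using \<delta>[of "vertex_code c None"] by linarith
  have "support u \<subseteq> support w"
  proof
    fix m assume m: "m \<in> support u"
    then have "m \<in> vertex_code c ` types" using \<tau> chamberD(2)[OF \<tau>(1)] by blast
    then have "w m > 0" using \<delta>[of m] sup[OF m] by force
    then show "m \<in> support w" by (simp add: support_def)
  qed
  then have "\<tau> \<subseteq> \<rho>" using decode_image \<tau> \<rho> by (metis image_mono)
  then have sub: "support (decode_at \<one> u) \<subseteq> dv \<one> ` \<rho>" "support (decode_at \<one> w) \<subseteq> dv \<one> ` \<rho>"
    using support_decode_at[OF u \<tau>] support_decode_at[OF w \<rho>] by auto
  have "decoded_dist u w \<le> real (card S) * (\<Sum>D\<in>dv \<one> ` \<rho>. \<bar>decode_at \<one> u D - decode_at \<one> w D\<bar>)"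
    unfolding decoded_dist_def using u w \<rho> sub
    by (intro davis_dist_le_weights decode_at_in_X davis_simplex) auto
  also have "\<dots> \<le> real (card S) * (\<Sum>D\<in>dv \<one> ` \<rho>. \<delta>)"
  proof (intro mult_left_mono sum_mono)
    fix D assume "D \<in> dv \<one> ` \<rho>"
    then obtain v where v: "v \<in> types" "D = dv \<one> v" using chamberD(2)[OF \<rho>(1)] by blast
    then show "\<bar>decode_at \<one> u D - decode_at \<one> w D\<bar> \<le> \<delta>"
      using \<delta>[of "vertex_code c v"] decode_at_apply[OF one_closed u v(1)] decode_at_apply[OF one_closed w v(1)]
      by simp
  qed simp
  also have "\<dots> = real (card S) * (real (card (dv \<one> ` \<rho>)) * \<delta>)" by simp
  also have "\<dots> \<le> real (card S) * (real (card types) * \<delta>)"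
  proof (intro mult_left_mono mult_right_mono)
    have "card (dv \<one> ` \<rho>) \<le> card \<rho>" using chamberD(3)[OF \<rho>(1)] by (rule card_image_le)
    also have "\<dots> \<le> card types" using finite_types chamberD(2)[OF \<rho>(1)] by (rule card_mono)
    finally show "real (card (dv \<one> ` \<rho>)) \<le> real (card types)" by simp
  qed (use \<open>\<delta> > 0\<close> in auto)
  finally show ?thesis by (simp add: mult.assoc)
qed

text \<open>The identity is continuous in both directions by \<open>decoded_dist_small\<close> and
\<open>coordinate_Lipschitz\<close>.\<close>

lemma mtopology_tile:
  "Metric_space.mtopology (realization (tile c)) decoded_dist = top_of_set (realization (tile c))"
proof -
  let ?M = "realization (tile c)"
  interpret M: Metric_space ?M decoded_dist by (rule Metric_space_tile)
  have to_metric: "continuous_map (top_of_set ?M) M.mtopology id"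
    unfolding M.continuous_map_to_metric
  proof (intro ballI allI impI)
    fix u and \<epsilon> :: real assume "u \<in> topspace (top_of_set ?M)" and \<epsilon>: "\<epsilon> > 0"
    then have u: "u \<in> ?M" by simp
    define N where "N = real (card S * card types)"
    \<comment> \<open>small enough for the sum over all vertices and below every positive weight of \<open>u\<close>\<close>
    define \<delta> where "\<delta> = Min (insert (\<epsilon> / (N + 1)) (u ` support u))"
    have fin: "finite (support u)" using realizationD[OF simplicial_complex_tile u] by blast
    have pos: "\<delta> > 0"
    proof -
      have "0 < u m" if "m \<in> support u" for m
        using that realizationD(4)[OF simplicial_complex_tile u, of m] by (simp add: support_def less_le)
      moreover have "0 < \<epsilon> / (N + 1)" using \<epsilon> by (simp add: N_def add_nonneg_pos)
      ultimately show ?thesis unfolding \<delta>_def using fin by (subst Min_gr_iff) auto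
    qed
    have sup: "\<delta> \<le> u m" if "m \<in> support u" for m
      unfolding \<delta>_def using fin that by (intro Min_le) auto
    have "\<delta> \<le> \<epsilon> / (N + 1)" unfolding \<delta>_def using fin by (intro Min_le) auto
    then have "N * \<delta> \<le> N * (\<epsilon> / (N + 1))" by (intro mult_left_mono) (auto simp: N_def)
    also have "\<dots> < \<epsilon>"
    proof -
      have "N \<ge> 0" by (simp add: N_def)
      then show ?thesis using \<epsilon> by (simp add: field_simps)
    qed
    finally have small: "N * \<delta> < \<epsilon>" .
    define U where "U = (\<Inter>m\<in>vertex_code c ` types. {w :: nat \<Rightarrow> real. \<bar>w m - u m\<bar> < \<delta>})"
    have "open U"
      unfolding U_def using finite_types
      by (intro open_INT ballI open_Collect_less continuous_intros continuous_on_product_coordinates) auto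
    then have "openin (top_of_set ?M) (?M \<inter> U)" by (rule openin_open_Int)
    moreover have "u \<in> ?M \<inter> U" using u pos by (simp add: U_def)
    moreover have "id w \<in> M.mball (id u) \<epsilon>" if "w \<in> ?M \<inter> U" for w
    proof -
      have "decoded_dist u w \<le> N * \<delta>"
        unfolding N_def using that u sup by (intro decoded_dist_small[of u c w \<delta>]) (auto simp: U_def)
      then show ?thesis using small u that by simp
    qed
    ultimately show "\<exists>U. openin (top_of_set ?M) U \<and> u \<in> U \<and> (\<forall>w\<in>U. id w \<in> M.mball (id u) \<epsilon>)"
      by blast
  qed
  have "continuous_map M.mtopology euclideanreal (\<lambda>u. u m)" for m
    unfolding M.continuous_map_from_metric
  proof (intro conjI ballI allI impI)
    fix u and U :: "real set" assume u: "u \<in> ?M" and U: "openin euclidean U \<and> u m \<in> U"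
    then obtain e where e: "e > 0" "\<And>y. dist y (u m) < e \<Longrightarrow> y \<in> U"
      by (auto simp: open_dist)
    show "\<exists>r>0. \<forall>w. w \<in> ?M \<and> decoded_dist u w < r \<longrightarrow> w m \<in> U"
    proof (intro exI[of _ "e / 2"] conjI allI impI e(2))
      fix w assume w: "w \<in> ?M \<and> decoded_dist u w < e / 2"
      then have "\<bar>u m - w m\<bar> \<le> 2 * decoded_dist u w" using coordinate_Lipschitz[OF u] by blast
      then show "dist (w m) (u m) < e" using w by (simp add: dist_real_def abs_minus_commute)
    qed (use e in simp)
  qed simp
  then have "continuous_map M.mtopology euclidean (id :: (nat \<Rightarrow> real) \<Rightarrow> _)"
    by (simp add: continuous_map_componentwise_UNIV flip: euclidean_product_topology)
  then have from_metric: "continuous_map M.mtopology (top_of_set ?M) id"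
    by (simp add: continuous_map_in_subtopology)
  have "openin M.mtopology U \<longleftrightarrow> openin (top_of_set ?M) U" for U
  proof
    assume U: "openin M.mtopology U"
    then have "U \<subseteq> ?M" using openin_subset by fastforce
    then have "{x \<in> topspace (top_of_set ?M). id x \<in> U} = U" by auto
    then show "openin (top_of_set ?M) U" using openin_continuous_map_preimage[OF to_metric U] by simp
  next
    assume U: "openin (top_of_set ?M) U"
    then have "U \<subseteq> ?M" using openin_subset by fastforce
    then have "{x \<in> topspace M.mtopology. id x \<in> U} = U" by auto
    then show "openin M.mtopology U" using openin_continuous_map_preimage[OF from_metric U] by simp
  qed
  then show ?thesis by (simp add: topology_eq)
qed

definition chamber_tiles :: "nat \<Rightarrow> tile_set" where
  "chamber_tiles k = \<lparr>tiles = tile ` {..<k}, tile_dist = \<lambda>_. decoded_dist,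
     faces = face ` S, opposite = id\<rparr>"

definition piece_index :: "(('a \<times> 'a set option) set \<Rightarrow> real) set \<Rightarrow> 'a" where
  "piece_index = the_inv_into (carrier G) piece"

lemma piece_index [simp]: "a \<in> carrier G \<Longrightarrow> piece_index (piece a) = a"
  unfolding piece_index_def by (rule the_inv_into_f_f[OF inj_on_piece])

definition chamber_tiling :: "('a \<Rightarrow> nat) \<Rightarrow> (('a \<times> 'a set option) set \<Rightarrow> real) tiling" where
  "chamber_tiling f = \<lparr>pieces = piece ` carrier G,
     target = (\<lambda>t. tile (f (piece_index t))), chart = (\<lambda>t. encode (f (piece_index t)))\<rparr>"

text \<open>A simplex of a mirror extends by the cone point, so mirrors have smaller dimension than the
chamber.\<close>

lemma is_tile_set_chamber_tiles:
  assumes "k > 0"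
  shows "is_tile_set (Max (card ` chamber G S) - 1) (chamber_tiles k)"
proof -
  let ?n = "Max (card ` chamber G S) - 1"
  have ne: "card ` chamber G S \<noteq> {}" using singleton_chamber[OF None_types] by blast
  have fin: "finite (card ` chamber G S)" using finite_chamber by simp
  have le: "card \<tau> \<le> Max (card ` chamber G S)" if "\<tau> \<in> chamber G S" for \<tau>
    using Max_ge[OF fin] that by blast
  have pos: "Max (card ` chamber G S) > 0"
    using le[OF singleton_chamber[OF None_types]] by simp
  obtain \<tau>0 where \<tau>0: "\<tau>0 \<in> chamber G S" "card \<tau>0 = Max (card ` chamber G S)"
    using Max_in[OF fin ne] by (metis imageE)
  have tile: "finite (tile c) \<and> simplicial_complex (tile c) \<and> (\<forall>\<sigma>\<in>tile c. card \<sigma> \<le> ?n + 1) \<and>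
      (\<exists>\<sigma>\<in>tile c. card \<sigma> = ?n + 1)" for c
  proof (intro conjI ballI)
    show "finite (tile c)" by (simp add: tile_def finite_chamber)
    show "simplicial_complex (tile c)" by (rule simplicial_complex_tile)
    show "card \<sigma> \<le> ?n + 1" if "\<sigma> \<in> tile c" for \<sigma>
      using that le pos by (auto simp: tile_def card_code_image)
    show "\<exists>\<sigma>\<in>tile c. card \<sigma> = ?n + 1"
      using \<tau>0 pos by (intro bexI[of _ "vertex_code c ` \<tau>0"]) (auto simp: tile_def card_code_image)
  qed
  have face: "simplicial_complex (face s) \<and> face s \<noteq> {} \<and> (\<forall>\<sigma>\<in>face s. card \<sigma> \<le> ?n) \<and> face s \<subseteq> tile 0"
    if s: "s \<in> S" for s
  proof (intro conjI ballI)
    show "simplicial_complex (face s)" by (rule simplicial_complex_face)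
    have "{Some {s}} \<in> mirror s"
      using s singleton_chamber singleton_nerve by (simp add: mirror_def)
    then show "face s \<noteq> {}" unfolding face_def by blast
    show "face s \<subseteq> tile 0" by (rule face_subset_tile)
    show "card \<sigma> \<le> ?n" if \<sigma>: "\<sigma> \<in> face s" for \<sigma>
    proof -
      obtain \<tau> where \<tau>: "\<tau> \<in> mirror s" "\<sigma> = vertex_code 0 ` \<tau>" using \<sigma> by (auto simp: face_def)
      then have \<tau>c: "\<tau> \<in> chamber G S" by (simp add: mirror_def)
      have "card (insert None \<tau>) = card \<tau> + 1"
        using None_notin_mirror[OF \<tau>(1)] chamberD(3)[OF \<tau>c] by simp
      then show ?thesis
        using le[OF chamber_insert_None[OF \<tau>c]] \<tau>(2) card_code_image[OF \<tau>c] by simp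
    qed
  qed
  have metric: "Metric_space (realization (tile c)) decoded_dist"
    "Metric_space.mtopology (realization (tile c)) decoded_dist = top_of_set (realization (tile c))" for c
    by (rule Metric_space_tile mtopology_tile)+
  have "tile 0 \<in> tile ` {..<k}" using assms by simp
  then show ?thesis
    unfolding is_tile_set_def chamber_tiles_def using tile metric
    by (auto dest: face)
qed

lemma tile_faces_chamber: "tile_faces (chamber_tiles k) (chamber_tiling f) t = face ` S"
  using face_subset_tile by (auto simp: tile_faces_def chamber_tiles_def chamber_tiling_def)

lemma piece_face_eq:
  assumes a: "a \<in> carrier G" and s: "s \<in> S"
  shows "piece_face (chamber_tiling f) (piece a) (face s) = piece a \<inter> piece (a \<otimes> s)"
proof -
  have "encode c x \<in> realization (face s) \<longleftrightarrow> x \<in> piece (a \<otimes> s)" if x: "x \<in> piece a" for x c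
  proof -
    have xX: "x \<in> X" using x piece_subset by blast
    obtain \<tau> where \<tau>: "\<tau> \<in> chamber G S" "support x = dv a ` \<tau>" using piece_support[OF a x] .
    have "encode c x \<in> realization (tile c)" using encode_in_realization[OF a x] .
    then have "encode c x \<in> realization (face s) \<longleftrightarrow> support (encode c x) \<in> face s"
      by (simp add: realization_def)
    also have "\<dots> \<longleftrightarrow> (\<forall>v\<in>\<tau>. s \<in> type_set v)"
      using support_encode[OF a xX \<tau>] code_in_face_iff[OF \<tau>(1)] by simp
    also have "\<dots> \<longleftrightarrow> x \<in> piece (a \<otimes> s)" using in_neighbour_iff[OF a s xX \<tau>] by simp
    finally show ?thesis .
  qed
  then show ?thesis using a by (auto simp: piece_face_def chamber_tiling_def)
qed

lemma is_tiling_chamber_tiling: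
  assumes f: "\<forall>x\<in>carrier G. f x < k"
  shows "is_tiling X (davis_dist G S) (chamber_tiles k) (chamber_tiling f)"
  unfolding is_tiling_def Let_def tile_faces_chamber
proof (intro conjI ballI impI)
  let ?\<Phi> = "chamber_tiling f" and ?T = "chamber_tiles k"
  have pieces: "pieces ?\<Phi> = piece ` carrier G" by (simp add: chamber_tiling_def)
  show "\<Union>(pieces ?\<Phi>) = X"
    unfolding pieces
  proof (intro equalityI subsetI)
    fix x assume "x \<in> X"
    then obtain a where "a \<in> carrier G" "x \<in> piece a" by (rule point_in_some_piece)
    then show "x \<in> \<Union>(piece ` carrier G)" by blast
  qed (use piece_subset in blast)
  fix t assume "t \<in> pieces ?\<Phi>"
  then obtain a where a: "a \<in> carrier G" and t: "t = piece a" unfolding pieces by blast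
  have target: "target ?\<Phi> t = tile (f a)" and chart: "chart ?\<Phi> t = encode (f a)"
    using a by (simp_all add: t chamber_tiling_def)
  show "target ?\<Phi> t \<in> tiles ?T" using f a by (simp add: target chamber_tiles_def)
  show "bij_betw (chart ?\<Phi> t) t (realization (target ?\<Phi> t))"
    unfolding target chart unfolding t by (rule bij_betw_encode[OF a])
  show "tile_dist ?T (target ?\<Phi> t) (chart ?\<Phi> t x) (chart ?\<Phi> t y) = davis_dist G S x y"
    if "x \<in> t" "y \<in> t" for x y
  proof -
    have xy: "x \<in> piece a" "y \<in> piece a" "x \<in> X" "y \<in> X" using that piece_subset unfolding t by auto
    have "tile_dist ?T (target ?\<Phi> t) (chart ?\<Phi> t x) (chart ?\<Phi> t y)
        = decoded_dist (encode (f a) x) (encode (f a) y)"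
      by (simp add: chart chamber_tiles_def)
    also have "\<dots> = davis_dist G S (push (translate G (inv a)) x) (push (translate G (inv a)) y)"
      using xy a by (simp add: decoded_dist_def decode_at_encode[OF a one_closed])
    also have "\<dots> = davis_dist G S x y" using xy a by (intro davis_dist_translate) auto
    finally show ?thesis .
  qed
  show "t - (\<Union>g\<in>face ` S. piece_face ?\<Phi> t g) = intr t"
  proof -
    have "x \<in> (\<Union>s\<in>S. piece_face ?\<Phi> t (face s)) \<longleftrightarrow> dv a None \<notin> support x" if x: "x \<in> piece a" for x
    proof
      assume "x \<in> (\<Union>s\<in>S. piece_face ?\<Phi> t (face s))"
      then obtain s where s: "s \<in> S" "x \<in> piece (a \<otimes> s)" using piece_face_eq[OF a] t by blast
      then show "dv a None \<notin> support x"
        using cone_point_unique[OF a _ s(2)] mult_generator_neq[OF a s(1)] a S_in by auto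
    next
      assume "dv a None \<notin> support x"
      then obtain s where "s \<in> S" "x \<in> piece (a \<otimes> s)" using boundary_has_neighbour[OF a x] by blast
      then show "x \<in> (\<Union>s\<in>S. piece_face ?\<Phi> t (face s))" using piece_face_eq[OF a] x t by blast
    qed
    then show ?thesis unfolding t interior_piece[OF a] by blast
  qed
  show "\<exists>g\<in>face ` S. opposite ?T g \<in> face ` S \<and> t \<inter> t' = piece_face ?\<Phi> t g \<and>
      t \<inter> t' = piece_face ?\<Phi> t' (opposite ?T g)"
    if t': "t' \<in> pieces ?\<Phi>" and neq: "intr (t \<union> t') \<noteq> intr t \<union> intr t'" for t'
  proof -
    obtain b where b: "b \<in> carrier G" "t' = piece b" using t' unfolding pieces by blast
    obtain s where s: "s \<in> S" "b = a \<otimes> s"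
      using interior_union_adjacent[OF a b(1)] neq unfolding t b(2) by blast
    have "a = b \<otimes> s" using s a S_in by (simp add: m_assoc S_square)
    then have "piece_face ?\<Phi> t (face s) = t \<inter> t'" "piece_face ?\<Phi> t' (face s) = t' \<inter> t"
      using piece_face_eq[OF a s(1)] piece_face_eq[OF b(1) s(1)] s(2) t b(2) by simp_all
    then show ?thesis using s(1) by (intro bexI[of _ "face s"]) (auto simp: chamber_tiles_def)
  qed
  show "\<exists>t'\<in>pieces ?\<Phi> - {t}. \<exists>g'\<in>face ` S. piece_face ?\<Phi> t g = piece_face ?\<Phi> t' g'"
    if g: "g \<in> face ` S" for g
  proof -
    obtain s where s: "s \<in> S" "g = face s" using g by blast
    have as: "a \<otimes> s \<in> carrier G" using a S_in[OF s(1)] by simp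
    have "piece (a \<otimes> s) \<noteq> piece a"
      using inj_on_piece as a mult_generator_neq[OF a s(1)] by (metis inj_onD)
    moreover have "piece_face ?\<Phi> t g = piece_face ?\<Phi> (piece (a \<otimes> s)) g"
      using piece_face_eq[OF a s(1)] piece_face_eq[OF as s(1)] a S_in[OF s(1)] s t
      by (auto simp: m_assoc S_square)
    ultimately show ?thesis using as g by (intro bexI[of _ "piece (a \<otimes> s)"]) (auto simp: pieces t)
  qed
qed

end


section \<open>Rigidity of the limit tilings\<close>

context racg
begin

text \<open>Touching is preserved by every bijection that permutes the pieces. The invariance of
adjacency would require an argument about interiors.\<close>

definition touching :: "'a \<Rightarrow> 'a \<Rightarrow> bool" where
  "touching a b \<longleftrightarrow> piece a \<inter> piece b \<noteq> {}"

inductive chain_of_pieces :: "'a \<Rightarrow> nat \<Rightarrow> 'a \<Rightarrow> bool" where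
  start: "a \<in> carrier G \<Longrightarrow> chain_of_pieces a 0 a"
| step: "chain_of_pieces a n b \<Longrightarrow> c \<in> carrier G \<Longrightarrow> touching b c \<Longrightarrow> chain_of_pieces a (Suc n) c"

lemma chain_of_pieces_carrier: "chain_of_pieces a n b \<Longrightarrow> a \<in> carrier G \<and> b \<in> carrier G"
  by (induction rule: chain_of_pieces.induct) auto

text \<open>The displacements between touching chambers. They form a finite set because the nerve and
its special subgroups are finite.\<close>

definition touching_steps :: "'a set" where
  "touching_steps = insert \<one> (\<Union>\<sigma>\<in>nerve G S. generate G \<sigma>)"

lemma finite_touching_steps: "finite touching_steps"
  unfolding touching_steps_def using finite_nerve finite_generate_nerve by auto

lemma touching_step:
  assumes a: "a \<in> carrier G" and b: "b \<in> carrier G" and ab: "touching a b"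
  shows "inv a \<otimes> b \<in> touching_steps"
proof -
  obtain x where x: "x \<in> piece a" "x \<in> piece b" using ab by (auto simp: touching_def)
  have xX: "x \<in> X" using x piece_subset by blast
  obtain \<tau> where \<tau>: "\<tau> \<in> chamber G S" "support x = dv a ` \<tau>" using piece_support[OF a x(1)] .
  obtain v where v: "v \<in> \<tau>" using chamberD(1)[OF \<tau>(1)] by blast
  have "inv a \<otimes> b \<in> vertex_group G v" using in_piece_iff[OF a b xX \<tau>] x(2) v by blast
  moreover have "v \<in> types" using v chamberD(2)[OF \<tau>(1)] by blast
  ultimately show ?thesis by (cases v) (auto simp: touching_steps_def)
qed

lemma finite_chain_ends: "a \<in> carrier G \<Longrightarrow> finite {b. chain_of_pieces a n b}"
proof (induction n)
  case 0
  have "{b. chain_of_pieces a 0 b} \<subseteq> {a}" by (auto elim: chain_of_pieces.cases)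
  then show ?case by (rule finite_subset) simp
next
  case (Suc n)
  have "{c. chain_of_pieces a (Suc n) c} \<subseteq> (\<lambda>(b, g). b \<otimes> g) ` ({b. chain_of_pieces a n b} \<times> touching_steps)"
  proof
    fix c assume "c \<in> {c. chain_of_pieces a (Suc n) c}"
    then obtain b where b: "chain_of_pieces a n b" "c \<in> carrier G" "touching b c"
      by (auto elim: chain_of_pieces.cases)
    have bc: "b \<in> carrier G" using chain_of_pieces_carrier[OF b(1)] by blast
    have "c = b \<otimes> (inv b \<otimes> c)" using bc b(2) by (simp add: cancel_inv_left)
    moreover have "inv b \<otimes> c \<in> touching_steps" using touching_step[OF bc b(2,3)] .
    ultimately show "c \<in> (\<lambda>(b, g). b \<otimes> g) ` ({b. chain_of_pieces a n b} \<times> touching_steps)"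
      using b(1) by force
  qed
  then show ?case using Suc finite_touching_steps by (auto intro: finite_subset)
qed

text \<open>This bound is independent of the chamber in which the chain starts.\<close>

lemma finite_chain_displacements: "finite {inv a \<otimes> b | a b. chain_of_pieces a n b}"
proof (induction n)
  case 0
  have "{inv a \<otimes> b | a b. chain_of_pieces a 0 b} \<subseteq> {\<one>}" by (auto elim: chain_of_pieces.cases)
  then show ?case by (rule finite_subset) simp
next
  case (Suc n)
  let ?D = "{inv a \<otimes> b | a b. chain_of_pieces a n b}"
  have "{inv a \<otimes> c | a c. chain_of_pieces a (Suc n) c} \<subseteq> (\<lambda>(d, g). d \<otimes> g) ` (?D \<times> touching_steps)"
  proof clarify
    fix a c assume "chain_of_pieces a (Suc n) c"
    then obtain b where b: "chain_of_pieces a n b" "c \<in> carrier G" "touching b c"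
      by (auto elim: chain_of_pieces.cases)
    have ab: "a \<in> carrier G" "b \<in> carrier G" using chain_of_pieces_carrier[OF b(1)] by auto
    have "inv a \<otimes> c = (inv a \<otimes> b) \<otimes> (inv b \<otimes> c)"
      using ab b(2) by (simp add: m_assoc cancel_inv_left)
    moreover have "inv b \<otimes> c \<in> touching_steps" using touching_step[OF ab(2) b(2,3)] .
    ultimately show "inv a \<otimes> c \<in> (\<lambda>(d, g). d \<otimes> g) ` (?D \<times> touching_steps)"
      using b(1) by force
  qed
  moreover have "finite (?D \<times> touching_steps)" using Suc finite_touching_steps by blast
  ultimately show ?case by (meson finite_imageI finite_subset)
qed


definition permutes_pieces :: "((('a \<times> 'a set option) set \<Rightarrow> real) \<Rightarrow> (('a \<times> 'a set option) set \<Rightarrow> real)) \<Rightarrow> bool" where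
  "permutes_pieces g \<longleftrightarrow> bij_betw g X X \<and> (\<forall>a\<in>carrier G. g ` piece a \<in> piece ` carrier G)"

definition piece_map :: "((('a \<times> 'a set option) set \<Rightarrow> real) \<Rightarrow> (('a \<times> 'a set option) set \<Rightarrow> real)) \<Rightarrow> 'a \<Rightarrow> 'a" where
  "piece_map g a = piece_index (g ` piece a)"

lemma piece_map_image:
  assumes "permutes_pieces g" "a \<in> carrier G"
  shows "g ` piece a = piece (piece_map g a)" "piece_map g a \<in> carrier G"
proof -
  obtain b where "b \<in> carrier G" "g ` piece a = piece b"
    using assms by (auto simp: permutes_pieces_def)
  then show "g ` piece a = piece (piece_map g a)" "piece_map g a \<in> carrier G"
    by (simp_all add: piece_map_def)
qed

lemma piece_map_point:
  assumes "permutes_pieces g" "a \<in> carrier G" "x \<in> piece a"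
  shows "g x \<in> piece (piece_map g a)"
  using piece_map_image(1)[OF assms(1,2)] assms(3) by blast

lemma permutes_pieces_inj: "permutes_pieces g \<Longrightarrow> inj_on g X"
  by (auto simp: permutes_pieces_def bij_betw_def)

lemma piece_map_inj:
  assumes g: "permutes_pieces g" and a: "a \<in> carrier G" and b: "b \<in> carrier G"
    and eq: "piece_map g a = piece_map g b"
  shows "a = b"
proof -
  have "g ` piece a = g ` piece b" using piece_map_image[OF g] a b eq by simp
  then have "piece a = piece b"
    using inj_on_image_eq_iff[OF permutes_pieces_inj[OF g] piece_subset piece_subset] by blast
  then show ?thesis using inj_on_piece a b by (metis inj_onD)
qed

lemma piece_map_surj:
  assumes g: "permutes_pieces g" and b: "b \<in> carrier G"
  obtains a where "a \<in> carrier G" "piece_map g a = b"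
proof -
  let ?p = "vertex_point (dv b None)"
  have "?p \<in> g ` X" using g vertex_point_davis[OF b None_types] by (simp add: permutes_pieces_def bij_betw_def)
  then obtain x where x: "x \<in> X" "?p = g x" by blast
  obtain a where a: "a \<in> carrier G" "x \<in> piece a" using point_in_some_piece[OF x(1)] .
  have "?p \<in> piece (piece_map g a)" using piece_map_point[OF g a] x(2) by simp
  then have "b = piece_map g a" using cone_point_unique[OF b piece_map_image(2)[OF g a(1)]] by simp
  then show ?thesis using that a(1) by blast
qed

lemma touching_piece_map_iff:
  assumes g: "permutes_pieces g" and a: "a \<in> carrier G" and b: "b \<in> carrier G"
  shows "touching (piece_map g a) (piece_map g b) \<longleftrightarrow> touching a b"
proof -
  have "g ` (piece a \<inter> piece b) = piece (piece_map g a) \<inter> piece (piece_map g b)"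
    using inj_on_image_Int[OF permutes_pieces_inj[OF g] piece_subset piece_subset]
      piece_map_image(1)[OF g a] piece_map_image(1)[OF g b] by simp
  then show ?thesis unfolding touching_def by (metis image_is_empty)
qed

lemma chain_of_pieces_map:
  assumes g: "permutes_pieces g" and "chain_of_pieces a n b"
  shows "chain_of_pieces (piece_map g a) n (piece_map g b)"
  using assms(2)
proof (induction rule: chain_of_pieces.induct)
  case (start a)
  then show ?case using piece_map_image(2)[OF g] by (intro chain_of_pieces.start)
next
  case (step a n b c)
  have "b \<in> carrier G" using chain_of_pieces_carrier[OF step(1)] by blast
  then have "touching (piece_map g b) (piece_map g c)"
    using touching_piece_map_iff[OF g _ step(2)] step(3) by blast
  then show ?case using step.IH piece_map_image(2)[OF g step(2)] by (intro chain_of_pieces.step)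
qed

lemma vertex_point_in_neighbour:
  assumes a: "a \<in> carrier G" and s: "s \<in> S"
  shows "vertex_point (dv a (Some {s})) \<in> piece a \<inter> piece (a \<otimes> s)"
proof -
  have v: "Some {s} \<in> types" using singleton_nerve[OF s] by simp
  have "vertex_point (dv a (Some {s})) \<in> piece (a \<otimes> s)"
    using in_neighbour_iff[OF a s vertex_point_davis[OF a v] singleton_chamber[OF v]] by simp
  then show ?thesis using vertex_point_in_piece[OF a v] by blast
qed

lemma touching_neighbour: "a \<in> carrier G \<Longrightarrow> s \<in> S \<Longrightarrow> touching a (a \<otimes> s)"
  using vertex_point_in_neighbour unfolding touching_def by blast

lemma chain_of_word:
  assumes "w \<in> lists S" "a \<in> carrier G"
  shows "chain_of_pieces a (length w) (a \<otimes> word_value G w)"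
  using assms
proof (induction w rule: rev_induct)
  case Nil
  then show ?case by (simp add: chain_of_pieces.start)
next
  case (snoc s w)
  then have w: "w \<in> lists S" "s \<in> S" "s \<in> carrier G" by (auto simp: S_in)
  have val: "a \<otimes> word_value G (w @ [s]) = a \<otimes> word_value G w \<otimes> s"
    using w snoc.prems by (simp add: word_value_append m_assoc)
  have aw: "a \<otimes> word_value G w \<in> carrier G" using w snoc.prems by simp
  show ?case
    unfolding val using snoc.IH[OF w(1) snoc.prems(2)] aw w(3) touching_neighbour[OF aw w(2)]
    by (auto intro: chain_of_pieces.step)
qed

lemma decode_at_encode_vertex_point:
  assumes "a \<in> carrier G" "v \<in> types"
  shows "decode_at b (encode c (vertex_point (dv a v))) = vertex_point (dv b v)"
  using assms by (simp add: decode_at_def encode_def)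

text \<open>On the piece of \<open>b\<close>, the conjugate of \<open>h\<close> by \<open>g\<close> respects the charts and the colours of the
tiling.\<close>

definition locally_fixed where
  "locally_fixed f g h b \<longleftrightarrow>
     f (piece_map g (piece_map h b)) = f (piece_map g b) \<and>
     (\<forall>x\<in>piece b. encode (f (piece_map g b)) (g (h x)) = encode (f (piece_map g b)) (g x))"

text \<open>Charts record types, and a chamber has a single vertex of each type.\<close>

lemma locally_fixed_vertex_point:
  assumes g: "permutes_pieces g" and h: "permutes_pieces h" and b: "b \<in> carrier G"
    and fixed: "locally_fixed f g h b"
    and x: "x \<in> piece b" "g x = vertex_point (dv a v)" and a: "a \<in> carrier G" "v \<in> types"
  shows "g (h x) = vertex_point (dv (piece_map g (piece_map h b)) v)"
proof -
  let ?u = "piece_map g (piece_map h b)"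
  have hb: "piece_map h b \<in> carrier G" using piece_map_image(2)[OF h b] .
  have "g (h x) \<in> piece ?u"
    using piece_map_point[OF g hb piece_map_point[OF h b x(1)]] .
  then have "g (h x) = decode_at ?u (encode (f (piece_map g b)) (g (h x)))"
    using decode_at_encode_same[OF piece_map_image(2)[OF g hb]] by simp
  also have "\<dots> = decode_at ?u (encode (f (piece_map g b)) (vertex_point (dv a v)))"
    using fixed x by (simp add: locally_fixed_def)
  also have "\<dots> = vertex_point (dv ?u v)" using a by (rule decode_at_encode_vertex_point)
  finally show ?thesis .
qed

text \<open>Where the conjugate of \<open>h\<close> by \<open>g\<close> respects the charts, it is the same left translation on
all chambers of a chain. The path spelled by \<open>w\<close> runs through the images under \<open>g\<close>, where
successive chambers differ by a generator; in the source the corresponding chambers merely touch,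
since \<open>g\<close> need not preserve types. Across the mirror between \<open>u\<close> and \<open>u s\<close> the translation cannot
change: the image of its barycentre lies in \<open>u'\<close> and \<open>u' s\<close> only, and the images of two distinct
chambers are distinct.\<close>

lemma displacement_propagates:
  assumes g: "permutes_pieces g" and h: "permutes_pieces h" and a: "a \<in> carrier G"
    and w: "w \<in> lists S" "length w \<le> n"
    and fixed: "\<And>m b. m \<le> n \<Longrightarrow> chain_of_pieces a m b \<Longrightarrow> locally_fixed f g h b"
  shows "\<exists>b. chain_of_pieces a (length w) b \<and> piece_map g b = piece_map g a \<otimes> word_value G w \<and>
    piece_map g (piece_map h b) = piece_map g (piece_map h a) \<otimes> word_value G w"
  using w
proof (induction w rule: rev_induct)
  case Nil
  have "piece_map g a \<in> carrier G" "piece_map g (piece_map h a) \<in> carrier G"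
    using piece_map_image(2)[OF g] piece_map_image(2)[OF h] a by auto
  then show ?case using a by (intro exI[of _ a]) (simp add: chain_of_pieces.start)
next
  case (snoc s w)
  then have w: "w \<in> lists S" "length w \<le> n" and s: "s \<in> S" "s \<in> carrier G" by (auto simp: S_in)
  obtain b where b: "chain_of_pieces a (length w) b" "piece_map g b = piece_map g a \<otimes> word_value G w"
    "piece_map g (piece_map h b) = piece_map g (piece_map h a) \<otimes> word_value G w"
    using snoc.IH[OF w] by blast
  let ?u = "piece_map g b" and ?u' = "piece_map g (piece_map h b)"
  have bc: "b \<in> carrier G" using chain_of_pieces_carrier[OF b(1)] by blast
  have hb: "piece_map h b \<in> carrier G" using piece_map_image(2)[OF h bc] .
  have u: "?u \<in> carrier G" "?u' \<in> carrier G" using piece_map_image(2)[OF g] bc hb by auto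
  have us: "?u \<otimes> s \<in> carrier G" using u s by simp
  obtain b' where b': "b' \<in> carrier G" "piece_map g b' = ?u \<otimes> s" using piece_map_surj[OF g us] .
  have "touching b b'"
    using touching_neighbour[OF u(1) s(1)] touching_piece_map_iff[OF g bc b'(1)] b'(2) by simp
  then have chain': "chain_of_pieces a (Suc (length w)) b'"
    using b(1) b'(1) by (intro chain_of_pieces.step)
  let ?v' = "piece_map g (piece_map h b')"
  have hb': "piece_map h b' \<in> carrier G" using piece_map_image(2)[OF h b'(1)] .
  have v': "?v' \<in> carrier G" using piece_map_image(2)[OF g hb'] .
  let ?p = "vertex_point (dv ?u (Some {s}))"
  have type: "Some {s} \<in> types" using singleton_nerve[OF s(1)] by simp
  have p: "?p \<in> piece ?u" "?p \<in> piece (?u \<otimes> s)" using vertex_point_in_neighbour[OF u(1) s(1)] by auto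
  obtain x where x: "x \<in> piece b" "?p = g x" using p(1) piece_map_image(1)[OF g bc] by blast
  obtain x' where x': "x' \<in> piece b'" "?p = g x'"
    using p(2) piece_map_image(1)[OF g b'(1)] b'(2) by auto
  have "x = x'"
    using permutes_pieces_inj[OF g] x x' piece_subset by (metis inj_onD subsetD)
  have "g (h x) = vertex_point (dv ?u' (Some {s}))"
    using locally_fixed_vertex_point[OF g h bc fixed[OF w(2) b(1)] x(1) x(2)[symmetric] u(1) type] .
  moreover have "g (h x) = vertex_point (dv ?v' (Some {s}))"
    using locally_fixed_vertex_point[OF g h b'(1) fixed[OF _ chain'] _ _ u(1) type, of x] x x' snoc.prems(2)
      \<open>x = x'\<close> by simp
  ultimately have "dv ?u' (Some {s}) = dv ?v' (Some {s})" by simp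
  then have "inv ?u' \<otimes> ?v' \<in> {\<one>, s}"
    using davis_vertex_eq_iff[OF u(2) v' type type] generate_singleton[OF s(1)] by simp
  \<comment> \<open>distinct chambers have distinct images\<close>
  moreover have "inv ?u' \<otimes> ?v' \<noteq> \<one>"
  proof
    assume "inv ?u' \<otimes> ?v' = \<one>"
    then have "?u' = ?v'" using u v' by (metis inv_equality inv_inv inv_closed)
    then have "b = b'" using piece_map_inj[OF g hb hb'] piece_map_inj[OF h bc b'(1)] by blast
    then show False using b'(2) mult_generator_neq[OF u(1) s(1)] by simp
  qed
  ultimately have "inv ?u' \<otimes> ?v' = s" by blast
  then have "?v' = ?u' \<otimes> s" using u v' cancel_inv_left(1)[of ?u' ?v'] by simp
  moreover have "word_value G (w @ [s]) = word_value G w \<otimes> s"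
    using w s by (simp add: word_value_append)
  moreover have "piece_map g a \<in> carrier G" "piece_map g (piece_map h a) \<in> carrier G"
    using piece_map_image(2)[OF g] piece_map_image(2)[OF h] a by auto
  ultimately show ?case
    using chain' b b' w s by (intro exI[of _ b']) (simp add: m_assoc)
qed

text \<open>The colour of a tile is seen at its only even vertex.\<close>

lemma tile_inject:
  assumes "tile c = tile c'" shows "c = c'"
proof -
  have "vertex_code c ` {None} \<in> tile c'"
    using assms singleton_chamber[OF None_types] unfolding tile_def by blast
  then obtain \<tau> where \<tau>: "\<tau> \<in> chamber G S" "{2 * c} = vertex_code c' ` \<tau>" by (auto simp: tile_def)
  obtain v where v: "v \<in> \<tau>" using chamberD(1)[OF \<tau>(1)] by blast
  then have eq: "vertex_code c' v = 2 * c" using \<tau>(2) by blast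
  have "v = None"
  proof (cases v)
    case (Some \<sigma>)
    then have "odd (vertex_code c' v)" by (simp add: vertex_code_def)
    then show ?thesis using eq by simp
  qed
  then show ?thesis using eq by simp
qed

lemma pieces_chamber_tiling [simp]: "pieces (chamber_tiling f) = piece ` carrier G"
  and target_chamber_tiling [simp]: "a \<in> carrier G \<Longrightarrow> target (chamber_tiling f) (piece a) = tile (f a)"
  and chart_chamber_tiling [simp]: "a \<in> carrier G \<Longrightarrow> chart (chamber_tiling f) (piece a) = encode (f a)"
  by (simp_all add: chamber_tiling_def)

lemma decomposition_preserving_permutes:
  assumes "decomposition_preserving X d \<Psi> g" "pieces \<Psi> = piece ` carrier G"
  shows "permutes_pieces g"
  using assms by (auto simp: decomposition_preserving_def isometry_of_def permutes_pieces_def)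

text \<open>The charts of \<open>\<Psi>\<close> at \<open>b\<close> and at its image under \<open>h\<close> are known from the pullback; the
isometry \<open>h\<close> identifies them.\<close>

lemma locally_fixedI:
  assumes g: "permutes_pieces g" and h: "permutes_pieces h" and b: "b \<in> carrier G"
    and iso: "agree_on (piece b) (pullback h \<Psi>) \<Psi>"
    and ag: "agree_on (piece b) \<Psi> (pullback g (chamber_tiling f))"
      "agree_on (piece (piece_map h b)) \<Psi> (pullback g (chamber_tiling f))"
  shows "locally_fixed f g h b"
proof -
  let ?c = "f (piece_map g b)" and ?c' = "f (piece_map g (piece_map h b))"
  have hb: "piece_map h b \<in> carrier G" using piece_map_image(2)[OF h b] .
  have 1: "target \<Psi> (piece b) = tile ?c" "\<forall>x\<in>piece b. chart \<Psi> (piece b) x = encode ?c (g x)"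
    using ag(1) piece_map_image[OF g b] by (simp_all add: agree_on_def pullback_def)
  have 2: "target \<Psi> (piece (piece_map h b)) = tile ?c'"
    "\<forall>x\<in>piece (piece_map h b). chart \<Psi> (piece (piece_map h b)) x = encode ?c' (g x)"
    using ag(2) piece_map_image[OF g hb] by (simp_all add: agree_on_def pullback_def)
  have 3: "target \<Psi> (piece (piece_map h b)) = target \<Psi> (piece b)"
    "\<forall>x\<in>piece b. chart \<Psi> (piece (piece_map h b)) (h x) = chart \<Psi> (piece b) x"
    using iso piece_map_image[OF h b] by (simp_all add: agree_on_def pullback_def)
  have c: "?c' = ?c" using 1(1) 2(1) 3(1) tile_inject by metis
  moreover have "encode ?c (g (h x)) = encode ?c (g x)" if x: "x \<in> piece b" for x
    using 1(2) 2(2) 3(2) x piece_map_point[OF h b x] c by metis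
  ultimately show ?thesis by (simp add: locally_fixed_def)
qed

text \<open>The displacements that can occur lie in a finite set fixed in advance, so a single finite
set of chambers serves for all \<open>i\<close>, and the agreement of \<open>\<Psi>\<close> with the pullbacks is needed there
only.\<close>

theorem limit_tiling_strongly_aperiodic:
  assumes f: "\<And>d. d \<in> carrier G - {\<one>} \<Longrightarrow> \<exists>W\<subseteq>carrier G. finite W \<and>
      (\<forall>g\<in>carrier G. \<exists>t\<in>W. f (g \<otimes> t) \<noteq> f (g \<otimes> (d \<otimes> t)))"
    and lim: "limit_tiling X (davis_dist G S) T (chamber_tiling f) \<Psi>"
  shows "strongly_aperiodic X (davis_dist G S) \<Psi>"
  unfolding strongly_aperiodic_def
proof (intro allI impI ballI)
  fix h x assume iso: "tiling_isometry X (davis_dist G S) \<Psi> h" and x: "x \<in> X"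
  have pieces: "pieces \<Psi> = piece ` carrier G" using lim by (simp add: limit_tiling_def)
  have h: "permutes_pieces h"
    using iso pieces decomposition_preserving_permutes by (auto simp: tiling_isometry_def)
  have h_agree: "agree_on (piece b) (pullback h \<Psi>) \<Psi>" if "b \<in> carrier G" for b
    using iso pieces that by (simp add: tiling_isometry_def)
  obtain g where g: "\<And>i :: nat. permutes_pieces (g i)"
    and ev: "\<And>b. b \<in> carrier G \<Longrightarrow>
      \<forall>\<^sub>F i in sequentially. agree_on (piece b) \<Psi> (pullback (g i) (chamber_tiling f))"
  proof -
    obtain g where "\<forall>i :: nat. decomposition_preserving X (davis_dist G S) (chamber_tiling f) (g i)"
      "\<forall>t\<in>piece ` carrier G. \<exists>i0. \<forall>i\<ge>i0. agree_on t \<Psi> (pullback (g i) (chamber_tiling f))"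
      using lim unfolding limit_tiling_def pieces_chamber_tiling by blast
    then show ?thesis
      using that[of g] decomposition_preserving_permutes pieces_chamber_tiling
      unfolding eventually_sequentially by blast
  qed
  obtain a where a: "a \<in> carrier G" "x \<in> piece a" using point_in_some_piece[OF x] .
  have ha: "piece_map h a \<in> carrier G" using piece_map_image(2)[OF h a(1)] .
  \<comment> \<open>some chain leads from \<open>a\<close> to its image; its length bounds the displacements of all
    conjugates of \<open>h\<close>\<close>
  obtain w0 where w0: "w0 \<in> lists S" "word_value G w0 = inv a \<otimes> piece_map h a"
    using carrier_word[of "inv a \<otimes> piece_map h a"] a(1) ha by auto
  have chain0: "chain_of_pieces a (length w0) (piece_map h a)"
    using chain_of_word[OF w0(1) a(1)] w0(2) a(1) ha by (simp add: cancel_inv_left)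
  define D where "D = {inv a \<otimes> b | a b. chain_of_pieces a (length w0) b}"
  have D: "finite D" unfolding D_def by (rule finite_chain_displacements)
  have "\<forall>d\<in>carrier G - {\<one>}. \<exists>W. W \<subseteq> carrier G \<and> finite W \<and>
      (\<forall>g\<in>carrier G. \<exists>t\<in>W. f (g \<otimes> t) \<noteq> f (g \<otimes> (d \<otimes> t)))"
    using f by blast
  from bchoice[OF this] obtain W where W: "\<And>d. d \<in> carrier G - {\<one>} \<Longrightarrow> W d \<subseteq> carrier G \<and> finite (W d) \<and>
      (\<forall>g\<in>carrier G. \<exists>t\<in>W d. f (g \<otimes> t) \<noteq> f (g \<otimes> (d \<otimes> t)))"
    by blast
  \<comment> \<open>all points at which a displacement in \<open>D\<close> may have to be detected, reached by words of
    length at most \<open>n\<close>\<close>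
  define V where "V = (\<Union>d\<in>D \<inter> (carrier G - {\<one>}). W d)"
  have Wd: "finite (W d)" "W d \<subseteq> carrier G" if "d \<in> D \<inter> (carrier G - {\<one>})" for d
    using W[of d] that by simp_all
  have V: "finite V" "V \<subseteq> carrier G"
  proof -
    show "finite V" unfolding V_def by (rule finite_UN_I[OF finite_Int[OF disjI1[OF D]] Wd(1)])
    show "V \<subseteq> carrier G" unfolding V_def by (rule UN_least[OF Wd(2)])
  qed
  have "\<forall>t\<in>V. \<exists>w. w \<in> lists S \<and> word_value G w = t"
  proof
    fix t assume "t \<in> V"
    then have "t \<in> carrier G" using V(2) by (rule subsetD[rotated])
    then obtain w where "w \<in> lists S" "word_value G w = t" by (rule carrier_word)
    then show "\<exists>w. w \<in> lists S \<and> word_value G w = t" by (intro exI[of _ w] conjI)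
  qed
  from bchoice[OF this] obtain wd where wd: "\<And>t. t \<in> V \<Longrightarrow> wd t \<in> lists S \<and> word_value G (wd t) = t"
    by blast
  obtain n where n: "\<And>t. t \<in> V \<Longrightarrow> length (wd t) \<le> n"
  proof -
    have "finite ((\<lambda>t. length (wd t)) ` V)" using V(1) by simp
    then obtain n where "\<forall>m\<in>(\<lambda>t. length (wd t)) ` V. m \<le> n"
      using finite_nat_set_iff_bounded_le by metis
    then show ?thesis using that by blast
  qed
  \<comment> \<open>the chambers in which agreement with the pullback is needed, whatever the displacement\<close>
  define B where "B = (\<Union>m\<le>n. {b. chain_of_pieces a m b})"
  have B: "finite B" "B \<subseteq> carrier G"
    using finite_chain_ends[OF a(1)] chain_of_pieces_carrier by (auto simp: B_def)
  have "\<forall>\<^sub>F i in sequentially. \<forall>b\<in>B. agree_on (piece b) \<Psi> (pullback (g i) (chamber_tiling f)) \<and>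
      agree_on (piece (piece_map h b)) \<Psi> (pullback (g i) (chamber_tiling f))"
  proof (rule eventually_ball_finite[OF B(1)], rule ballI)
    fix b assume "b \<in> B"
    then have b: "b \<in> carrier G" using B(2) by blast
    show "\<forall>\<^sub>F i in sequentially. agree_on (piece b) \<Psi> (pullback (g i) (chamber_tiling f)) \<and>
      agree_on (piece (piece_map h b)) \<Psi> (pullback (g i) (chamber_tiling f))"
      by (rule eventually_conj[OF ev ev[OF piece_map_image(2)[OF h b]]]) (rule b)
  qed
  then obtain i where i: "\<And>b. b \<in> B \<Longrightarrow> agree_on (piece b) \<Psi> (pullback (g i) (chamber_tiling f)) \<and>
      agree_on (piece (piece_map h b)) \<Psi> (pullback (g i) (chamber_tiling f))"
    unfolding eventually_sequentially by blast
  have fixed: "locally_fixed f (g i) h b" if "m \<le> n" "chain_of_pieces a m b" for m b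
  proof -
    have b: "b \<in> B" "b \<in> carrier G" using that B(2) by (auto simp: B_def)
    then show ?thesis using locally_fixedI[OF g h b(2) h_agree] i by blast
  qed
  let ?u = "piece_map (g i) a" and ?u' = "piece_map (g i) (piece_map h a)"
  have u: "?u \<in> carrier G" "?u' \<in> carrier G" using piece_map_image(2)[OF g] a(1) ha by auto
  define d where "d = inv ?u \<otimes> ?u'"
  have dc: "d \<in> carrier G" using u by (simp add: d_def)
  have "d \<in> D" unfolding D_def d_def using chain_of_pieces_map[OF g chain0] by blast
  have "d = \<one>"
  proof (rule ccontr)
    assume "d \<noteq> \<one>"
    then have d: "d \<in> carrier G - {\<one>}" using dc by simp
    then obtain t where t: "t \<in> W d" "f (?u \<otimes> t) \<noteq> f (?u \<otimes> (d \<otimes> t))" using W u(1) by blast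
    have tV: "t \<in> V" using t(1) d \<open>d \<in> D\<close> by (auto simp: V_def)
    then have tc: "t \<in> carrier G" using V(2) by blast
    obtain b where b: "chain_of_pieces a (length (wd t)) b" "piece_map (g i) b = ?u \<otimes> t"
      "piece_map (g i) (piece_map h b) = ?u' \<otimes> t"
    proof -
      have w: "wd t \<in> lists S" "word_value G (wd t) = t" using wd[OF tV] by simp_all
      have "\<exists>b. chain_of_pieces a (length (wd t)) b \<and>
          piece_map (g i) b = ?u \<otimes> word_value G (wd t) \<and>
          piece_map (g i) (piece_map h b) = ?u' \<otimes> word_value G (wd t)"
      proof (rule displacement_propagates[OF g h a(1) w(1) n[OF tV]])
        show "locally_fixed f (g i) h b" if "m \<le> n" "chain_of_pieces a m b" for m b
          using that by (rule fixed)
      qed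
      then show ?thesis using that unfolding w(2) by blast
    qed
    have "?u' \<otimes> t = ?u \<otimes> (d \<otimes> t)" using u tc by (simp add: d_def m_assoc cancel_inv_left)
    then show False using fixed[OF n[OF tV] b(1)] b t(2) by (simp add: locally_fixed_def)
  qed
  then have "?u' = ?u" using u cancel_inv_left(1)[of ?u ?u'] by (simp add: d_def)
  then have "piece_map h a = a" using piece_map_inj[OF g ha a(1)] by blast
  then have ha_eq: "h ` piece a = piece a" using piece_map_image(1)[OF h a(1)] by simp
  then have "chart \<Psi> (piece a) (h x) = chart \<Psi> (piece a) x"
    using h_agree[OF a(1)] a(2) by (simp add: agree_on_def pullback_def)
  moreover have "inj_on (chart \<Psi> (piece a)) (piece a)"
  proof -
    have "is_tiling X (davis_dist G S) T \<Psi>" using lim by (simp add: limit_tiling_def)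
    moreover have "piece a \<in> pieces \<Psi>" using pieces a(1) by simp
    ultimately have "bij_betw (chart \<Psi> (piece a)) (piece a) (realization (target \<Psi> (piece a)))"
      unfolding is_tiling_def Let_def by (elim conjE) (drule (1) bspec, elim conjE, assumption)
    then show ?thesis by (rule bij_betw_imp_inj_on)
  qed
  ultimately show "h x = x" using a(2) ha_eq by (metis image_eqI inj_onD)
qed

text \<open>With this, the tiling itself is covered by the statement about its limits.\<close>

lemma limit_tiling_self:
  assumes "is_tiling X d T \<Phi>" shows "limit_tiling X d T \<Phi> \<Phi>"
  unfolding limit_tiling_def
proof (intro conjI exI[of _ "\<lambda>_. id"] allI ballI exI[of _ 0] impI)
  show "decomposition_preserving X d \<Phi> id"
    by (simp add: decomposition_preserving_def isometry_of_def)
  show "agree_on t \<Phi> (pullback id \<Phi>)" for t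
    by (simp add: agree_on_def pullback_def)
qed (use assms in simp_all)

end

theorem theorem1p7:
  fixes G :: "('g, 'm) monoid_scheme" and S :: "'g set"
  assumes "right_angled_coxeter_group G S"
    and "hyperbolic_group G S"
  shows "\<exists>(n :: nat) (T :: tile_set) (\<Phi> :: (('g \<times> 'g set option) set \<Rightarrow> real) tiling).
    is_tile_set n T \<and>
    is_tiling (davis_space G S) (davis_dist G S) T \<Phi> \<and>
    strongly_aperiodic (davis_space G S) (davis_dist G S) \<Phi> \<and>
    (\<forall>\<Psi>. limit_tiling (davis_space G S) (davis_dist G S) T \<Phi> \<Psi> \<longrightarrow>
       strongly_aperiodic (davis_space G S) (davis_dist G S) \<Psi>)"
proof -
  interpret group G using assms(1) by (simp add: right_angled_coxeter_group_def)
  interpret racg G S by unfold_locales (rule assms(1))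
  obtain k and f :: "'g \<Rightarrow> nat" where fk: "\<forall>x\<in>carrier G. f x < k"
    and f: "\<forall>d\<in>carrier G - {\<one>\<^bsub>G\<^esub>}. \<exists>W\<subseteq>carrier G. finite W \<and>
      (\<forall>g\<in>carrier G. \<exists>t\<in>W. f (g \<otimes>\<^bsub>G\<^esub> t) \<noteq> f (g \<otimes>\<^bsub>G\<^esub> (d \<otimes>\<^bsub>G\<^esub> t)))"
    using exists_limit_aperiodic_colouring[OF countable_carrier] by blast
  have "k > 0" using fk one_closed by fastforce
  have tiling: "is_tiling (davis_space G S) (davis_dist G S) (chamber_tiles k) (chamber_tiling f)"
    using fk by (rule is_tiling_chamber_tiling)
  have limit: "strongly_aperiodic (davis_space G S) (davis_dist G S) \<Psi>"
    if "limit_tiling (davis_space G S) (davis_dist G S) (chamber_tiles k) (chamber_tiling f) \<Psi>" for \<Psi>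
    by (rule limit_tiling_strongly_aperiodic[OF bspec[OF f] that])
  show ?thesis
    using is_tile_set_chamber_tiles[OF \<open>k > 0\<close>] tiling limit[OF limit_tiling_self[OF tiling]] limit
    by blast
qed

end
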